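(* Suppose $(\sigma_i\sigma_j)^{m_{i,j}}=1$ is a defining relation for $W$, where $(m_{i,j})$ is the Coxeter matrix of $\Phi$. Then, as operators on $\mathcal{K}$, $$\mathcal{D}_i\mathcal{D}_j\mathcal{D}_i\cdots=\mathcal{D}_j\mathcal{D}_i\mathcal{D}_j\cdots,\qquad \mathcal{T}_i\mathcal{T}_j\mathcal{T}_i\cdots=\mathcal{T}_j\mathcal{T}_i\mathcal{T}_j\cdots,$$ where there are $m_{i,j}$ factors on both sides of each equality.
   Context: Root data. $\Phi$ is an irreducible reduced root system of rank $r$ with Weyl group $W$ and simple roots $\alpha_1,\dots,\alpha_r$; $\sigma_i\in W$ is the simple reflection of $\alpha_i$. $\Lambda$ is a lattice containing $\Phi$ as a subset, on which $W$ acts, and $Q$ is a $W$-invariant $\mathbb{Z}$-valued quadratic form on $\Lambda$, with bilinear form $B(\alpha,\beta)=Q(\alpha+\beta)-Q(\alpha)-Q(\beta)$. Fix a positive integer $n$. Put $m(\alpha)=n/\gcd(n,Q(\alpha))$ for $\alpha\in\Phi$ (not to be confused with the Coxeter matrix entries $m_{i,j}$), and $\Lambda_0=\{\lambda\in\Lambda: B(\alpha,\lambda)\equiv0 \bmod n\text{ for all simple roots }\alpha\}$. Let $\lambda\mapsto\bar\lambda$ be the projection $\Lambda\to\Lambda/\Lambda_0$. $\mathcal{K}$ is the field of fractions of the ring $\mathbb{C}[\Lambda]$ of Laurent polynomials on $\Lambda$ (with basis $x^\lambda$, $\lambda\in\Lambda$). The permutation action $(w,f)\mapsto w.f$ of $W$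 on $\mathcal{K}$ is given by $w.x^\lambda=x^{w\lambda}$, extended linearly and multiplicatively. Each character $\xi$ of $\Lambda/\Lambda_0$ acts on $\mathcal{K}$ by the field automorphism over $\mathbb{C}$ with $\xi(x^\lambda)=\xi(\bar\lambda)x^\lambda$; put $\mathcal{K}_{\bar\lambda}=\{f\in\mathcal{K}:\xi(f)=\xi(\bar\lambda)f\text{ for all }\xi\}$, so that $\mathcal{K}=\bigoplus_{\bar\lambda\in\Lambda/\Lambda_0}\mathcal{K}_{\bar\lambda}$. Parameters. $v,g_0,\dots,g_{n-1}$ are nonzero complex numbers with $g_0=-1$ and $g_ig_{n-i}=v^{-1}$ for $i=1,\dots,n-1$; for other integers $j$, $g_j:=g_{r_n(j)}$, where for a positive integer $m$, $r_m(j)\in\{0,\dots,m-1\}$ denotes the remainder of $j$ on division by $m$. Metaplectic action. For $f\in\mathcal{K}_{\bar\lambda}$, with $\lambda$ any lift of $\bar\lambda$ to $\Lambda$, $$\sigma_i(f)=\frac{\sigma_i.f}{1-vx^{m(\alpha_i)\alpha_i}}\cdot\Bigl[x^{-r_{m(\alpha_i)}\left(-\frac{B(\lambda,\alpha_i)}{Q(\alpha_i)}\right)\cdot\alpha_i}\cdot(1-v)-v\cdot g_{Q(\alpha_i)-B(\lambda,\alpha_i)}\cdot x^{(1-m(\alpha_i))\alpha_i}\cdot(1-x^{m(\alpha_i)\alpha_i})\Bigr],$$ extended to $\mathcal{K}$ by additivity. These operators satisfy the defining relations of $W$ (Chinta–Gunnells), so this extends to an action $(w,f)\mapsto w(f)$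 of $W$ on $\mathcal{K}$, which is $\mathbb{C}$-linear but in general not multiplicative. Demazure and Demazure–Lusztig operators, for $1\le i\le r$ and $f\in\mathcal{K}$, with $\sigma_i(f)$ the metaplectic action: $$\mathcal{D}_i(f)=\frac{f-x^{m(\alpha_i)\alpha_i}\cdot\sigma_i(f)}{1-x^{m(\alpha_i)\alpha_i}},\qquad \mathcal{T}_i(f)=\bigl(1-v\cdot x^{m(\alpha_i)\alpha_i}\bigr)\cdot\mathcal{D}_i(f)-f.$$ *)

theory Defs
  imports
    Complex_Main
    "HOL-Library.Poly_Mapping"
    "HOL-Computational_Algebra.Fraction_Field"
begin

text \<open>
  A lattice is a free abelian group of finite rank, here the group of integer-valued functions on
  a finite index type.  The linear order on the index type carries no mathematical content: it only
  makes the library's instances apply that turn the group ring into an integral domain.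
\<close>

type_synonym 'd lat = "'d \<Rightarrow>\<^sub>0 int"
type_synonym 'd laurent = "'d lat \<Rightarrow>\<^sub>0 complex"
type_synonym 'd ratfun = "'d laurent fract"

subsection \<open>Root systems in a lattice\<close>

text \<open>
  \<open>coroot \<alpha>\<close> is the linear form defining the reflection in \<open>\<alpha>\<close>.
\<close>

definition refl :: "('d lat \<Rightarrow> 'd lat \<Rightarrow> int) \<Rightarrow> 'd lat \<Rightarrow> 'd lat \<Rightarrow> 'd lat"
  where "refl coroot \<alpha> \<nu> = \<nu> - frag_cmul (coroot \<alpha> \<nu>) \<alpha>"

text \<open>
  The root system spans a subspace of the rational span of the lattice, which may be proper.
  On that subspace the coroots are uniquely determined, and the last clause is automatic; off it,
  the coroots record how the Weyl group acts on the rest of the lattice, and the last clause,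
  i.e. that the reflection in \<open>s\<^sub>\<beta>(\<alpha>)\<close> is the conjugate of that in \<open>\<alpha>\<close> by \<open>s\<^sub>\<beta>\<close>, says that the
  reflections do define an action of the Weyl group on the whole lattice.
\<close>

definition root_system :: "'d lat set \<Rightarrow> ('d lat \<Rightarrow> 'd lat \<Rightarrow> int) \<Rightarrow> bool"
  where "root_system \<Phi> coroot \<longleftrightarrow>
    finite \<Phi> \<and> 0 \<notin> \<Phi> \<and>
    (\<forall>\<alpha>\<in>\<Phi>. additive (coroot \<alpha>) \<and> coroot \<alpha> \<alpha> = 2) \<and>
    (\<forall>\<alpha>\<in>\<Phi>. \<forall>\<beta>\<in>\<Phi>. refl coroot \<alpha> \<beta> \<in> \<Phi>) \<and>
    (\<forall>\<alpha>\<in>\<Phi>. \<forall>\<beta>\<in>\<Phi>. \<forall>\<nu>. coroot (refl coroot \<beta> \<alpha>) (refl coroot \<beta> \<nu>) = coroot \<alpha> \<nu>)"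

definition reduced :: "'d lat set \<Rightarrow> bool"
  where "reduced \<Phi> \<longleftrightarrow>
    (\<forall>\<alpha>\<in>\<Phi>. \<forall>\<beta>\<in>\<Phi>. \<forall>p q. q \<noteq> 0 \<and> frag_cmul q \<beta> = frag_cmul p \<alpha> \<longrightarrow> \<beta> = \<alpha> \<or> \<beta> = - \<alpha>)"

definition irreducible_roots :: "'d lat set \<Rightarrow> ('d lat \<Rightarrow> 'd lat \<Rightarrow> int) \<Rightarrow> bool"
  where "irreducible_roots \<Phi> coroot \<longleftrightarrow> \<Phi> \<noteq> {} \<and>
    \<not> (\<exists>\<Phi>1 \<Phi>2. \<Phi>1 \<noteq> {} \<and> \<Phi>2 \<noteq> {} \<and> \<Phi>1 \<inter> \<Phi>2 = {} \<and> \<Phi>1 \<union> \<Phi>2 = \<Phi> \<and>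
         (\<forall>\<alpha>\<in>\<Phi>1. \<forall>\<beta>\<in>\<Phi>2. coroot \<alpha> \<beta> = 0 \<and> coroot \<beta> \<alpha> = 0))"

definition simple_roots :: "'d lat set \<Rightarrow> nat \<Rightarrow> (nat \<Rightarrow> 'd lat) \<Rightarrow> bool"
  where "simple_roots \<Phi> r \<alpha> \<longleftrightarrow>
    (\<forall>i\<in>{1..r}. \<alpha> i \<in> \<Phi>) \<and>
    (\<forall>c. (\<Sum>i=1..r. frag_cmul (c i) (\<alpha> i)) = 0 \<longrightarrow> (\<forall>i\<in>{1..r}. c i = 0)) \<and>
    (\<forall>\<beta>\<in>\<Phi>. \<exists>c. \<beta> = (\<Sum>i=1..r. frag_cmul (c i) (\<alpha> i)) \<and>
       ((\<forall>i\<in>{1..r}. 0 \<le> c i) \<or> (\<forall>i\<in>{1..r}. c i \<le> 0)))"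

inductive_set weyl_group :: "'d lat set \<Rightarrow> ('d lat \<Rightarrow> 'd lat \<Rightarrow> int) \<Rightarrow> ('d lat \<Rightarrow> 'd lat) set"
  for \<Phi> coroot where
  "id \<in> weyl_group \<Phi> coroot"
| "w \<in> weyl_group \<Phi> coroot \<Longrightarrow> \<alpha> \<in> \<Phi> \<Longrightarrow> refl coroot \<alpha> \<circ> w \<in> weyl_group \<Phi> coroot"

definition coxeter_entry :: "('d lat \<Rightarrow> 'd lat \<Rightarrow> int) \<Rightarrow> 'd lat \<Rightarrow> 'd lat \<Rightarrow> nat"
  where "coxeter_entry coroot \<alpha> \<beta> =
    (LEAST k. 0 < k \<and> (refl coroot \<alpha> \<circ> refl coroot \<beta>) ^^ k = id)"

subsection \<open>Quadratic forms\<close>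

definition bil :: "('d lat \<Rightarrow> int) \<Rightarrow> 'd lat \<Rightarrow> 'd lat \<Rightarrow> int"
  where "bil Q \<nu> \<mu> = Q (\<nu> + \<mu>) - Q \<nu> - Q \<mu>"

definition quadratic_form :: "('d lat \<Rightarrow> int) \<Rightarrow> bool"
  where "quadratic_form Q \<longleftrightarrow>
    (\<forall>k \<nu>. Q (frag_cmul k \<nu>) = k\<^sup>2 * Q \<nu>) \<and> (\<forall>\<mu>. additive (\<lambda>\<nu>. bil Q \<nu> \<mu>))"

definition mexp :: "nat \<Rightarrow> ('d lat \<Rightarrow> int) \<Rightarrow> 'd lat \<Rightarrow> int"
  where "mexp n Q \<alpha> = int n div gcd (int n) (Q \<alpha>)"

text \<open>\<open>S\<close> is the set of simple roots.\<close>

definition Lambda0 :: "'d lat set \<Rightarrow> ('d lat \<Rightarrow> int) \<Rightarrow> nat \<Rightarrow> 'd lat set"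
  where "Lambda0 S Q n = {\<nu>. \<forall>\<alpha>\<in>S. int n dvd bil Q \<alpha> \<nu>}"

subsection \<open>Rational functions on the lattice\<close>

definition cst :: "complex \<Rightarrow> 'd::{finite,linorder} ratfun"
  where "cst c = Fract (Poly_Mapping.single 0 c) 1"

definition X :: "'d::{finite,linorder} lat \<Rightarrow> 'd ratfun"
  where "X \<nu> = Fract (Poly_Mapping.single \<nu> 1) 1"

text \<open>
  For additive injective \<open>w\<close> and multiplicative nonvanishing \<open>c\<close>, the following is the
  endomorphism of the ring of Laurent polynomials, resp. of its fraction field, that is the identity
  on constants and maps \<open>x\<^sup>\<nu>\<close> to \<open>c(\<nu>) x\<^bsup>w \<nu>\<^esup>\<close> (for the fraction field this is proved below).
\<close>

definition subst_laurent ::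
    "('d lat \<Rightarrow> complex) \<Rightarrow> ('d lat \<Rightarrow> 'd lat) \<Rightarrow> 'd laurent \<Rightarrow> 'd laurent"
  where "subst_laurent c w p =
    (\<Sum>\<nu>\<in>Poly_Mapping.keys p. Poly_Mapping.single (w \<nu>) (c \<nu> * Poly_Mapping.lookup p \<nu>))"

definition subst_ratfun ::
    "('d lat \<Rightarrow> complex) \<Rightarrow> ('d lat \<Rightarrow> 'd lat) \<Rightarrow> 'd::{finite,linorder} ratfun \<Rightarrow> 'd ratfun"
  where "subst_ratfun c w f =
    (THE h. \<forall>p q. q \<noteq> 0 \<and> f = Fract p q \<longrightarrow> h = Fract (subst_laurent c w p) (subst_laurent c w q))"

definition perm :: "('d lat \<Rightarrow> 'd lat) \<Rightarrow> 'd::{finite,linorder} ratfun \<Rightarrow> 'd ratfun"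
  where "perm w = subst_ratfun (\<lambda>_. 1) w"

text \<open>
  Characters of a quotient group are represented by their pullbacks, i.e. by the characters that
  are trivial on the subgroup.
\<close>

definition characters_mod :: "'d lat set \<Rightarrow> ('d lat \<Rightarrow> complex) set"
  where "characters_mod L =
    {\<xi>. (\<forall>\<nu>. \<xi> \<nu> \<noteq> 0) \<and> (\<forall>\<nu> \<mu>. \<xi> (\<nu> + \<mu>) = \<xi> \<nu> * \<xi> \<mu>) \<and> (\<forall>\<nu>\<in>L. \<xi> \<nu> = 1)}"

text \<open>The homogeneous component belonging to the class of \<open>\<nu>\<close> modulo \<open>L\<close>.\<close>

definition component ::
    "'d lat set \<Rightarrow> 'd::{finite,linorder} lat \<Rightarrow> 'd ratfun set"
  where "component L \<nu> =
    {f. \<forall>\<xi>\<in>characters_mod L. subst_ratfun \<xi> id f = cst (\<xi> \<nu>) * f}"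

subsection \<open>The metaplectic action and the Demazure operators\<close>

definition gpar :: "nat \<Rightarrow> (nat \<Rightarrow> complex) \<Rightarrow> int \<Rightarrow> complex"
  where "gpar n g j = g (nat (j mod int n))"

text \<open>
  The metaplectic action of the reflection in \<open>\<alpha>\<close> on the component of \<open>\<nu>\<close>.  For simple \<open>\<alpha>\<close> the
  division of integers below is exact: invariance of \<open>Q\<close> gives
  \<open>bil Q \<nu> \<alpha> = coroot \<alpha> \<nu> * Q \<alpha>\<close>.
\<close>

definition metaplectic_on ::
    "('d lat \<Rightarrow> 'd lat \<Rightarrow> int) \<Rightarrow> ('d lat \<Rightarrow> int) \<Rightarrow> nat \<Rightarrow> complex \<Rightarrow> (nat \<Rightarrow> complex) \<Rightarrow>
      'd lat \<Rightarrow> 'd lat \<Rightarrow> 'd::{finite,linorder} ratfun \<Rightarrow> 'd ratfun"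
  where "metaplectic_on coroot Q n v g \<alpha> \<nu> f =
    (let m = mexp n Q \<alpha> in
      perm (refl coroot \<alpha>) f / (1 - cst v * X (frag_cmul m \<alpha>)) *
      (X (frag_cmul (- ((- (bil Q \<nu> \<alpha> div Q \<alpha>)) mod m)) \<alpha>) * (1 - cst v)
       - cst v * cst (gpar n g (Q \<alpha> - bil Q \<nu> \<alpha>)) * X (frag_cmul (1 - m) \<alpha>)
           * (1 - X (frag_cmul m \<alpha>))))"

text \<open>
  Since the field is the direct sum of the components, and the formula above depends on \<open>\<nu>\<close> only
  through its class, there is exactly one additive extension.
\<close>

definition metaplectic ::
    "('d lat \<Rightarrow> 'd lat \<Rightarrow> int) \<Rightarrow> 'd lat set \<Rightarrow> ('d lat \<Rightarrow> int) \<Rightarrow> nat \<Rightarrow> complex \<Rightarrow>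
      (nat \<Rightarrow> complex) \<Rightarrow> 'd lat \<Rightarrow> 'd::{finite,linorder} ratfun \<Rightarrow> 'd ratfun"
  where "metaplectic coroot S Q n v g \<alpha> =
    (THE s. additive s \<and>
      (\<forall>\<nu>. \<forall>f\<in>component (Lambda0 S Q n) \<nu>. s f = metaplectic_on coroot Q n v g \<alpha> \<nu> f))"

definition demazure ::
    "('d lat \<Rightarrow> 'd lat \<Rightarrow> int) \<Rightarrow> 'd lat set \<Rightarrow> ('d lat \<Rightarrow> int) \<Rightarrow> nat \<Rightarrow> complex \<Rightarrow>
      (nat \<Rightarrow> complex) \<Rightarrow> 'd lat \<Rightarrow> 'd::{finite,linorder} ratfun \<Rightarrow> 'd ratfun"
  where "demazure coroot S Q n v g \<alpha> f =
    (let y = X (frag_cmul (mexp n Q \<alpha>) \<alpha>)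
     in (f - y * metaplectic coroot S Q n v g \<alpha> f) / (1 - y))"

definition demazure_lusztig ::
    "('d lat \<Rightarrow> 'd lat \<Rightarrow> int) \<Rightarrow> 'd lat set \<Rightarrow> ('d lat \<Rightarrow> int) \<Rightarrow> nat \<Rightarrow> complex \<Rightarrow>
      (nat \<Rightarrow> complex) \<Rightarrow> 'd lat \<Rightarrow> 'd::{finite,linorder} ratfun \<Rightarrow> 'd ratfun"
  where "demazure_lusztig coroot S Q n v g \<alpha> f =
    (1 - cst v * X (frag_cmul (mexp n Q \<alpha>) \<alpha>)) * demazure coroot S Q n v g \<alpha> f - f"

text \<open>\<open>alternating k F G\<close> is the composite \<open>F \<circ> G \<circ> F \<circ> \<dots>\<close> with \<open>k\<close> factors.\<close>

fun alternating :: "nat \<Rightarrow> ('a \<Rightarrow> 'a) \<Rightarrow> ('a \<Rightarrow> 'a) \<Rightarrow> 'a \<Rightarrow> 'a"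
  where
    "alternating 0 F G = id"
  | "alternating (Suc k) F G = F \<circ> alternating k G F"

subsection \<open>Substitutions are well defined\<close>

lemma subst_laurent_sum:
  assumes "finite A" "Poly_Mapping.keys p \<subseteq> A"
  shows "subst_laurent c w p =
    (\<Sum>\<nu>\<in>A. Poly_Mapping.single (w \<nu>) (c \<nu> * Poly_Mapping.lookup p \<nu>))"
  unfolding subst_laurent_def
  by (rule sum.mono_neutral_left) (use assms in \<open>auto simp: in_keys_iff\<close>)

lemma subst_laurent_single [simp]:
  "subst_laurent c w (Poly_Mapping.single \<nu> a) = Poly_Mapping.single (w \<nu>) (c \<nu> * a)"
  by (subst subst_laurent_sum[where A = "{\<nu>}"]) auto

lemma subst_laurent_add:
  "subst_laurent c w (p + q) = subst_laurent c w p + subst_laurent c w q"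
proof -
  let ?A = "Poly_Mapping.keys p \<union> Poly_Mapping.keys q"
  show ?thesis
    by (subst (1 2 3) subst_laurent_sum[where A = ?A])
       (auto simp: lookup_add distrib_left single_add sum.distrib dest: set_mp[OF keys_add])
qed

lemma poly_mapping_sum_single:
  "p = (\<Sum>\<nu>\<in>Poly_Mapping.keys p. Poly_Mapping.single \<nu> (Poly_Mapping.lookup p \<nu>))"
  by (rule poly_mapping_eqI) (simp add: lookup_sum lookup_single when_def in_keys_iff sum.delta)

lemma subst_laurent_zero [simp]: "subst_laurent c w 0 = 0"
  by (simp add: subst_laurent_def)

lemma subst_laurent_sum_right:
  "subst_laurent c w (sum f A) = (\<Sum>a\<in>A. subst_laurent c w (f a))"
  by (induction A rule: infinite_finite_induct) (auto simp: subst_laurent_add)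

lemma subst_laurent_mult:
  assumes w: "additive w" and c: "\<And>\<nu> \<mu>. c (\<nu> + \<mu>) = c \<nu> * c \<mu>"
  shows "subst_laurent c w (p * q) = subst_laurent c w p * subst_laurent c w q"
proof -
  let ?s = "\<lambda>p \<nu>. Poly_Mapping.single \<nu> (Poly_Mapping.lookup p \<nu>)"
  have "p * q = (\<Sum>\<nu>\<in>Poly_Mapping.keys p. ?s p \<nu>) * (\<Sum>\<mu>\<in>Poly_Mapping.keys q. ?s q \<mu>)"
    using poly_mapping_sum_single[of p] poly_mapping_sum_single[of q] by simp
  also have "subst_laurent c w \<dots> =
      (\<Sum>\<nu>\<in>Poly_Mapping.keys p. \<Sum>\<mu>\<in>Poly_Mapping.keys q.
         subst_laurent c w (?s p \<nu>) * subst_laurent c w (?s q \<mu>))"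
    by (simp add: sum_product subst_laurent_sum_right mult_single c additive.add[OF w] ac_simps)
  also have "\<dots> = subst_laurent c w p * subst_laurent c w q"
    by (simp only: subst_laurent_single) (simp only: sum_product subst_laurent_def)
  finally show ?thesis .
qed

lemma subst_laurent_eq_0_iff:
  assumes "inj w" "\<And>\<nu>. c \<nu> \<noteq> 0"
  shows "subst_laurent c w p = 0 \<longleftrightarrow> p = 0"
proof
  assume *: "subst_laurent c w p = 0"
  show "p = 0"
  proof (rule poly_mapping_eqI)
    fix \<mu>
    have "Poly_Mapping.lookup (subst_laurent c w p) (w \<mu>) = c \<mu> * Poly_Mapping.lookup p \<mu>"
      by (auto simp: subst_laurent_def lookup_sum lookup_single when_def
          inj_eq[OF assms(1)] in_keys_iff sum.delta)
    with * assms(2) show "Poly_Mapping.lookup p \<mu> = Poly_Mapping.lookup 0 \<mu>" by simp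
  qed
qed simp

lemma subst_ratfun_Fract:
  assumes "additive w" "inj w" "\<And>\<nu>. c \<nu> \<noteq> 0" "\<And>\<nu> \<mu>. c (\<nu> + \<mu>) = c \<nu> * c \<mu>" "q \<noteq> 0"
  shows "subst_ratfun c w (Fract p q) = Fract (subst_laurent c w p) (subst_laurent c w q)"
  unfolding subst_ratfun_def
proof (rule the_equality, intro allI impI)
  fix p' q' :: "'a laurent"
  assume *: "q' \<noteq> 0 \<and> Fract p q = Fract p' q'"
  then have "p * q' = p' * q" using assms(5) eq_fract(1)[of q q' p p'] by blast
  then have "subst_laurent c w p * subst_laurent c w q' = subst_laurent c w p' * subst_laurent c w q"
    using subst_laurent_mult[of w c, OF assms(1,4)] by metis
  then show "Fract (subst_laurent c w p) (subst_laurent c w q) =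
      Fract (subst_laurent c w p') (subst_laurent c w q')"
    using * assms(5) by (simp add: eq_fract subst_laurent_eq_0_iff[OF assms(2,3)])
qed (use assms(5) in auto)

end

theory Submission
  imports Defs
begin

text \<open>
  Let \<open>\<alpha>, \<beta>\<close> be two simple roots and \<open>M\<close> the order of the product of their reflections.  The operators
  \<open>\<sigma>\<close> are additive involutions, semilinear over the fixed field \<open>K\<^sub>0\<close> of the characters of
  \<open>\<Lambda>/\<Lambda>\<^sub>0\<close>, which contains the monomials \<open>y = x\<^bsup>m(\<alpha>)\<alpha>\<^esup>\<close>.  With \<open>c(y) = (1 - t y)/(1 - y)\<close> and
  \<open>U = (1 - t y) D\<close>, conjugation by the product of the \<open>1 - t y\<close> over the positive rank two roots turns
  \<open>U\<close> into \<open>(1 + \<sigma>) c(y)\<close>.  The two Kazhdan-Lusztig elements for the longest element, written with the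
  letters \<open>U\<close>, differ by the braid difference of the \<open>T\<close> (for \<open>t = v\<close>) or of the \<open>D\<close> (for \<open>t = 0\<close>);
  expanded in words in \<open>\<sigma>\<close>, they differ, thanks to \<open>c(1/x) = 1 + t - c(x)\<close> and
  \<open>c(xy)(c(x) + c(y) - (1 + t)) = c(x) c(y) - t\<close>, only in the two longest words, which carry the common
  coefficient \<open>\<Prod> c\<close>.  So the braid relations of the \<open>T\<close>, the \<open>D\<close> and the \<open>\<sigma>\<close> are equivalent, and the
  kernel of the braid difference of the \<open>\<sigma>\<close> is a \<open>K\<^sub>0\<close>-subspace that is stable under \<open>\<sigma>\<close>.

  It contains \<open>x\<^sup>\<lambda>\<close> whenever \<open>- m(\<gamma>) \<le> \<langle>\<lambda> - \<rho>, \<gamma>\<^sup>\<vee>\<rangle> \<le> 0\<close> for all positive rank two roots \<open>\<gamma>\<close>: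
  there the operators \<open>T\<close> merely permute monomials up to scalars, and both words collect the same
  scalars.  Every weight reaches this region by the dot action and by translations in \<open>\<Lambda>\<^sub>0\<close>, and the
  monomials span the field over \<open>K\<^sub>0\<close>, so the kernel is everything.
\<close>

subsection \<open>Kazhdan-Lusztig elements of dihedral Hecke algebras\<close>

text \<open>Neither family of operators suffices alone. The \<open>T\<close> permute monomials up to
  scalars on a suitable region, so their braid relation can be checked there; but they are not
  semilinear over \<open>K0\<close>, so the check does not spread. The \<sigma> are semilinear
  involutions, so the kernel of their braid difference does spread; but a general monomial goes to a
  combination of two, which makes a direct check unwieldy. The comparison is therefore used in both
  directions: at t = v from the \<open>T\<close> to the \<sigma> on the region, and, once the kernel
  is everything, at t = v and t = 0 from the \<sigma> back to the \<open>T\<close> and the Demazure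
  operators. For this it has to be an identity of operators that holds before any braid relation is
  known. That is why the two Kazhdan-Lusztig elements are compared as formal sums of words,
  coefficient by coefficient, and why the factors relating the two sides must be nonzero elements of
  \<open>K0\<close>, which can be divided out on either side.\<close>

lemma alternating_Suc: "alternating (Suc k) F G x = F (alternating k G F x)"
  by simp

lemma alternating_snoc:
  "alternating (Suc k) F G x = alternating k F G ((if even k then F else G) x)"
  by (induction k arbitrary: F G) auto

lemma alternating_additive:
  assumes "additive F" "additive G"
  shows "additive (alternating k F G)"
  using assms by (induction k arbitrary: F G) (auto simp: additive_def)

text \<open>
  For \<open>F = T\<^sub>s + 1\<close> and \<open>G = T\<^sub>t + 1\<close>, this is the Kazhdan-Lusztig element of the word \<open>s t s \<dots>\<close> of
  length \<open>k\<close>; the value at \<open>0\<close> is chosen to start the recursion.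
\<close>

fun kl :: "nat \<Rightarrow> 'a::ring \<Rightarrow> ('a \<Rightarrow> 'a) \<Rightarrow> ('a \<Rightarrow> 'a) \<Rightarrow> 'a \<Rightarrow> 'a"
  where
    "kl 0 u F G x = 0"
  | "kl (Suc 0) u F G x = F x"
  | "kl (Suc (Suc k)) u F G x = F (kl (Suc k) u G F x) - u * kl k u F G x"

text \<open>At parameter 0 the correction term disappears, so the braid difference of the Demazure
  operators is itself a difference of two such elements.\<close>

lemma kl_zero: "kl (Suc k) 0 F G x = alternating (Suc k) F G x"
  by (induction k arbitrary: F G x) auto

lemma kl_gauge:
  fixes h :: "'a::comm_ring"
  assumes "\<And>x. F (h * x) = h * F' x" "\<And>x. G (h * x) = h * G' x"
  shows "kl k u F G (h * x) = h * kl k u F' G' x"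
proof -
  have "kl k u F G (h * x) = h * kl k u F' G' x \<and> kl k u G F (h * x) = h * kl k u G' F' x"
    by (induction k rule: induct_nat_012) (auto simp: assms algebra_simps)
  then show ?thesis ..
qed

text \<open>
  The coefficient of a Kazhdan-Lusztig element at the two words of lengths \<open>l\<close> and \<open>l + 1\<close> that left
  multiplication by the first generator exchanges.
\<close>

fun klc :: "'a::ring \<Rightarrow> (nat \<Rightarrow> 'a) \<Rightarrow> (nat \<Rightarrow> 'a) \<Rightarrow> (nat \<Rightarrow> 'a) \<Rightarrow> (nat \<Rightarrow> 'a) \<Rightarrow> nat \<Rightarrow> nat \<Rightarrow> 'a"
  where
    "klc u c c' d d' 0 l = 0"
  | "klc u c c' d d' (Suc 0) l = c l"
  | "klc u c c' d d' (Suc (Suc k)) l =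
       c l * klc u d d' c c' (Suc k) (l - 1)
       + (if l < k then c' l * klc u d d' c c' (Suc k) (Suc l) - u * klc u c c' d d' k l else 0)"

text \<open>The pairs of words exchanged by \<open>S\<close> interlock with those exchanged by
  \<open>T\<close>: in the expansion for \<open>W\<close>, the word of length \<open>l\<close>
  starting with \<open>T\<close> lies in pair \<open>l - 1\<close>, and the word of length
  \<open>l + 1\<close> starting with \<open>S\<close> in pair \<open>l + 1\<close>. \<open>V\<close>
  sends both into its own pair \<open>l\<close>; these are the two products in the recursion of
  \<open>klc\<close>.\<close>

lemma kl_expansion_aux:
  fixes V W S T :: "'a::comm_ring \<Rightarrow> 'a"
  assumes add: "additive S" "additive T" "additive V"
    and u: "\<And>x. S (u * x) = u * S x" "\<And>x. T (u * x) = u * T x"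
    and V: "\<And>l x. l < Suc k \<Longrightarrow> V (alternating l T S x) =
              alternating l T S (c l * x) + alternating (Suc l) S T (c l * x)"
           "\<And>l x. l < k \<Longrightarrow> V (alternating (Suc l) S T x) =
              alternating l T S (c' l * x) + alternating (Suc l) S T (c' l * x)"
    and W: "\<And>x. kl k u W V x = (\<Sum>l<k. alternating l S T (e l * x) + alternating (Suc l) T S (e l * x))"
    and k: "k > 0"
  shows "V (kl k u W V x) = (\<Sum>l<Suc k.
     alternating l T S (c l * e (l - 1) * x + (if Suc l < k then c' l * e (Suc l) * x else 0))
     + alternating (Suc l) S T (c l * e (l - 1) * x + (if Suc l < k then c' l * e (Suc l) * x else 0)))"
proof -
  let ?p = "\<lambda>l z. alternating l T S z + alternating (Suc l) S T z"
  let ?f = "\<lambda>l. c l * e (l - 1) * x"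
  let ?g = "\<lambda>l. if Suc l < k then c' l * e (Suc l) * x else 0"
  obtain j where j: "k = Suc j" using k by (cases k) auto
  have Vsum: "V (\<Sum>l\<in>I. f l) = (\<Sum>l\<in>I. V (f l))" for f and I :: "nat set"
    by (induction I rule: infinite_finite_induct) (auto simp: additive.add[OF add(3)] additive.zero[OF add(3)])
  note aA = alternating_additive[OF add(1,2)] and aB = alternating_additive[OF add(2,1)]
  have p_add: "?p l (a + b) = ?p l a + ?p l b" for l a b
    by (simp only: additive.add[OF aA] additive.add[OF aB] algebra_simps)
  have p0: "?p l 0 = 0" for l
    by (simp only: additive.zero[OF aA] additive.zero[OF aB] add_0)
  have "V (kl k u W V x) = (\<Sum>l<k. V (alternating l S T (e l * x))) + (\<Sum>l<k. V (alternating (Suc l) T S (e l * x)))"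
    unfolding W Vsum additive.add[OF add(3)] sum.distrib ..
  also have "(\<Sum>l<k. V (alternating l S T (e l * x))) =
      V (alternating 0 S T (e 0 * x)) + (\<Sum>l<j. V (alternating (Suc l) S T (e (Suc l) * x)))"
    unfolding j by (rule sum.lessThan_Suc_shift)
  \<comment> \<open>The empty word lies in pair 0 for either letter, so at \<open>l = 0\<close> the
    truncated difference \<open>l - 1 = 0\<close> is the right index.\<close>
  also have "V (alternating 0 S T (e 0 * x)) = ?p 0 (?f 0)"
    using V(1)[of 0 "e 0 * x"] by (simp add: mult.assoc)
  also have "(\<Sum>l<j. V (alternating (Suc l) S T (e (Suc l) * x))) =
      (\<Sum>l<j. ?p l (c' l * e (Suc l) * x))"
    by (intro sum.cong refl, subst V(2)) (simp_all add: j mult.assoc del: alternating.simps(2))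
  also have "(\<Sum>l<j. ?p l (c' l * e (Suc l) * x)) = (\<Sum>l<j. ?p l (?g l))"
    by (intro sum.cong) (auto simp: j)
  also have "\<dots> = (\<Sum>l<Suc k. ?p l (?g l))"
    by (intro sum.mono_neutral_left) (use p0 in \<open>auto simp: j\<close>)
  also have "(\<Sum>l<k. V (alternating (Suc l) T S (e l * x))) = (\<Sum>l<k. ?p (Suc l) (?f (Suc l)))"
    by (intro sum.cong refl, subst V(1)) (simp_all add: mult.assoc del: alternating.simps(2))
  finally show ?thesis
    unfolding p_add sum.distrib[of "\<lambda>l. ?p l (?f l)" "\<lambda>l. ?p l (?g l)"]
    by (simp only: sum.lessThan_Suc_shift[of "\<lambda>l. ?p l (?f l)" k] add_ac)
qed

text \<open>The recursion alternates the first letter, so both expansions are carried through one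
  induction. The bound \<open>k \<le> m\<close> confines it to words of length at most
  \<open>m\<close>, where the action of \<open>V\<close> and \<open>W\<close> is prescribed.\<close>

lemma kl_expansion:
  fixes V W S T :: "'a::comm_ring \<Rightarrow> 'a"
  assumes add: "additive S" "additive T" "additive V" "additive W"
    and u: "\<And>x. S (u * x) = u * S x" "\<And>x. T (u * x) = u * T x"
    and V: "\<And>l x. l < m \<Longrightarrow> V (alternating l T S x) =
              alternating l T S (c l * x) + alternating (Suc l) S T (c l * x)"
           "\<And>l x. l < m \<Longrightarrow> V (alternating (Suc l) S T x) =
              alternating l T S (c' l * x) + alternating (Suc l) S T (c' l * x)"
    and W: "\<And>l x. l < m \<Longrightarrow> W (alternating l S T x) =
              alternating l S T (d l * x) + alternating (Suc l) T S (d l * x)"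
           "\<And>l x. l < m \<Longrightarrow> W (alternating (Suc l) T S x) =
              alternating l S T (d' l * x) + alternating (Suc l) T S (d' l * x)"
    and k: "k \<le> m"
  shows "kl k u V W x =
      (\<Sum>l<k. alternating l T S (klc u c c' d d' k l * x) + alternating (Suc l) S T (klc u c c' d d' k l * x)) \<and>
    kl k u W V x =
      (\<Sum>l<k. alternating l S T (klc u d d' c c' k l * x) + alternating (Suc l) T S (klc u d d' c c' k l * x))"
  using k
proof (induction k arbitrary: x rule: induct_nat_012)
  case 0
  then show ?case by simp
next
  case 1
  then show ?case using V(1)[of 0 x] W(1)[of 0 x] by simp
next
  case (ge2 k)
  note aA = alternating_additive[OF add(1,2)] and aB = alternating_additive[OF add(2,1)]
  have uAB: "u * alternating l S T y = alternating l S T (u * y) \<and>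
      u * alternating l T S y = alternating l T S (u * y)" for l y
    by (induction l arbitrary: y) (auto simp: u[symmetric])
  have step: "(\<Sum>l<Suc (Suc k). alternating l T S (f l + (if Suc l < Suc k then g l else 0))
       + alternating (Suc l) S T (f l + (if Suc l < Suc k then g l else 0)))
      - u * (\<Sum>l<k. alternating l T S (h l) + alternating (Suc l) S T (h l)) =
     (\<Sum>l<Suc (Suc k). alternating l T S (f l + (if l < k then g l - u * h l else 0))
       + alternating (Suc l) S T (f l + (if l < k then g l - u * h l else 0)))"
    if "additive S" "additive T" and u: "\<And>l y. u * alternating l S T y = alternating l S T (u * y)"
      "\<And>l y. u * alternating l T S y = alternating l T S (u * y)" for f g h :: "nat \<Rightarrow> 'a" and S T
  proof -
    note aA = alternating_additive[OF that(1,2)] and aB = alternating_additive[OF that(2,1)]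
    have "u * (\<Sum>l<k. alternating l T S (h l) + alternating (Suc l) S T (h l)) =
       (\<Sum>l<k. alternating l T S (u * h l) + alternating (Suc l) S T (u * h l))"
      by (simp only: sum_distrib_left distrib_left u)
    also have "\<dots> = (\<Sum>l<Suc (Suc k). if l < k then alternating l T S (u * h l) + alternating (Suc l) S T (u * h l) else 0)"
      by (intro sum.mono_neutral_cong_left) auto
    finally show ?thesis
      by (simp only: sum_subtractf [symmetric])
         (intro sum.cong refl, auto simp only: additive.add[OF aA] additive.diff[OF aA]
            additive.add[OF aB] additive.diff[OF aB] additive.zero[OF aA] additive.zero[OF aB]
            Suc_less_eq algebra_simps add_0_left add_0_right diff_zero split: if_splits)
  qed
  have k: "k \<le> m" "Suc k \<le> m" "\<And>l. l < Suc (Suc k) \<Longrightarrow> l < m" "\<And>l. l < Suc k \<Longrightarrow> l < m" using ge2 by auto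
  note IH = ge2.IH(1)[OF k(1)] ge2.IH(2)[OF k(2)]
  have "V (kl (Suc k) u W V x) = (\<Sum>l<Suc (Suc k).
     alternating l T S (c l * klc u d d' c c' (Suc k) (l - 1) * x + (if Suc l < Suc k then c' l * klc u d d' c c' (Suc k) (Suc l) * x else 0))
     + alternating (Suc l) S T (c l * klc u d d' c c' (Suc k) (l - 1) * x + (if Suc l < Suc k then c' l * klc u d d' c c' (Suc k) (Suc l) * x else 0)))"
    by (rule kl_expansion_aux[OF add(1,2,3) u V]) (use k IH in auto)
  moreover have "W (kl (Suc k) u V W x) = (\<Sum>l<Suc (Suc k).
     alternating l S T (d l * klc u c c' d d' (Suc k) (l - 1) * x + (if Suc l < Suc k then d' l * klc u c c' d d' (Suc k) (Suc l) * x else 0))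
     + alternating (Suc l) T S (d l * klc u c c' d d' (Suc k) (l - 1) * x + (if Suc l < Suc k then d' l * klc u c c' d d' (Suc k) (Suc l) * x else 0)))"
    by (rule kl_expansion_aux[OF add(2,1,4) u(2,1) W]) (use k IH in auto)
  moreover have e: "a * x + (if l < k then b * x - u * (h * x) else 0) = (a + (if l < k then b - u * h else 0)) * x" for l a b h
    by (simp add: algebra_simps)
  ultimately show ?case
    using conjunct1[OF IH(1), of x] conjunct2[OF IH(1), of x]
      step[OF add(1,2) conjunct1[OF uAB] conjunct2[OF uAB]] step[OF add(2,1) conjunct2[OF uAB] conjunct1[OF uAB]]
    by (simp only: kl.simps(3) klc.simps(3) e)
qed

text \<open>With one common coefficient both expansions run over all words up to length
  \<open>m\<close>. Words of intermediate length occur in both, so the difference telescopes to the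
  two longest words, the empty words cancelling.\<close>

lemma kl_diff:
  fixes V W S T :: "'a::comm_ring \<Rightarrow> 'a"
  assumes "additive S" "additive T" "additive V" "additive W"
    and "\<And>x. S (u * x) = u * S x" "\<And>x. T (u * x) = u * T x"
    and "\<And>l x. l < m \<Longrightarrow> V (alternating l T S x) =
              alternating l T S (c l * x) + alternating (Suc l) S T (c l * x)"
        "\<And>l x. l < m \<Longrightarrow> V (alternating (Suc l) S T x) =
              alternating l T S (c' l * x) + alternating (Suc l) S T (c' l * x)"
    and "\<And>l x. l < m \<Longrightarrow> W (alternating l S T x) =
              alternating l S T (d l * x) + alternating (Suc l) T S (d l * x)"
        "\<And>l x. l < m \<Longrightarrow> W (alternating (Suc l) T S x) =
              alternating l S T (d' l * x) + alternating (Suc l) T S (d' l * x)"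
    and p: "\<And>l. l < m \<Longrightarrow> klc u c c' d d' m l = p" "\<And>l. l < m \<Longrightarrow> klc u d d' c c' m l = p"
  shows "kl m u V W x - kl m u W V x = alternating m S T (p * x) - alternating m T S (p * x)"
proof -
  note e = kl_expansion[where u = u and m = m and k = m and x = x and c = c and c' = c' and d = d and d' = d', OF assms(1-10) order.refl]
  have "kl m u V W x - kl m u W V x =
     (\<Sum>l<m. (alternating (Suc l) S T (p * x) - alternating l S T (p * x)) -
       (alternating (Suc l) T S (p * x) - alternating l T S (p * x)))"
    by (subst conjunct1[OF e], simp, subst conjunct2[OF e], simp, subst sum_subtractf[symmetric], intro sum.cong refl) (simp only: lessThan_iff p, simp add: algebra_simps)
  also have "\<dots> = alternating m S T (p * x) - alternating m T S (p * x)"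
    by (subst sum_subtractf, subst sum_lessThan_telescope[of "\<lambda>l. alternating l S T (p * x)"],
        subst sum_lessThan_telescope[of "\<lambda>l. alternating l T S (p * x)"]) simp
  finally show ?thesis .
qed

text \<open>The quadratic relation says that \<open>V\<close> sends a word starting with
  \<open>S\<close> to \<open>u\<close> times the sum of its pair, and this excess is exactly what
  the term \<open>u * kl k\<close> removes. So all coefficients are 1: the classical description of
  the Kazhdan-Lusztig basis of a dihedral Hecke algebra.\<close>

lemma kl_diff_hecke:
  fixes S T :: "'a::comm_ring_1 \<Rightarrow> 'a"
  assumes add: "additive S" "additive T"
    and u: "\<And>x. S (u * x) = u * S x" "\<And>x. T (u * x) = u * T x"
    and quad: "\<And>x. S (S x) = (u - 1) * S x + u * x" "\<And>x. T (T x) = (u - 1) * T x + u * x"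
  shows "kl m u (\<lambda>x. S x + x) (\<lambda>x. T x + x) x - kl m u (\<lambda>x. T x + x) (\<lambda>x. S x + x) x =
    alternating m S T x - alternating m T S x"
proof -
  have uAB: "alternating l S T (u * y) = u * alternating l S T y \<and>
      alternating l T S (u * y) = u * alternating l T S y" for l y
    by (induction l arbitrary: y) (auto simp: u)
  have c: "klc u (\<lambda>_. 1) (\<lambda>_. u) (\<lambda>_. 1) (\<lambda>_. u) (Suc k) l = 1" for k l
    by (induction k arbitrary: l rule: induct_nat_012) (auto simp: algebra_simps)
  have uAB': "alternating l S T (y * u) = u * alternating l S T y"
      "alternating l T S (y * u) = u * alternating l T S y" for l y
    using uAB[of l y] by (simp_all add: mult.commute)
  have "kl m u (\<lambda>x. S x + x) (\<lambda>x. T x + x) x - kl m u (\<lambda>x. T x + x) (\<lambda>x. S x + x) x =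
    alternating m S T (1 * x) - alternating m T S (1 * x)"
    by (rule kl_diff[where u = u and m = m and p = 1 and c = "\<lambda>_. 1" and c' = "\<lambda>_. u" and d = "\<lambda>_. 1" and d' = "\<lambda>_. u"])
       (use add u c in \<open>auto simp: additive_def quad u uAB uAB' algebra_simps gr0_conv_Suc elim: less_natE\<close>)
  then show ?thesis by simp
qed

section \<open>Expansion in the words of a twisted dihedral action\<close>

lemma klc_rec:
  assumes "k \<ge> 2"
  shows "klc u c c' d d' k l =
       c l * klc u d d' c c' (k - 1) (l - 1)
       + (if l < k - 2 then c' l * klc u d d' c c' (k - 1) (Suc l) - u * klc u c c' d d' (k - 2) l else 0)"
  using assms by (cases k; cases "k - 1") auto

text \<open>
  \<open>c k\<close> belongs to the \<open>k\<close>-th positive root in cyclic order, the first and the last of which are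
  simple.
\<close>

locale dihedral_action =
  fixes S T :: "'a::idom \<Rightarrow> 'a" and u w :: 'a and m :: nat and c :: "nat \<Rightarrow> 'a"
  assumes add: "additive S" "additive T"
    and inv: "\<And>x. S (S x) = x" "\<And>x. T (T x) = x"
    and S_scalar: "\<And>x. S (u * x) = u * S x" "\<And>x. S (w * x) = w * S x"
    and T_scalar: "\<And>x. T (u * x) = u * T x" "\<And>x. T (w * x) = w * T x"
    and m: "m > 0"
    and S_c: "\<And>x. S (c 1 * x) = (w - c 1) * S x" "\<And>k x. 1 < k \<Longrightarrow> k \<le> m \<Longrightarrow> S (c k * x) = c (m + 2 - k) * S x"
    and T_c: "\<And>x. T (c m * x) = (w - c m) * T x" "\<And>k x. 1 \<le> k \<Longrightarrow> k < m \<Longrightarrow> T (c k * x) = c (m - k) * T x"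
begin

definition "V x = c 1 * x + S (c 1 * x)"
definition "W x = c m * x + T (c m * x)"

lemma w_word:
  "w * alternating l T S y = alternating l T S (w * y)" "w * alternating l S T y = alternating l S T (w * y)"
proof -
  have "w * alternating l T S y = alternating l T S (w * y) \<and> w * alternating l S T y = alternating l S T (w * y)"
    by (induction l arbitrary: y) (auto simp: S_scalar[symmetric] T_scalar[symmetric])
  then show "w * alternating l T S y = alternating l T S (w * y)" "w * alternating l S T y = alternating l S T (w * y)"
    by auto
qed

text \<open>The image of \<open>V\<close> is fixed by \<open>S\<close>, so the two words of a pair
  receive equal coefficients. On the word starting with \<open>S\<close> the coefficient is
  \<open>w - e\<close>, because \<open>S\<close> exchanges \<open>c 1\<close> and
  \<open>w - c 1\<close>.\<close>

lemma V_word: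
  assumes "\<And>x. c 1 * alternating l T S x = alternating l T S (e * x)"
  shows "V (alternating l T S x) = alternating l T S (e * x) + alternating (Suc l) S T (e * x)"
    and "V (alternating (Suc l) S T x) =
      alternating l T S ((w - e) * x) + alternating (Suc l) S T ((w - e) * x)"
proof -
  show "V (alternating l T S x) = alternating l T S (e * x) + alternating (Suc l) S T (e * x)"
    unfolding V_def assms by simp
  have *: "(w - c 1) * alternating l T S x = alternating l T S ((w - e) * x)"
    by (simp only: left_diff_distrib assms w_word additive.diff[OF alternating_additive[OF add(2,1)]])
  have 1: "S ((w - c 1) * y) = c 1 * S y" for y
    unfolding left_diff_distrib additive.diff[OF add(1)] S_scalar S_c(1) by (simp add: algebra_simps)
  then have "c 1 * S y = S ((w - c 1) * y)" for y by simp
  then show "V (alternating (Suc l) S T x) =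
      alternating l T S ((w - e) * x) + alternating (Suc l) S T ((w - e) * x)"
    unfolding V_def alternating_Suc by (simp only: inv *) (simp add: algebra_simps)
qed

lemma W_word:
  assumes "\<And>x. c m * alternating l S T x = alternating l S T (e * x)"
  shows "W (alternating l S T x) = alternating l S T (e * x) + alternating (Suc l) T S (e * x)"
    and "W (alternating (Suc l) T S x) =
      alternating l S T ((w - e) * x) + alternating (Suc l) T S ((w - e) * x)"
proof -
  show "W (alternating l S T x) = alternating l S T (e * x) + alternating (Suc l) T S (e * x)"
    unfolding W_def assms by simp
  have *: "(w - c m) * alternating l S T x = alternating l S T ((w - e) * x)"
    by (simp only: left_diff_distrib assms w_word additive.diff[OF alternating_additive[OF add(1,2)]])
  have 1: "T ((w - c m) * y) = c m * T y" for y
    unfolding left_diff_distrib additive.diff[OF add(2)] T_scalar T_c(1) by (simp add: algebra_simps)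
  then have "c m * T y = T ((w - c m) * y)" for y by simp
  then show "W (alternating (Suc l) T S x) =
      alternating l S T ((w - e) * x) + alternating (Suc l) T S ((w - e) * x)"
    unfolding W_def alternating_Suc by (simp only: inv *) (simp add: algebra_simps)
qed

text \<open>\<open>e l\<close> and \<open>f l\<close> are what \<open>c 1\<close> and
  \<open>c m\<close> become when they are carried to the right through a word of length
  \<open>l\<close>. This reduces each type to a commutative identity for \<open>klc\<close>.\<close>

lemma kl_diff_sigma:
  assumes e: "\<And>l x. l < m \<Longrightarrow> c 1 * alternating l T S x = alternating l T S (e l * x)"
    and f: "\<And>l x. l < m \<Longrightarrow> c m * alternating l S T x = alternating l S T (f l * x)"
    and p: "\<And>l. l < m \<Longrightarrow> klc u e (\<lambda>l. w - e l) f (\<lambda>l. w - f l) m l = p"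
      "\<And>l. l < m \<Longrightarrow> klc u f (\<lambda>l. w - f l) e (\<lambda>l. w - e l) m l = p"
  shows "kl m u V W x - kl m u W V x = alternating m S T (p * x) - alternating m T S (p * x)"
proof (rule kl_diff[where u = u and m = m and p = p and c = e and c' = "\<lambda>l. w - e l" and d = f and d' = "\<lambda>l. w - f l"])
  show "additive V" "additive W"
    using add by (auto simp: additive_def V_def W_def algebra_simps)
qed (use add p V_word[OF e] W_word[OF f] S_scalar T_scalar in \<open>auto simp del: alternating.simps(2)\<close>)

end

lemma (in dihedral_action) kl_diff_2:
  assumes "m = 2"
  shows "kl m u V W x - kl m u W V x =
    alternating m S T (c 1 * c 2 * x) - alternating m T S (c 1 * c 2 * x)"
  by (rule kl_diff_sigma[where e = "\<lambda>l. [c 1, c 1] ! l" and f = "\<lambda>l. [c 2, c 2] ! l"])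
     (use S_c T_c in \<open>auto simp: assms less_Suc_eq numeral_eq_Suc\<close>)

text \<open>\<open>R1\<close> is the addition rule for the middle root, the sum of the two simple
  ones. Only the pair containing the empty word needs it, since only there the second term of the
  recursion is present in the last row.\<close>

lemma klc_3:
  fixes c1 c2 c3 u w :: "'a::idom" and e f :: "nat \<Rightarrow> 'a"
  defines "e \<equiv> \<lambda>l. [c1, c2, c3] ! l" and "f \<equiv> \<lambda>l. [c3, c2, c1] ! l"
  assumes R1: "c1 * c3 - u = c2 * (c1 + c3 - w)"
  assumes l: "l < 3"
  shows "klc u e (\<lambda>l. w - e l) f (\<lambda>l. w - f l) 3 l = c1 * c2 * c3"
    and "klc u f (\<lambda>l. w - f l) e (\<lambda>l. w - e l) 3 l = c1 * c2 * c3"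
proof -
  let ?A = "klc u e (\<lambda>l. w - e l) f (\<lambda>l. w - f l)" and ?B = "klc u f (\<lambda>l. w - f l) e (\<lambda>l. w - e l)"
  note rec = klc_rec[of _ u e "\<lambda>l. w - e l" f "\<lambda>l. w - f l"] klc_rec[of _ u f "\<lambda>l. w - f l" e "\<lambda>l. w - e l"]
  have e: "e 0 = c1" "e 1 = c2" "e 2 = c3"
    and f: "f 0 = c3" "f 1 = c2" "f 2 = c1"
    by (simp_all add: e_def f_def)
  note [simp] = e e(2)[unfolded One_nat_def] f f(2)[unfolded One_nat_def] numeral_2_eq_2[symmetric]
  have A1: "?A 1 0 = c1" "?A (Suc 0) 0 = c1" and B1: "?B 1 0 = c3" "?B (Suc 0) 0 = c3" by simp_all
  have A2_0: "?A 2 0 = c1 * c3"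
    by (simp add: rec A1 B1)
  have A2_1: "?A 2 (Suc 0) = c2 * c3"
    by (simp add: rec A1 B1)
  note A2 = A2_0 A2_1
  have B2_0: "?B 2 0 = c1 * c3"
    by (simp add: rec A1 B1)
  have B2_1: "?B 2 (Suc 0) = c1 * c2"
    by (simp add: rec A1 B1)
  note B2 = B2_0 B2_1
  have "?A 3 0 =
      c1 * (c1 * c3) + ((w - c1) * (c1 * c2) - u * (c1))"
    by (simp add: rec A2 B2 A1 B1)
  also have "\<dots> = c1 * c2 * c3"
    by (use R1 in algebra)
  finally have A3_0: "?A 3 0 = c1 * c2 * c3" .
  have A3_1: "?A 3 (Suc 0) = c1 * c2 * c3"
    by (simp add: rec A2 B2 A1 B1)
  have A3_2: "?A 3 2 = c1 * c2 * c3"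
    by (simp add: rec A2 B2 A1 B1)
  note A3 = A3_0 A3_1 A3_2
  have "?B 3 0 =
      c3 * (c1 * c3) + ((w - c3) * (c2 * c3) - u * (c3))"
    by (simp add: rec A2 B2 A1 B1)
  also have "\<dots> = c1 * c2 * c3"
    by (use R1 in algebra)
  finally have B3_0: "?B 3 0 = c1 * c2 * c3" .
  have B3_1: "?B 3 (Suc 0) = c1 * c2 * c3"
    by (simp add: rec A2 B2 A1 B1)
  have B3_2: "?B 3 2 = c1 * c2 * c3"
    by (simp add: rec A2 B2 A1 B1)
  note B3 = B3_0 B3_1 B3_2
  have "l = 0 \<or> l = 1 \<or> l = 2" using l by auto
  then show "?A 3 l = c1 * c2 * c3" "?B 3 l = c1 * c2 * c3"
    by (elim disjE; simp only: A3 B3 One_nat_def)+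
qed

text \<open>There is one relation for each decomposition of a positive root: root 3 is 1 + 4, root 2
  is 1 + 3. In the form \<open>c1 * (c3 * (c2 + c4 - w) + u)\<close> of \<open>A3_0\<close>, both
  entries of the next row that involve it become plain polynomial identities.\<close>

lemma klc_4:
  fixes c1 c2 c3 c4 u w :: "'a::idom" and e f :: "nat \<Rightarrow> 'a"
  defines "e \<equiv> \<lambda>l. [c1, c3, c3, c1] ! l" and "f \<equiv> \<lambda>l. [c4, c2, c2, c4] ! l"
  assumes R1: "c1 * c4 - u = c3 * (c1 + c4 - w)" and
      R2: "c1 * c3 - u = c2 * (c1 + c3 - w)"
  assumes l: "l < 4"
  shows "klc u e (\<lambda>l. w - e l) f (\<lambda>l. w - f l) 4 l = c1 * c2 * c3 * c4"
    and "klc u f (\<lambda>l. w - f l) e (\<lambda>l. w - e l) 4 l = c1 * c2 * c3 * c4"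
proof -
  let ?A = "klc u e (\<lambda>l. w - e l) f (\<lambda>l. w - f l)" and ?B = "klc u f (\<lambda>l. w - f l) e (\<lambda>l. w - e l)"
  note rec = klc_rec[of _ u e "\<lambda>l. w - e l" f "\<lambda>l. w - f l"] klc_rec[of _ u f "\<lambda>l. w - f l" e "\<lambda>l. w - e l"]
  have e: "e 0 = c1" "e 1 = c3" "e 2 = c3" "e 3 = c1"
    and f: "f 0 = c4" "f 1 = c2" "f 2 = c2" "f 3 = c4"
    by (simp_all add: e_def f_def)
  note [simp] = e e(2)[unfolded One_nat_def] f f(2)[unfolded One_nat_def] numeral_2_eq_2[symmetric]
  have A1: "?A 1 0 = c1" "?A (Suc 0) 0 = c1" and B1: "?B 1 0 = c4" "?B (Suc 0) 0 = c4" by simp_all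
  have A2_0: "?A 2 0 = c1 * c4"
    by (simp add: rec A1 B1)
  have A2_1: "?A 2 (Suc 0) = c3 * c4"
    by (simp add: rec A1 B1)
  note A2 = A2_0 A2_1
  have B2_0: "?B 2 0 = c1 * c4"
    by (simp add: rec A1 B1)
  have B2_1: "?B 2 (Suc 0) = c1 * c2"
    by (simp add: rec A1 B1)
  note B2 = B2_0 B2_1
  have "?A 3 0 =
      c1 * (c1 * c4) + ((w - c1) * (c1 * c2) - u * (c1))"
    by (simp add: rec A2 B2 A1 B1)
  also have "\<dots> = c1 * (c3 * (c2 + c4 - w) + u)"
    by (use R1 R2 in algebra)
  finally have A3_0: "?A 3 0 = c1 * (c3 * (c2 + c4 - w) + u)" .
  have A3_1: "?A 3 (Suc 0) = c1 * c3 * c4"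
    by (simp add: rec A2 B2 A1 B1)
  have A3_2: "?A 3 2 = c1*c2*c3"
    by (simp add: rec A2 B2 A1 B1)
  note A3 = A3_0 A3_1 A3_2
  have "?B 3 0 =
      c4 * (c1 * c4) + ((w - c4) * (c3 * c4) - u * (c4))"
    by (simp add: rec A2 B2 A1 B1)
  also have "\<dots> = c1 * c3 * c4"
    by (use R1 in algebra)
  finally have B3_0: "?B 3 0 = c1 * c3 * c4" .
  have B3_1: "?B 3 (Suc 0) = c1 * c2 * c4"
    by (simp add: rec A2 B2 A1 B1)
  have B3_2: "?B 3 2 = c2 * c3 * c4"
    by (simp add: rec A2 B2 A1 B1)
  note B3 = B3_0 B3_1 B3_2
  have "?A 4 0 =
      c1 * (c1 * c3 * c4) + ((w - c1) * (c1 * c2 * c4) - u * (c1 * c4))"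
    by (simp add: rec A3 B3 A2 B2)
  also have "\<dots> = c1 * c2 * c3 * c4"
    by (use R2 in algebra)
  finally have A4_0: "?A 4 0 = c1 * c2 * c3 * c4" .
  have "?A 4 (Suc 0) =
      c3 * (c1 * c3 * c4) + ((w - c3) * (c2 * c3 * c4) - u * (c3 * c4))"
    by (simp add: rec A3 B3 A2 B2)
  also have "\<dots> = c1 * c2 * c3 * c4"
    by (use R2 in algebra)
  finally have A4_1: "?A 4 (Suc 0) = c1 * c2 * c3 * c4" .
  have A4_2: "?A 4 2 = c1 * c2 * c3 * c4"
    by (simp add: rec A3 B3 A2 B2)
  have A4_3: "?A 4 3 = c1 * c2 * c3 * c4"
    by (simp add: rec A3 B3 A2 B2)
  note A4 = A4_0 A4_1 A4_2 A4_3
  have "?B 4 0 =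
      c4 * (c1 * (c3 * (c2 + c4 - w) + u)) + ((w - c4) * (c1 * c3 * c4) - u * (c1 * c4))"
    by (simp add: rec A3 B3 A2 B2)
  also have "\<dots> = c1 * c2 * c3 * c4"
    by algebra
  finally have B4_0: "?B 4 0 = c1 * c2 * c3 * c4" .
  have "?B 4 (Suc 0) =
      c2 * (c1 * (c3 * (c2 + c4 - w) + u)) + ((w - c2) * (c1*c2*c3) - u * (c1 * c2))"
    by (simp add: rec A3 B3 A2 B2)
  also have "\<dots> = c1 * c2 * c3 * c4"
    by algebra
  finally have B4_1: "?B 4 (Suc 0) = c1 * c2 * c3 * c4" .
  have B4_2: "?B 4 2 = c1 * c2 * c3 * c4"
    by (simp add: rec A3 B3 A2 B2)
  have B4_3: "?B 4 3 = c1 * c2 * c3 * c4"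
    by (simp add: rec A3 B3 A2 B2)
  note B4 = B4_0 B4_1 B4_2 B4_3
  have "l = 0 \<or> l = 1 \<or> l = 2 \<or> l = 3" using l by auto
  then show "?A 4 l = c1 * c2 * c3 * c4" "?B 4 l = c1 * c2 * c3 * c4"
    by (elim disjE; simp only: A4 B4 One_nat_def)+
qed

text \<open>The relations are the five ways to write a positive root of G2 as a sum of two positive
  roots: 5 = 1 + 6, 3 = 1 + 5, 2 = 1 + 3, 4 = 2 + 6, 4 = 3 + 5.\<close>

lemma klc_6:
  fixes c1 c2 c3 c4 c5 c6 u w :: "'a::idom" and e f :: "nat \<Rightarrow> 'a"
  defines "e \<equiv> \<lambda>l. [c1, c5, c3, c3, c5, c1] ! l" and "f \<equiv> \<lambda>l. [c6, c2, c4, c4, c2, c6] ! l"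
  assumes R1: "c1 * c6 - u = c5 * (c1 + c6 - w)" and
      R2: "c1 * c5 - u = c3 * (c1 + c5 - w)" and
      R3: "c1 * c3 - u = c2 * (c1 + c3 - w)" and
      R4: "c2 * c6 - u = c4 * (c2 + c6 - w)" and
      R5: "c3 * c5 - u = c4 * (c3 + c5 - w)"
  assumes l: "l < 6"
  shows "klc u e (\<lambda>l. w - e l) f (\<lambda>l. w - f l) 6 l = c1 * c2 * c3 * c4 * c5 * c6"
    and "klc u f (\<lambda>l. w - f l) e (\<lambda>l. w - e l) 6 l = c1 * c2 * c3 * c4 * c5 * c6"
proof -
  let ?A = "klc u e (\<lambda>l. w - e l) f (\<lambda>l. w - f l)" and ?B = "klc u f (\<lambda>l. w - f l) e (\<lambda>l. w - e l)"
  note rec = klc_rec[of _ u e "\<lambda>l. w - e l" f "\<lambda>l. w - f l"] klc_rec[of _ u f "\<lambda>l. w - f l" e "\<lambda>l. w - e l"]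
  have e: "e 0 = c1" "e 1 = c5" "e 2 = c3" "e 3 = c3" "e 4 = c5" "e 5 = c1"
    and f: "f 0 = c6" "f 1 = c2" "f 2 = c4" "f 3 = c4" "f 4 = c2" "f 5 = c6"
    by (simp_all add: e_def f_def)
  note [simp] = e e(2)[unfolded One_nat_def] f f(2)[unfolded One_nat_def] numeral_2_eq_2[symmetric]
  have A1: "?A 1 0 = c1" "?A (Suc 0) 0 = c1" and B1: "?B 1 0 = c6" "?B (Suc 0) 0 = c6" by simp_all
  \<comment> \<open>These consequences of the relations keep each ideal membership problem small:
    \<open>I4\<close> prepares \<open>I5\<close>, and each of the others serves one entry of the
    tables below.\<close>
  have I1: "c1*c6 + (w-c1)*c2 - u = (c3*c5 + c2*c3 + c5*c6 - w*(c3+c5) + 2*u)"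
    using R1 R2 R3 by algebra
  have I2: "c1*c5+(w-c1)*c2-u = (c3*(c2+c5-w)+u)"
    using R2 R3 by algebra
  have I3: "c1*c5+(w-c5)*c4-u = (c3*(c1+c4-w)+u)"
    using R2 R5 by algebra
  have I4: "(c1+c6-w)*(c2+c5-w)=(c2+c6-w)*(c1+c4-w)"
    using R1 R4 by algebra
  have I5: "c1*c6*(c3*(c2+c5-w)+u)+(w-c6)*c5*(c3*(c1+c4-w)+u)-u*c1*c5
      = c2*c3*c5*(c1+c4-w)+u*c3*(c2+c5-w)+u*u"
    using R1 I4 by algebra
  have I6: "c1*c6*(c3*(c2+c5-w)+u)+(w-c1)*c2*(c5*(c3+c6-w)+u) - u*(c3*c5 + c2*c3 + c5*c6 - w*(c3+c5) + 2*u)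
      = c2*c3*c4*c5-(w-c6)*c5*(c3*(c2+c4-w)+u)+u*(c3*(c2+c5-w)+u)"
    using R1 R2 R3 R4 R5 by algebra
  have I7: "c2*c5*(c1+c4-w)+u*(c2+c5-c1-c4)+(w-c5)*c1*c4=c1*c2*c4"
    using R1 R2 R3 R4 R5 by algebra
  have A2_0: "?A 2 0 = c1*c6"
    by (simp add: rec A1 B1)
  have A2_1: "?A 2 (Suc 0) = c5*c6"
    by (simp add: rec A1 B1)
  note A2 = A2_0 A2_1
  have B2_0: "?B 2 0 = c1*c6"
    by (simp add: rec A1 B1)
  have B2_1: "?B 2 (Suc 0) = c1*c2"
    by (simp add: rec A1 B1)
  note B2 = B2_0 B2_1
  have "?A 3 0 =
      c1 * (c1*c6) + ((w - c1) * (c1*c2) - u * (c1))"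
    by (simp add: rec A2 B2 A1 B1)
  also have "\<dots> = c1*(c3*c5 + c2*c3 + c5*c6 - w*(c3+c5) + 2*u)"
    by (use I1 in algebra)
  finally have A3_0: "?A 3 0 = c1*(c3*c5 + c2*c3 + c5*c6 - w*(c3+c5) + 2*u)" .
  have A3_1: "?A 3 (Suc 0) = c1*c5*c6"
    by (simp add: rec A2 B2 A1 B1)
  have A3_2: "?A 3 2 = c1*c2*c3"
    by (simp add: rec A2 B2 A1 B1)
  note A3 = A3_0 A3_1 A3_2
  have "?B 3 0 =
      c6 * (c1*c6) + ((w - c6) * (c5*c6) - u * (c6))"
    by (simp add: rec A2 B2 A1 B1)
  also have "\<dots> = c1*c5*c6"
    by (use R1 in algebra)
  finally have B3_0: "?B 3 0 = c1*c5*c6" .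
  have B3_1: "?B 3 (Suc 0) = c1*c2*c6"
    by (simp add: rec A2 B2 A1 B1)
  have B3_2: "?B 3 2 = c4*c5*c6"
    by (simp add: rec A2 B2 A1 B1)
  note B3 = B3_0 B3_1 B3_2
  have "?A 4 0 =
      c1 * (c1*c5*c6) + ((w - c1) * (c1*c2*c6) - u * (c1*c6))"
    by (simp add: rec A3 B3 A2 B2)
  also have "\<dots> = c1*c6*(c3*(c2+c5-w)+u)"
    by (use I2 in algebra)
  finally have A4_0: "?A 4 0 = c1*c6*(c3*(c2+c5-w)+u)" .
  have "?A 4 (Suc 0) =
      c5 * (c1*c5*c6) + ((w - c5) * (c4*c5*c6) - u * (c5*c6))"
    by (simp add: rec A3 B3 A2 B2)
  also have "\<dots> = c5*c6*(c3*(c1+c4-w)+u)"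
    by (use I3 in algebra)
  finally have A4_1: "?A 4 (Suc 0) = c5*c6*(c3*(c1+c4-w)+u)" .
  have A4_2: "?A 4 2 = c1*c2*c3*c6"
    by (simp add: rec A3 B3 A2 B2)
  have A4_3: "?A 4 3 = c3*c4*c5*c6"
    by (simp add: rec A3 B3 A2 B2)
  note A4 = A4_0 A4_1 A4_2 A4_3
  have "?B 4 0 =
      c6 * (c1*(c3*c5 + c2*c3 + c5*c6 - w*(c3+c5) + 2*u)) + ((w - c6) * (c1*c5*c6) - u * (c1*c6))"
    by (simp add: rec A3 B3 A2 B2)
  also have "\<dots> = c1*c6*(c3*(c2+c5-w)+u)"
    by algebra
  finally have B4_0: "?B 4 0 = c1*c6*(c3*(c2+c5-w)+u)" .
  have "?B 4 (Suc 0) =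
      c2 * (c1*(c3*c5 + c2*c3 + c5*c6 - w*(c3+c5) + 2*u)) + ((w - c2) * (c1*c2*c3) - u * (c1*c2))"
    by (simp add: rec A3 B3 A2 B2)
  also have "\<dots> = c1*c2*(c5*(c3+c6-w)+u)"
    by algebra
  finally have B4_1: "?B 4 (Suc 0) = c1*c2*(c5*(c3+c6-w)+u)" .
  have B4_2: "?B 4 2 = c1*c4*c5*c6"
    by (simp add: rec A3 B3 A2 B2)
  have B4_3: "?B 4 3 = c1*c2*c3*c4"
    by (simp add: rec A3 B3 A2 B2)
  note B4 = B4_0 B4_1 B4_2 B4_3
  have "?A 5 0 =
      c1 * (c1*c6*(c3*(c2+c5-w)+u)) + ((w - c1) * (c1*c2*(c5*(c3+c6-w)+u)) - u * (c1*(c3*c5 + c2*c3 + c5*c6 - w*(c3+c5) + 2*u)))"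
    by (simp add: rec A4 B4 A3 B3)
  also have "\<dots> = c1*(c2*c3*c4*c5-(w-c6)*c5*(c3*(c2+c4-w)+u)+u*(c3*(c2+c5-w)+u))"
    by (use I6 in algebra)
  finally have A5_0: "?A 5 0 = c1*(c2*c3*c4*c5-(w-c6)*c5*(c3*(c2+c4-w)+u)+u*(c3*(c2+c5-w)+u))" .
  have "?A 5 (Suc 0) =
      c5 * (c1*c6*(c3*(c2+c5-w)+u)) + ((w - c5) * (c1*c4*c5*c6) - u * (c1*c5*c6))"
    by (simp add: rec A4 B4 A3 B3)
  also have "\<dots> = c1*c5*c6*(c3*(c2+c4-w)+u)"
    by (use R5 in algebra)
  finally have A5_1: "?A 5 (Suc 0) = c1*c5*c6*(c3*(c2+c4-w)+u)" .
  have "?A 5 2 =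
      c3 * (c1*c2*(c5*(c3+c6-w)+u)) + ((w - c3) * (c1*c2*c3*c4) - u * (c1*c2*c3))"
    by (simp add: rec A4 B4 A3 B3)
  also have "\<dots> = c1*c2*c3*(c5*(c4+c6-w)+u)"
    by (use R5 in algebra)
  finally have A5_2: "?A 5 2 = c1*c2*c3*(c5*(c4+c6-w)+u)" .
  have A5_3: "?A 5 3 = c1*c3*c4*c5*c6"
    by (simp add: rec A4 B4 A3 B3)
  have A5_4: "?A 5 4 = c1*c2*c3*c4*c5"
    by (simp add: rec A4 B4 A3 B3)
  note A5 = A5_0 A5_1 A5_2 A5_3 A5_4
  have "?B 5 0 =
      c6 * (c1*c6*(c3*(c2+c5-w)+u)) + ((w - c6) * (c5*c6*(c3*(c1+c4-w)+u)) - u * (c1*c5*c6))"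
    by (simp add: rec A4 B4 A3 B3)
  also have "\<dots> = c6*(c2*c3*c5*(c1+c4-w)+u*c3*(c2+c5-w)+u*u)"
    by (use I5 in algebra)
  finally have B5_0: "?B 5 0 = c6*(c2*c3*c5*(c1+c4-w)+u*c3*(c2+c5-w)+u*u)" .
  have "?B 5 (Suc 0) =
      c2 * (c1*c6*(c3*(c2+c5-w)+u)) + ((w - c2) * (c1*c2*c3*c6) - u * (c1*c2*c6))"
    by (simp add: rec A4 B4 A3 B3)
  also have "\<dots> = c1*c2*c3*c5*c6"
    by algebra
  finally have B5_1: "?B 5 (Suc 0) = c1*c2*c3*c5*c6" .
  have "?B 5 2 =
      c4 * (c5*c6*(c3*(c1+c4-w)+u)) + ((w - c4) * (c3*c4*c5*c6) - u * (c4*c5*c6))"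
    by (simp add: rec A4 B4 A3 B3)
  also have "\<dots> = c1*c3*c4*c5*c6"
    by algebra
  finally have B5_2: "?B 5 2 = c1*c3*c4*c5*c6" .
  have B5_3: "?B 5 3 = c1*c2*c3*c4*c6"
    by (simp add: rec A4 B4 A3 B3)
  have B5_4: "?B 5 4 = c2*c3*c4*c5*c6"
    by (simp add: rec A4 B4 A3 B3)
  note B5 = B5_0 B5_1 B5_2 B5_3 B5_4
  have "?A 6 0 =
      c1 * (c6*(c2*c3*c5*(c1+c4-w)+u*c3*(c2+c5-w)+u*u)) + ((w - c1) * (c1*c2*c3*c5*c6) - u * (c1*c6*(c3*(c2+c5-w)+u)))"
    by (simp add: rec A5 B5 A4 B4)
  also have "\<dots> = c1 * c2 * c3 * c4 * c5 * c6"
    by algebra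
  finally have A6_0: "?A 6 0 = c1 * c2 * c3 * c4 * c5 * c6" .
  have "?A 6 (Suc 0) =
      c5 * (c6*(c2*c3*c5*(c1+c4-w)+u*c3*(c2+c5-w)+u*u)) + ((w - c5) * (c1*c3*c4*c5*c6) - u * (c5*c6*(c3*(c1+c4-w)+u)))"
    by (simp add: rec A5 B5 A4 B4)
  also have "\<dots> = c1 * c2 * c3 * c4 * c5 * c6"
    by (use I7 in algebra)
  finally have A6_1: "?A 6 (Suc 0) = c1 * c2 * c3 * c4 * c5 * c6" .
  have "?A 6 2 =
      c3 * (c1*c2*c3*c5*c6) + ((w - c3) * (c1*c2*c3*c4*c6) - u * (c1*c2*c3*c6))"
    by (simp add: rec A5 B5 A4 B4)
  also have "\<dots> = c1 * c2 * c3 * c4 * c5 * c6"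
    by (use R5 in algebra)
  finally have A6_2: "?A 6 2 = c1 * c2 * c3 * c4 * c5 * c6" .
  have "?A 6 3 =
      c3 * (c1*c3*c4*c5*c6) + ((w - c3) * (c2*c3*c4*c5*c6) - u * (c3*c4*c5*c6))"
    by (simp add: rec A5 B5 A4 B4)
  also have "\<dots> = c1 * c2 * c3 * c4 * c5 * c6"
    by (use R3 in algebra)
  finally have A6_3: "?A 6 3 = c1 * c2 * c3 * c4 * c5 * c6" .
  have A6_4: "?A 6 4 = c1 * c2 * c3 * c4 * c5 * c6"
    by (simp add: rec A5 B5 A4 B4)
  have A6_5: "?A 6 5 = c1 * c2 * c3 * c4 * c5 * c6"
    by (simp add: rec A5 B5 A4 B4)
  note A6 = A6_0 A6_1 A6_2 A6_3 A6_4 A6_5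
  have "?B 6 0 =
      c6 * (c1*(c2*c3*c4*c5-(w-c6)*c5*(c3*(c2+c4-w)+u)+u*(c3*(c2+c5-w)+u))) + ((w - c6) * (c1*c5*c6*(c3*(c2+c4-w)+u)) - u * (c1*c6*(c3*(c2+c5-w)+u)))"
    by (simp add: rec A5 B5 A4 B4)
  also have "\<dots> = c1 * c2 * c3 * c4 * c5 * c6"
    by algebra
  finally have B6_0: "?B 6 0 = c1 * c2 * c3 * c4 * c5 * c6" .
  have "?B 6 (Suc 0) =
      c2 * (c1*(c2*c3*c4*c5-(w-c6)*c5*(c3*(c2+c4-w)+u)+u*(c3*(c2+c5-w)+u))) + ((w - c2) * (c1*c2*c3*(c5*(c4+c6-w)+u)) - u * (c1*c2*(c5*(c3+c6-w)+u)))"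
    by (simp add: rec A5 B5 A4 B4)
  also have "\<dots> = c1 * c2 * c3 * c4 * c5 * c6"
    by algebra
  finally have B6_1: "?B 6 (Suc 0) = c1 * c2 * c3 * c4 * c5 * c6" .
  have "?B 6 2 =
      c4 * (c1*c5*c6*(c3*(c2+c4-w)+u)) + ((w - c4) * (c1*c3*c4*c5*c6) - u * (c1*c4*c5*c6))"
    by (simp add: rec A5 B5 A4 B4)
  also have "\<dots> = c1 * c2 * c3 * c4 * c5 * c6"
    by algebra
  finally have B6_2: "?B 6 2 = c1 * c2 * c3 * c4 * c5 * c6" .
  have "?B 6 3 =
      c4 * (c1*c2*c3*(c5*(c4+c6-w)+u)) + ((w - c4) * (c1*c2*c3*c4*c5) - u * (c1*c2*c3*c4))"
    by (simp add: rec A5 B5 A4 B4)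
  also have "\<dots> = c1 * c2 * c3 * c4 * c5 * c6"
    by algebra
  finally have B6_3: "?B 6 3 = c1 * c2 * c3 * c4 * c5 * c6" .
  have B6_4: "?B 6 4 = c1 * c2 * c3 * c4 * c5 * c6"
    by (simp add: rec A5 B5 A4 B4)
  have B6_5: "?B 6 5 = c1 * c2 * c3 * c4 * c5 * c6"
    by (simp add: rec A5 B5 A4 B4)
  note B6 = B6_0 B6_1 B6_2 B6_3 B6_4 B6_5
  have "l = 0 \<or> l = 1 \<or> l = 2 \<or> l = 3 \<or> l = 4 \<or> l = 5" using l by auto
  then show "?A 6 l = c1 * c2 * c3 * c4 * c5 * c6" "?B 6 l = c1 * c2 * c3 * c4 * c5 * c6"
    by (elim disjE; simp only: A6 B6 One_nat_def)+
qed

lemma (in dihedral_action) kl_diff_3: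
  assumes "m = 3" and R: "c 1 * c 3 - u = c 2 * (c 1 + c 3 - w)"
  shows "kl m u V W x - kl m u W V x =
    alternating m S T (c 1 * c 2 * c 3 * x) - alternating m T S (c 1 * c 2 * c 3 * x)"
proof (rule kl_diff_sigma)
  have l: "l = 0 \<or> l = 1 \<or> l = 2" if "l < m" for l using that assms(1) by auto
  show "c 1 * alternating l T S x = alternating l T S ([c 1, c 2, c 3] ! l * x)" if "l < m" for l x
    using l[OF that] S_c T_c by (auto simp: assms(1) numeral_eq_Suc)
  show "c m * alternating l S T x = alternating l S T ([c 3, c 2, c 1] ! l * x)" if "l < m" for l x
    using l[OF that] S_c T_c by (auto simp: assms(1) numeral_eq_Suc)
qed (use klc_3[OF R] in \<open>simp_all add: assms(1)\<close>)

lemma (in dihedral_action) kl_diff_4: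
  assumes "m = 4"
    and R: "c 1 * c 4 - u = c 3 * (c 1 + c 4 - w)"
      "c 1 * c 3 - u = c 2 * (c 1 + c 3 - w)"
  shows "kl m u V W x - kl m u W V x =
    alternating m S T (c 1 * c 2 * c 3 * c 4 * x) - alternating m T S (c 1 * c 2 * c 3 * c 4 * x)"
proof (rule kl_diff_sigma)
  have l: "l = 0 \<or> l = 1 \<or> l = 2 \<or> l = 3" if "l < m" for l using that assms(1) by auto
  show "c 1 * alternating l T S x = alternating l T S ([c 1, c 3, c 3, c 1] ! l * x)" if "l < m" for l x
    using l[OF that] S_c T_c by (auto simp: assms(1) numeral_eq_Suc)
  show "c m * alternating l S T x = alternating l S T ([c 4, c 2, c 2, c 4] ! l * x)" if "l < m" for l x
    using l[OF that] S_c T_c by (auto simp: assms(1) numeral_eq_Suc)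
qed (use klc_4[OF R] in \<open>simp_all add: assms(1)\<close>)

lemma (in dihedral_action) kl_diff_6:
  assumes "m = 6"
    and R: "c 1 * c 6 - u = c 5 * (c 1 + c 6 - w)"
      "c 1 * c 5 - u = c 3 * (c 1 + c 5 - w)"
      "c 1 * c 3 - u = c 2 * (c 1 + c 3 - w)"
      "c 2 * c 6 - u = c 4 * (c 2 + c 6 - w)"
      "c 3 * c 5 - u = c 4 * (c 3 + c 5 - w)"
  shows "kl m u V W x - kl m u W V x =
    alternating m S T (c 1 * c 2 * c 3 * c 4 * c 5 * c 6 * x) - alternating m T S (c 1 * c 2 * c 3 * c 4 * c 5 * c 6 * x)"
proof (rule kl_diff_sigma)
  have l: "l = 0 \<or> l = 1 \<or> l = 2 \<or> l = 3 \<or> l = 4 \<or> l = 5" if "l < m" for l using that assms(1) by auto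
  show "c 1 * alternating l T S x = alternating l T S ([c 1, c 5, c 3, c 3, c 5, c 1] ! l * x)" if "l < m" for l x
    using l[OF that] S_c T_c by (auto simp: assms(1) numeral_eq_Suc)
  show "c m * alternating l S T x = alternating l S T ([c 6, c 2, c 4, c 4, c 2, c 6] ! l * x)" if "l < m" for l x
    using l[OF that] S_c T_c by (auto simp: assms(1) numeral_eq_Suc)
qed (use klc_6[OF R] in \<open>simp_all add: assms(1)\<close>)

subsection \<open>The field of rational functions\<close>

lemma cst_0 [simp]: "cst 0 = 0" and cst_1 [simp]: "cst 1 = 1"
  by (simp_all add: cst_def Zero_fract_def One_fract_def)

lemma cst_add: "cst (a + b) = cst a + cst b"
  and cst_diff: "cst (a - b) = cst a - cst b"
  and cst_minus: "cst (- a) = - cst a"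
  and cst_mult: "cst (a * b) = cst a * cst b"
  by (simp_all add: cst_def single_add single_diff mult_single single_uminus)

lemma cst_sum: "cst (sum f A) = (\<Sum>a\<in>A. cst (f a))"
  by (induction A rule: infinite_finite_induct) (auto simp: cst_add)

lemma cst_eq_0_iff [simp]: "cst a = (0 :: 'd::{finite,linorder} ratfun) \<longleftrightarrow> a = 0"
proof
  assume "cst a = (0 :: 'd ratfun)"
  then have "cst (a * inverse a) = (0 :: 'd ratfun)" by (simp only: cst_mult) simp
  then show "a = 0" by (cases "a = 0") auto
qed simp

lemma X_0 [simp]: "X 0 = 1"
  by (simp add: X_def One_fract_def)

lemma X_add: "X (\<nu> + \<mu>) = X \<nu> * X \<mu>"
  by (simp add: X_def mult_single)

lemma X_neq_0 [simp]: "X \<nu> \<noteq> 0"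
proof
  assume "X \<nu> = 0"
  then have "X (\<nu> + - \<nu>) = 0" by (simp only: X_add) simp
  then show False by simp
qed

lemma X_uminus: "X (- \<nu>) = inverse (X \<nu>)"
  using X_add[of \<nu> "- \<nu>"] by (simp add: inverse_unique)

lemma X_diff: "X (\<nu> - \<mu>) = X \<nu> / X \<mu>"
  using X_add[of \<nu> "- \<mu>"] by (simp add: X_uminus divide_inverse)

lemma one_minus_cst_X:
  assumes "\<beta> \<noteq> 0"
  shows "1 - cst a * X \<beta> \<noteq> 0"
proof -
  have "1 - cst a * X \<beta> = Fract (Poly_Mapping.single 0 1 - Poly_Mapping.single \<beta> a) 1"
    by (simp add: cst_def X_def One_fract_def mult_single)
  moreover have "Poly_Mapping.lookup (Poly_Mapping.single 0 1 - Poly_Mapping.single \<beta> a) 0 = 1"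
    using assms by (simp add: lookup_minus lookup_single)
  then have "Poly_Mapping.single 0 1 - Poly_Mapping.single \<beta> a \<noteq> 0"
    by (metis lookup_zero zero_neq_one)
  ultimately show ?thesis
    by (simp add: Zero_fract_def eq_fract)
qed

lemma one_minus_X: "\<beta> \<noteq> 0 \<Longrightarrow> 1 - X \<beta> \<noteq> 0"
  using one_minus_cst_X[of \<beta> 1] by simp

text \<open>Treats two kinds of automorphism together: permutations of the monomials
  (\<open>c\<close> constantly 1) and characters (\<open>w\<close> the identity).\<close>

locale laurent_subst =
  fixes c :: "'d::{finite,linorder} lat \<Rightarrow> complex" and w :: "'d lat \<Rightarrow> 'd lat"
  assumes w: "additive w" "inj w"
    and c: "\<And>\<nu>. c \<nu> \<noteq> 0" "\<And>\<nu> \<mu>. c (\<nu> + \<mu>) = c \<nu> * c \<mu>"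
begin

abbreviation "\<phi> \<equiv> subst_ratfun c w"

lemma c_0: "c 0 = 1"
  using c(2)[of 0 0] c(1)[of 0] by simp

lemma laurent_1 [simp]: "subst_laurent c w 1 = 1"
  using subst_laurent_single[of c w 0 1] by (simp add: c_0 additive.zero[OF w(1)])

lemma Fract: "q \<noteq> 0 \<Longrightarrow> \<phi> (Fract p q) = Fract (subst_laurent c w p) (subst_laurent c w q)"
  using subst_ratfun_Fract[OF w c] .

lemma laurent_neq_0: "q \<noteq> 0 \<Longrightarrow> subst_laurent c w q \<noteq> 0"
  using subst_laurent_eq_0_iff[OF w(2), of c] c(1) by auto

lemma add: "\<phi> (f + g) = \<phi> f + \<phi> g"
  by (cases f; cases g)
     (simp add: Fract laurent_neq_0 subst_laurent_add subst_laurent_mult[OF w(1) c(2)])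

lemma mult: "\<phi> (f * g) = \<phi> f * \<phi> g"
  by (cases f; cases g) (simp add: Fract laurent_neq_0 subst_laurent_mult[OF w(1) c(2)])

lemma X: "\<phi> (X \<nu>) = cst (c \<nu>) * X (w \<nu>)"
  by (simp add: X_def cst_def Fract mult_single)

lemma cst [simp]: "\<phi> (cst a) = cst a"
  by (simp add: cst_def Fract c_0 additive.zero[OF w(1)])

lemma zero [simp]: "\<phi> 0 = 0" and one [simp]: "\<phi> 1 = 1"
  using cst[of 0] cst[of 1] by simp_all

lemma diff: "\<phi> (f - g) = \<phi> f - \<phi> g"
  using add[of "f - g" g] by (simp add: algebra_simps)

lemma inverse: "\<phi> (inverse f) = inverse (\<phi> f)"
proof (cases "f = 0")
  case False
  then have "\<phi> f * \<phi> (inverse f) = 1" by (simp flip: mult)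
  then show ?thesis by (rule inverse_unique[symmetric])
qed simp

lemma divide: "\<phi> (f / g) = \<phi> f / \<phi> g"
  by (simp add: divide_inverse mult inverse)

lemma eq_0_iff: "\<phi> f = 0 \<longleftrightarrow> f = 0"
  using inverse[of f] mult[of f "inverse f"] by (cases "f = 0") auto

end

lemma subst_laurent_comp:
  "subst_laurent c w (subst_laurent c' w' p) = subst_laurent (\<lambda>\<nu>. c (w' \<nu>) * c' \<nu>) (w \<circ> w') p"
proof -
  have "subst_laurent c w (subst_laurent c' w' p) =
     (\<Sum>\<nu>\<in>Poly_Mapping.keys p. Poly_Mapping.single (w (w' \<nu>)) (c (w' \<nu>) * (c' \<nu> * Poly_Mapping.lookup p \<nu>)))"
    by (subst (2) subst_laurent_def) (simp add: subst_laurent_sum_right)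
  then show ?thesis by (simp add: subst_laurent_def mult.assoc)
qed

lemma subst_ratfun_comp:
  assumes "laurent_subst c w" "laurent_subst c' w'"
  shows "subst_ratfun c w (subst_ratfun c' w' f) = subst_ratfun (\<lambda>\<nu>. c (w' \<nu>) * c' \<nu>) (w \<circ> w') f"
proof -
  interpret a: laurent_subst c w by fact
  interpret b: laurent_subst c' w' by fact
  interpret ab: laurent_subst "\<lambda>\<nu>. c (w' \<nu>) * c' \<nu>" "w \<circ> w'"
    using a.w b.w by unfold_locales
      (auto simp: a.c b.c additive_def additive.add[OF a.w(1)] additive.add[OF b.w(1)] intro: inj_compose)
  show ?thesis
    by (cases f) (simp add: a.Fract b.Fract ab.Fract b.laurent_neq_0 subst_laurent_comp)
qed

lemma additive_frag_cmul_int: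
  fixes f :: "'d lat \<Rightarrow> int"
  assumes "additive f"
  shows "f (frag_cmul k \<nu>) = k * f \<nu>"
proof (induction k rule: int_induct[where k = 0])
  case base
  then show ?case by (simp add: additive.zero[OF assms])
next
  case (step1 i)
  then show ?case by (simp add: frag_cmul_distrib additive.add[OF assms] algebra_simps)
next
  case (step2 i)
  then show ?case by (simp add: frag_cmul_diff_distrib additive.diff[OF assms] algebra_simps)
qed

lemma laurent_decompose:
  fixes p :: "'d::{finite,linorder} laurent"
  shows "Fract p 1 = (\<Sum>\<nu>\<in>Poly_Mapping.keys p. cst (Poly_Mapping.lookup p \<nu>) * X \<nu>)"
proof -
  have s: "Fract (sum f A) 1 = (\<Sum>a\<in>A. Fract (f a) 1)" for f :: "'b \<Rightarrow> 'd laurent" and A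
  proof (induction A rule: infinite_finite_induct)
    case (insert x F)
    then show ?case by (simp add: insert(3)[symmetric])
  qed (simp_all add: fract_collapse)
  show ?thesis
    by (subst poly_mapping_sum_single[of p], subst s)
       (simp add: cst_def X_def mult_single)
qed

lemma cis_eq_1_iff:
  assumes "n > 0"
  shows "cis (2 * pi * of_int d / of_nat n) = 1 \<longleftrightarrow> int n dvd d"
proof
  assume "cis (2 * pi * of_int d / of_nat n) = 1"
  then have "cos (2 * pi * of_int d / of_nat n) = 1" by (simp add: complex_eq_iff)
  then obtain k :: int where "2 * pi * of_int d / of_nat n = of_int k * 2 * pi"
    by (auto simp: cos_one_2pi_int)
  then have "(of_int d :: real) = of_int (k * int n)"
    using assms by (simp add: field_simps)
  then have "d = k * int n" by (simp only: of_int_eq_iff)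
  then show "int n dvd d" by simp
next
  assume "int n dvd d"
  then obtain k where "d = int n * k" by blast
  then show "cis (2 * pi * of_int d / of_nat n) = 1"
    using assms cis_multiple_2pi[of "of_int k"] by (simp add: mult.assoc)
qed

text \<open>Orthogonality of the characters of the integers modulo \<open>n\<close>, which makes the
  averages \<open>proj\<close> below into projections.\<close>

lemma sum_cis:
  assumes "n > 0"
  shows "(\<Sum>k<n. cis (2 * pi * of_int (int k * d) / of_nat n)) = (if int n dvd d then of_nat n else 0)"
proof -
  let ?z = "cis (2 * pi * of_int d / of_nat n)"
  have pow: "?z ^ k = cis (2 * pi * of_int (int k * d) / of_nat n)" for k
    by (simp add: DeMoivre algebra_simps)
  have "?z ^ n = 1"
    unfolding pow using assms by (subst cis_eq_1_iff) auto
  then show ?thesis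
    unfolding pow[symmetric] using geometric_sum[of ?z n] cis_eq_1_iff[OF assms, of d]
    by (cases "?z = 1") auto
qed

subsection \<open>The metaplectic action\<close>

locale metaplectic_data =
  fixes \<Phi> :: "'d::{finite,linorder} lat set"
    and coroot :: "'d lat \<Rightarrow> 'd lat \<Rightarrow> int"
    and S :: "'d lat set"
    and Q :: "'d lat \<Rightarrow> int"
    and n :: nat and v :: complex and g :: "nat \<Rightarrow> complex"
  assumes root_system: "root_system \<Phi> coroot"
    and S: "finite S" "S \<subseteq> \<Phi>"
    and quadratic_form: "quadratic_form Q"
    and Q_invariant: "w \<in> weyl_group \<Phi> coroot \<Longrightarrow> Q (w \<nu>) = Q \<nu>"
    and Q_nonzero: "\<beta> \<in> S \<Longrightarrow> Q \<beta> \<noteq> 0"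
    and n: "n > 0"
    and v: "v \<noteq> 0"
    and g: "i < n \<Longrightarrow> g i \<noteq> 0" "g 0 = -1" "0 < i \<Longrightarrow> i < n \<Longrightarrow> g i * g (n - i) = inverse v"
begin

abbreviation "s \<equiv> refl coroot"
abbreviation "L \<equiv> Lambda0 S Q n"
abbreviation "K0 \<equiv> component L 0"
abbreviation "B \<equiv> bil Q"
abbreviation "\<sigma> \<equiv> metaplectic coroot S Q n v g"
abbreviation "m \<equiv> mexp n Q"

lemma coroot_add: "\<beta> \<in> \<Phi> \<Longrightarrow> coroot \<beta> (\<nu> + \<mu>) = coroot \<beta> \<nu> + coroot \<beta> \<mu>"
  and coroot_diff: "\<beta> \<in> \<Phi> \<Longrightarrow> coroot \<beta> (\<nu> - \<mu>) = coroot \<beta> \<nu> - coroot \<beta> \<mu>"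
  and coroot_zero: "\<beta> \<in> \<Phi> \<Longrightarrow> coroot \<beta> 0 = 0"
  and coroot_cmul: "\<beta> \<in> \<Phi> \<Longrightarrow> coroot \<beta> (frag_cmul k \<nu>) = k * coroot \<beta> \<nu>"
  and coroot_self: "\<beta> \<in> \<Phi> \<Longrightarrow> coroot \<beta> \<beta> = 2"
  and root_neq_0: "\<beta> \<in> \<Phi> \<Longrightarrow> \<beta> \<noteq> 0"
  and refl_root: "\<beta> \<in> \<Phi> \<Longrightarrow> \<gamma> \<in> \<Phi> \<Longrightarrow> s \<beta> \<gamma> \<in> \<Phi>"
  and coroot_refl: "\<beta> \<in> \<Phi> \<Longrightarrow> \<gamma> \<in> \<Phi> \<Longrightarrow> coroot (s \<beta> \<gamma>) (s \<beta> \<nu>) = coroot \<gamma> \<nu>"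
  using root_system unfolding root_system_def
  by (auto simp: additive.add additive.diff additive.zero additive_frag_cmul_int)

lemma S_root: "\<beta> \<in> S \<Longrightarrow> \<beta> \<in> \<Phi>"
  using S by auto

lemma refl_refl: "\<beta> \<in> \<Phi> \<Longrightarrow> s \<beta> (s \<beta> \<nu>) = \<nu>"
  by (simp add: refl_def coroot_diff coroot_cmul coroot_self flip: frag_cmul_distrib)

lemma additive_refl: "\<beta> \<in> \<Phi> \<Longrightarrow> additive (s \<beta>)"
  by (simp add: additive_def refl_def coroot_add frag_cmul_distrib)

lemma inj_refl: "\<beta> \<in> \<Phi> \<Longrightarrow> inj (s \<beta>)"
  by (metis refl_refl injI)

lemma refl_self: "\<beta> \<in> \<Phi> \<Longrightarrow> s \<beta> \<beta> = - \<beta>"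
  by (simp add: refl_def coroot_self frag_cmul_distrib[of 1 1, simplified])

lemma refl_cmul: "\<beta> \<in> \<Phi> \<Longrightarrow> s \<beta> (frag_cmul k \<nu>) = frag_cmul k (s \<beta> \<nu>)"
  by (simp add: refl_def coroot_cmul frag_cmul_distrib2 diff_conv_add_uminus del: add_uminus_conv_diff)

lemma B_sym: "B \<nu> \<mu> = B \<mu> \<nu>"
  by (simp add: bil_def add.commute)

lemma B_add: "B (\<nu> + \<nu>') \<mu> = B \<nu> \<mu> + B \<nu>' \<mu>"
  and B_diff: "B (\<nu> - \<nu>') \<mu> = B \<nu> \<mu> - B \<nu>' \<mu>"
  and B_cmul: "B (frag_cmul k \<nu>) \<mu> = k * B \<nu> \<mu>"
  and B_zero: "B 0 \<mu> = 0"
proof -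
  have "additive (\<lambda>\<nu>. B \<nu> \<mu>)" using quadratic_form by (auto simp: quadratic_form_def)
  then show "B (\<nu> + \<nu>') \<mu> = B \<nu> \<mu> + B \<nu>' \<mu>" "B (\<nu> - \<nu>') \<mu> = B \<nu> \<mu> - B \<nu>' \<mu>"
    "B (frag_cmul k \<nu>) \<mu> = k * B \<nu> \<mu>" "B 0 \<mu> = 0"
    by (fact additive.add additive.diff additive_frag_cmul_int additive.zero)+
qed

lemma Q_refl: "\<beta> \<in> \<Phi> \<Longrightarrow> Q (s \<beta> \<nu>) = Q \<nu>"
  using Q_invariant[of "s \<beta> \<circ> id"] weyl_group.intros by fastforce

lemma Q_cmul: "Q (frag_cmul k \<nu>) = k\<^sup>2 * Q \<nu>"
  using quadratic_form by (auto simp: quadratic_form_def)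

lemma B_self: "B \<nu> \<nu> = 2 * Q \<nu>"
  using Q_cmul[of 2 \<nu>] frag_cmul_distrib[of 1 1 \<nu>] by (simp add: bil_def)

text \<open>Expanding \<open>Q (s \<beta> \<nu>) = Q \<nu>\<close> gives the formula multiplied by
  \<open>coroot \<beta> \<nu>\<close>. If this factor vanishes, apply the result to \<nu> + \<beta>,
  where the coroot takes the value 2.\<close>

lemma B_root:
  assumes "\<beta> \<in> \<Phi>"
  shows "B \<nu> \<beta> = coroot \<beta> \<nu> * Q \<beta>"
proof -
  have *: "B \<nu> \<beta> = coroot \<beta> \<nu> * Q \<beta>" if "coroot \<beta> \<nu> \<noteq> 0" for \<nu>
  proof -
    have "Q \<nu> = Q (\<nu> + frag_cmul (- coroot \<beta> \<nu>) \<beta>)"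
      using Q_refl[OF assms, of \<nu>] by (simp add: refl_def flip: minus_frag_cmul)
    also have "\<dots> = B (frag_cmul (- coroot \<beta> \<nu>) \<beta>) \<nu> + Q \<nu> + Q (frag_cmul (- coroot \<beta> \<nu>) \<beta>)"
      by (simp add: bil_def add.commute)
    finally have "coroot \<beta> \<nu> * B \<nu> \<beta> = coroot \<beta> \<nu> * (coroot \<beta> \<nu> * Q \<beta>)"
      by (simp add: B_cmul Q_cmul power2_eq_square B_sym[of \<beta>] algebra_simps)
    then show ?thesis using that by simp
  qed
  show ?thesis
  proof (cases "coroot \<beta> \<nu> = 0")
    case True
    then have "B (\<nu> + \<beta>) \<beta> = 2 * Q \<beta>"
      using *[of "\<nu> + \<beta>"] assms by (simp add: coroot_add coroot_self)
    then show ?thesis using True by (simp add: B_add B_self)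
  qed (rule *)
qed

lemma m_pos: "m \<beta> > 0"
  using n by (simp add: mexp_def pos_imp_zdiv_pos_iff zdvd_imp_le)

text \<open>\<open>m \<beta>\<close> is the order of \<open>Q \<beta>\<close> modulo
  \<open>n\<close>. This translates congruences modulo \<open>n\<close> for \<open>B\<close> into
  congruences modulo \<open>m \<beta>\<close> for coroots.\<close>

lemma n_dvd_iff: "int n dvd k * Q \<beta> \<longleftrightarrow> m \<beta> dvd k"
proof -
  let ?d = "gcd (int n) (Q \<beta>)"
  have d: "?d \<noteq> 0" using n by simp
  obtain a b where ab: "int n = a * ?d" "Q \<beta> = b * ?d" "coprime a b"
    using gcd_coprime_exists[OF d] by blast
  have "m \<beta> = a" unfolding mexp_def using ab(1) d by (metis nonzero_mult_div_cancel_right)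
  moreover have "int n dvd k * Q \<beta> \<longleftrightarrow> a dvd k * b"
    using ab(1,2) d by (metis dvd_mult_cancel_right mult.assoc)
  ultimately show ?thesis using ab(3) by (simp add: coprime_dvd_mult_left_iff)
qed

lemma L_iff: "\<nu> \<in> L \<longleftrightarrow> (\<forall>\<beta>\<in>S. m \<beta> dvd coroot \<beta> \<nu>)"
proof -
  have "int n dvd B \<beta> \<nu> \<longleftrightarrow> m \<beta> dvd coroot \<beta> \<nu>" if "\<beta> \<in> S" for \<beta>
    using that by (subst B_sym) (simp add: B_root S_root n_dvd_iff)
  then show ?thesis by (auto simp: Lambda0_def)
qed

lemma L_add: "\<nu> \<in> L \<Longrightarrow> \<mu> \<in> L \<Longrightarrow> \<nu> + \<mu> \<in> L"
  and L_uminus: "\<nu> \<in> L \<Longrightarrow> - \<nu> \<in> L"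
  and L_zero: "0 \<in> L"
  using coroot_diff[of _ 0 \<nu>] S by (auto simp: L_iff coroot_add coroot_zero)

lemma L_diff: "\<nu> \<in> L \<Longrightarrow> \<mu> \<in> L \<Longrightarrow> \<nu> - \<mu> \<in> L"
  using L_add[of \<nu> "- \<mu>"] L_uminus by simp

lemma L_cmul: "\<nu> \<in> L \<Longrightarrow> frag_cmul k \<nu> \<in> L"
  using S by (auto simp: L_iff coroot_cmul)

lemma m_root_in_L: "\<beta> \<in> \<Phi> \<Longrightarrow> frag_cmul (m \<beta>) \<beta> \<in> L"
  using n_dvd_iff[of "m \<beta>" \<beta>] by (auto simp: Lambda0_def B_sym[of _ "frag_cmul _ _"] B_cmul)
    (metis B_root B_sym dvd_mult mult.left_commute mult.commute)

lemma refl_L: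
  assumes "\<beta> \<in> S" "\<nu> \<in> L" shows "s \<beta> \<nu> \<in> L"
proof -
  obtain k where "coroot \<beta> \<nu> = k * m \<beta>"
    using assms L_iff by (metis dvd_def mult.commute)
  then show ?thesis
    using L_cmul[OF m_root_in_L[of \<beta>], of k] assms S by (auto simp: refl_def intro!: L_diff)
qed

lemma laurent_subst_char: "\<xi> \<in> characters_mod M \<Longrightarrow> laurent_subst \<xi> id"
  by unfold_locales (auto simp: characters_mod_def additive_def)

lemma laurent_subst_perm: "\<beta> \<in> \<Phi> \<Longrightarrow> laurent_subst (\<lambda>_. 1) (s \<beta>)"
  by unfold_locales (use additive.add[OF additive_refl] inj_refl in auto)

lemmas perm_add = laurent_subst.add[OF laurent_subst_perm, folded perm_def]
  and perm_diff = laurent_subst.diff[OF laurent_subst_perm, folded perm_def]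
  and perm_mult = laurent_subst.mult[OF laurent_subst_perm, folded perm_def]
  and perm_divide = laurent_subst.divide[OF laurent_subst_perm, folded perm_def]
  and perm_X = laurent_subst.X[OF laurent_subst_perm, folded perm_def, simplified]
  and perm_cst = laurent_subst.cst[OF laurent_subst_perm, folded perm_def]
  and perm_zero = laurent_subst.zero[OF laurent_subst_perm, folded perm_def]
  and perm_one = laurent_subst.one[OF laurent_subst_perm, folded perm_def]
  and perm_eq_0_iff = laurent_subst.eq_0_iff[OF laurent_subst_perm, folded perm_def]

lemma K0_iff: "f \<in> K0 \<longleftrightarrow> (\<forall>\<xi>\<in>characters_mod L. subst_ratfun \<xi> id f = f)"
  by (auto simp: component_def laurent_subst.c_0[OF laurent_subst_char])

lemma K0_add: "f \<in> K0 \<Longrightarrow> h \<in> K0 \<Longrightarrow> f + h \<in> K0"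
  and K0_diff: "f \<in> K0 \<Longrightarrow> h \<in> K0 \<Longrightarrow> f - h \<in> K0"
  and K0_mult: "f \<in> K0 \<Longrightarrow> h \<in> K0 \<Longrightarrow> f * h \<in> K0"
  and K0_divide: "f \<in> K0 \<Longrightarrow> h \<in> K0 \<Longrightarrow> f / h \<in> K0"
  and K0_cst: "cst a \<in> K0"
  and K0_one: "1 \<in> K0"
  and K0_zero: "0 \<in> K0"
  by (simp_all add: K0_iff laurent_subst.add[OF laurent_subst_char] laurent_subst.diff[OF laurent_subst_char]
    laurent_subst.mult[OF laurent_subst_char] laurent_subst.divide[OF laurent_subst_char]
    laurent_subst.cst[OF laurent_subst_char] laurent_subst.one[OF laurent_subst_char] laurent_subst.zero[OF laurent_subst_char])

lemma K0_X: "\<nu> \<in> L \<Longrightarrow> X \<nu> \<in> K0"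
  by (simp add: K0_iff laurent_subst.X[OF laurent_subst_char]) (simp add: characters_mod_def)

lemma X_component: "h \<in> K0 \<Longrightarrow> X \<nu> * h \<in> component L \<nu>"
  by (simp add: component_def laurent_subst.c_0[OF laurent_subst_char] laurent_subst.mult[OF laurent_subst_char]
      laurent_subst.X[OF laurent_subst_char])

text \<open>The reflection conjugates a character \<xi> into \<open>\<xi> \<circ> s \<beta>\<close>,
  which is again trivial on \<open>L\<close> because \<open>L\<close> is stable under
  \<open>s \<beta>\<close>.\<close>

lemma K0_perm:
  assumes \<beta>: "\<beta> \<in> S" and f: "f \<in> K0"
  shows "perm (s \<beta>) f \<in> K0"
proof -
  have "subst_ratfun \<xi> id (perm (s \<beta>) f) = perm (s \<beta>) f" if \<xi>: "\<xi> \<in> characters_mod L" for \<xi>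
  proof -
    have \<beta>': "\<beta> \<in> \<Phi>" using \<beta> by (rule S_root)
    have \<xi>': "\<xi> \<circ> s \<beta> \<in> characters_mod L"
      using \<xi> refl_L[OF \<beta>] by (auto simp: characters_mod_def additive.add[OF additive_refl[OF \<beta>']])
    have "subst_ratfun \<xi> id (perm (s \<beta>) f) = subst_ratfun (\<lambda>\<nu>. \<xi> (s \<beta> \<nu>)) (s \<beta>) f"
      unfolding perm_def
      by (subst subst_ratfun_comp[OF laurent_subst_char[OF \<xi>] laurent_subst_perm[OF \<beta>']]) simp
    also have "\<dots> = perm (s \<beta>) (subst_ratfun (\<xi> \<circ> s \<beta>) id f)"
      unfolding perm_def
      by (subst subst_ratfun_comp[OF laurent_subst_perm[OF \<beta>'] laurent_subst_char[OF \<xi>']]) (simp add: o_def)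
    also have "subst_ratfun (\<xi> \<circ> s \<beta>) id f = f" using f \<xi>' by (simp add: K0_iff)
    finally show ?thesis .
  qed
  then show ?thesis by (simp add: K0_iff)
qed

section \<open>Norms, and the field as the span of the monomials over \<open>K0\<close>\<close>

definition chi :: "'d lat \<Rightarrow> nat \<Rightarrow> 'd lat \<Rightarrow> complex"
  where "chi \<beta> k \<nu> = cis (2 * pi * of_int (int k * B \<nu> \<beta>) / of_nat n)"

lemma chi_char:
  assumes "\<beta> \<in> S"
  shows "chi \<beta> k \<in> characters_mod L"
proof -
  have "chi \<beta> k (\<nu> + \<mu>) = chi \<beta> k \<nu> * chi \<beta> k \<mu>" for \<nu> \<mu>
    unfolding chi_def by (simp add: B_add cis_mult add_divide_distrib algebra_simps)
  moreover have "chi \<beta> k \<nu> = 1" if "\<nu> \<in> L" for \<nu>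
    unfolding chi_def using that assms n
    by (subst cis_eq_1_iff) (auto simp: Lambda0_def B_sym[of \<nu>])
  ultimately show ?thesis by (auto simp: characters_mod_def chi_def)
qed

lemma chi_add: "chi \<beta> j \<nu> * chi \<beta> k \<nu> = chi \<beta> (j + k) \<nu>"
  by (simp add: chi_def cis_mult add_divide_distrib algebra_simps)

lemma chi_0: "chi \<beta> 0 = (\<lambda>_. 1)"
  by (rule ext) (simp add: chi_def)

lemma chi_n: "chi \<beta> n = chi \<beta> 0"
  by (rule ext) (use n in \<open>simp add: chi_def cis_eq_1_iff flip: of_int_mult\<close>)

lemma chi_1_eq_1_iff: "chi \<beta> 1 \<nu> = 1 \<longleftrightarrow> int n dvd B \<nu> \<beta>"
  using n by (simp add: chi_def cis_eq_1_iff)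

lemma subst_id_cong:
  assumes "\<And>\<nu>. \<nu> \<in> Poly_Mapping.keys p \<Longrightarrow> c \<nu> = c' \<nu>"
  shows "subst_laurent c id p = subst_laurent c' id p"
  unfolding subst_laurent_def by (intro sum.cong) (use assms in auto)

lemma subst_id_1: "subst_laurent (\<lambda>_. 1) id p = p"
  unfolding subst_laurent_def using poly_mapping_sum_single[of p] by simp

lemma lookup_subst_id: "Poly_Mapping.lookup (subst_laurent c id p) \<nu> = c \<nu> * Poly_Mapping.lookup p \<nu>"
  by (auto simp: subst_laurent_def lookup_sum lookup_single when_def in_keys_iff sum.delta)

text \<open>The multiple is a product of norms over the cyclic groups generated by \<open>chi \<beta> 1\<close>.\<close>

lemma exists_multiple_in_L:
  fixes q :: "'d laurent"
  assumes "q \<noteq> 0"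
  shows "\<exists>q'. q' \<noteq> 0 \<and> Poly_Mapping.keys (q * q') \<subseteq> L"
proof -
  have "finite T \<Longrightarrow> T \<subseteq> S \<Longrightarrow> \<exists>q'. q' \<noteq> 0 \<and> Poly_Mapping.keys (q * q') \<subseteq> Lambda0 T Q n" for T
  proof (induction T rule: finite_induct)
    case empty
    show ?case by (rule exI[of _ 1]) (auto simp: Lambda0_def)
  next
    case (insert \<beta> T)
    then obtain q' where q': "q' \<noteq> 0" "Poly_Mapping.keys (q * q') \<subseteq> Lambda0 T Q n" by auto
    have \<beta>: "\<beta> \<in> S" using insert by auto
    define p where "p = q * q'"
    have p: "p \<noteq> 0" using q' assms by (simp add: p_def)
    define F where "F k = subst_laurent (chi \<beta> k) id p" for k
    interpret chi: laurent_subst "chi \<beta> k" id for k by (rule laurent_subst_char[OF chi_char[OF \<beta>]])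
    have F0: "F 0 = p" unfolding F_def by (simp add: chi_0 subst_id_1)
    have "F n = F 0" by (simp add: F_def chi_n)
    define N where "N = (\<Prod>k<n. F k)"
    have "N = F 0 * (\<Prod>k<n - 1. F (Suc k))"
      unfolding N_def using n by (metis Suc_pred' prod.lessThan_Suc_shift)
    then have N: "N = q * (q' * (\<Prod>k<n - 1. F (Suc k)))" by (simp add: F0 p_def mult.assoc)
    have F_neq: "F k \<noteq> 0" for k unfolding F_def using chi.laurent_neq_0 p by blast
    have "subst_laurent (chi \<beta> 1) id N = (\<Prod>k<n. F (Suc k))"
    proof -
      have "subst_laurent (chi \<beta> 1) id (prod F A) = (\<Prod>k\<in>A. F (Suc k))" for A
      proof (induction A rule: infinite_finite_induct)
        case (insert k A)
        have "subst_laurent (chi \<beta> 1) id (F k) = F (Suc k)"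
          unfolding F_def subst_laurent_comp by (simp add: chi_add)
        with insert show ?case
          by (simp only: prod.insert not_False_eq_True subst_laurent_mult[OF chi.w(1) chi.c(2)])
      qed (simp_all only: prod.empty prod.infinite chi.laurent_1 not_False_eq_True)
      then show ?thesis by (simp add: N_def)
    qed
    also have "\<dots> = N"
    proof -
      have "F 0 * (\<Prod>k<n. F (Suc k)) = F n * N"
        unfolding N_def by (metis mult.commute prod.lessThan_Suc prod.lessThan_Suc_shift)
      then show ?thesis using \<open>F n = F 0\<close> F_neq[of 0] by simp
    qed
    finally have inv: "subst_laurent (chi \<beta> 1) id N = N" .
    \<comment> \<open>Invariance forces \<open>chi \<beta> 1\<close> to be 1 on the support, which
      is the congruence belonging to \<beta>.\<close>
    have "int n dvd B \<beta> \<nu>" if "\<nu> \<in> Poly_Mapping.keys N" for \<nu>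
    proof -
      have "chi \<beta> 1 \<nu> * Poly_Mapping.lookup N \<nu> = Poly_Mapping.lookup N \<nu>"
        using inv lookup_subst_id by metis
      then show ?thesis using that chi_1_eq_1_iff[of \<beta> \<nu>] by (simp add: in_keys_iff B_sym[of \<beta>])
    qed
    \<comment> \<open>Twisting by a character does not enlarge the support, so the congruences
      already obtained for \<open>T\<close> survive in the norm.\<close>
    moreover have "Poly_Mapping.keys (prod F A) \<subseteq> Lambda0 T Q n" for A
    proof (induction A rule: infinite_finite_induct)
      case (insert k A)
      have "Poly_Mapping.keys (F k) \<subseteq> Lambda0 T Q n"
        using q'(2) unfolding F_def p_def[symmetric] by (auto simp: in_keys_iff lookup_subst_id)
      moreover have "\<nu> + \<mu> \<in> Lambda0 T Q n" if "\<nu> \<in> Lambda0 T Q n" "\<mu> \<in> Lambda0 T Q n" for \<nu> \<mu>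
        using that by (auto simp: Lambda0_def B_sym[of _ "\<nu> + \<mu>"] B_add) (simp add: B_sym dvd_add)
      ultimately show ?case
        using insert keys_mult[of "F k" "prod F A"] by (simp add: subset_iff) blast
    qed (auto simp: Lambda0_def B_zero B_sym[of _ 0])
    ultimately have "Poly_Mapping.keys N \<subseteq> Lambda0 (insert \<beta> T) Q n"
      unfolding N_def by (fastforce simp: Lambda0_def)
    then show ?case
      using F_neq q'(1) by (intro exI[of _ "q' * (\<Prod>k<n - 1. F (Suc k))"]) (auto simp: N)
  qed
  from this[OF S(1) order.refl] show ?thesis .
qed

text \<open>Extending the fraction by a suitable factor moves its denominator into
  \<open>K0\<close>, so \<open>K0\<close>-multiples of monomials span the field additively. Hence an
  additive map is determined by its values on them, and identities between semilinear maps need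
  checking only on monomials.\<close>

lemma ratfun_induct [case_names add X]:
  assumes add: "\<And>f f'. P f \<Longrightarrow> P f' \<Longrightarrow> P (f + f')"
    and X: "\<And>\<nu> h. h \<in> K0 \<Longrightarrow> P (h * X \<nu>)"
  shows "P f"
proof (cases f)
  case (Fract p q)
  obtain q' where q': "q' \<noteq> 0" "Poly_Mapping.keys (q * q') \<subseteq> L"
    using exists_multiple_in_L[OF Fract(2)] by blast
  let ?N = "Fract (q * q') 1"
  have "subst_laurent \<xi> id (q * q') = q * q'" if "\<xi> \<in> characters_mod L" for \<xi>
  proof -
    have "subst_laurent \<xi> id (q * q') = subst_laurent (\<lambda>_. 1) id (q * q')"
      by (rule subst_id_cong) (use that q'(2) in \<open>auto simp: characters_mod_def\<close>)
    then show ?thesis by (simp add: subst_id_1)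
  qed
  then have N: "?N \<in> K0"
    by (simp add: K0_iff laurent_subst.Fract[OF laurent_subst_char] laurent_subst.laurent_1[OF laurent_subst_char])
  have "f = Fract (p * q') 1 / ?N"
    using q'(1) Fract by (simp add: eq_fract)
  also have "\<dots> = (\<Sum>\<nu>\<in>Poly_Mapping.keys (p * q'). cst (Poly_Mapping.lookup (p * q') \<nu>) / ?N * X \<nu>)"
    unfolding laurent_decompose[of "p * q'"] by (simp add: sum_divide_distrib)
  also have "P \<dots>"
  proof -
    have "P (\<Sum>\<nu>\<in>A. cst (c \<nu>) / ?N * X \<nu>)" for A c
    proof (induction A rule: infinite_finite_induct)
      case (insert \<nu> A)
      then show ?case by (simp del: times_divide_eq_left) (intro add X K0_divide K0_cst N)
    qed (use X[OF K0_zero] in simp_all)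
    then show ?thesis .
  qed
  finally show ?thesis .
qed

end

lemma frag_cmul_uminus: "frag_cmul k (- \<nu>) = frag_cmul (- k) \<nu>"
  by (rule poly_mapping_eqI) simp

context metaplectic_data
begin

section \<open>Existence and uniqueness of the additive extension\<close>

lemma metaplectic_on_cong:
  assumes \<beta>: "\<beta> \<in> S" and "int n dvd B \<nu> \<beta> - B \<mu> \<beta>"
  shows "metaplectic_on coroot Q n v g \<beta> \<nu> f = metaplectic_on coroot Q n v g \<beta> \<mu> f"
proof -
  have div: "B \<nu> \<beta> div Q \<beta> = coroot \<beta> \<nu>" for \<nu>
    using Q_nonzero[OF \<beta>] by (simp add: B_root S_root \<beta>)
  have "m \<beta> dvd coroot \<beta> \<nu> - coroot \<beta> \<mu>"
    using assms(2) n_dvd_iff[of "coroot \<beta> \<nu> - coroot \<beta> \<mu>" \<beta>] by (simp add: B_root S_root \<beta> left_diff_distrib)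
  then have "(- coroot \<beta> \<nu>) mod m \<beta> = (- coroot \<beta> \<mu>) mod m \<beta>"
    by (simp add: mod_eq_dvd_iff dvd_diff_commute)
  moreover have "(Q \<beta> - B \<nu> \<beta>) mod int n = (Q \<beta> - B \<mu> \<beta>) mod int n"
    using assms(2) by (simp add: mod_eq_dvd_iff dvd_diff_commute)
  ultimately show ?thesis
    by (simp add: metaplectic_on_def Let_def gpar_def div)
qed

lemma metaplectic_on_add:
  "\<beta> \<in> S \<Longrightarrow> metaplectic_on coroot Q n v g \<beta> \<nu> (f + h) =
    metaplectic_on coroot Q n v g \<beta> \<nu> f + metaplectic_on coroot Q n v g \<beta> \<nu> h"
  by (simp add: metaplectic_on_def Let_def perm_add S_root add_divide_distrib distrib_right)

text \<open>Fourier projection onto the part where \<open>B \<nu> \<beta>\<close> is congruent to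
  \<open>a\<close> modulo \<open>n\<close>. It is coarser than the decomposition into components,
  but the formula for the action of \<beta> depends on \<nu> only through this residue, so
  \<open>n\<close> projections suffice.\<close>

definition proj :: "'d lat \<Rightarrow> nat \<Rightarrow> 'd ratfun \<Rightarrow> 'd ratfun"
  where "proj \<beta> a f = cst (1 / of_nat n) *
    (\<Sum>k<n. cst (cis (2 * pi * of_int (int k * - int a) / of_nat n)) * subst_ratfun (chi \<beta> k) id f)"

lemma proj_add: "\<beta> \<in> S \<Longrightarrow> proj \<beta> a (f + h) = proj \<beta> a f + proj \<beta> a h"
  by (simp add: proj_def laurent_subst.add[OF laurent_subst_char[OF chi_char]] distrib_left sum.distrib)

lemma proj_component:
  assumes "\<beta> \<in> S" and "f \<in> component L \<nu>"
  shows "proj \<beta> a f = (if int n dvd B \<nu> \<beta> - int a then f else 0)"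
proof -
  have "cst (cis (2 * pi * of_int (int k * - int a) / of_nat n)) * subst_ratfun (chi \<beta> k) id f =
      cst (cis (2 * pi * of_int (int k * (B \<nu> \<beta> - int a)) / of_nat n)) * f" for k
  proof -
    have "subst_ratfun (chi \<beta> k) id f = cst (chi \<beta> k \<nu>) * f"
      using assms chi_char by (auto simp: component_def)
    moreover have "cis (2 * pi * of_int (int k * - int a) / of_nat n) * chi \<beta> k \<nu> =
        cis (2 * pi * of_int (int k * (B \<nu> \<beta> - int a)) / of_nat n)"
      unfolding chi_def cis_mult add_divide_distrib[symmetric] distrib_left[symmetric] of_int_add[symmetric]
      by (simp add: right_diff_distrib)
    ultimately show ?thesis by (simp only: mult.assoc[symmetric] cst_mult[symmetric])
  qed
  then have "proj \<beta> a f = cst (1 / of_nat n) *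
      cst (\<Sum>k<n. cis (2 * pi * of_int (int k * (B \<nu> \<beta> - int a)) / of_nat n)) * f"
    by (simp only: proj_def cst_sum sum_distrib_right mult.assoc)
  moreover have "cst (1 / of_nat n) * cst (of_nat n) = (1 :: 'd ratfun)"
    using n unfolding cst_mult[symmetric] by simp
  ultimately show ?thesis
    by (simp add: sum_cis[OF n] del: of_int_mult)
qed

lemma metaplectic_props:
  assumes \<beta>: "\<beta> \<in> S"
  shows "additive (\<sigma> \<beta>)"
    and "f \<in> component L \<nu> \<Longrightarrow> \<sigma> \<beta> f = metaplectic_on coroot Q n v g \<beta> \<nu> f"
proof -
  let ?M = "metaplectic_on coroot Q n v g \<beta>"
  let ?P = "\<lambda>s. additive s \<and> (\<forall>\<nu>. \<forall>f\<in>component L \<nu>. s f = ?M \<nu> f)"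
  \<comment> \<open>If no weight has residue \<open>a\<close>, then \<open>rep a\<close> is
    arbitrary; \<open>proj \<beta> a\<close> kills every component in that case.\<close>
  define rep where "rep a = (SOME \<nu>. int n dvd B \<nu> \<beta> - int a)" for a
  define s0 where "s0 f = (\<Sum>a<n. ?M (rep a) (proj \<beta> a f))" for f
  have "?P s0"
  proof (intro conjI allI ballI)
    show "additive s0"
      by (simp add: additive_def s0_def proj_add[OF \<beta>] metaplectic_on_add[OF \<beta>] sum.distrib)
    fix \<nu> f assume f: "f \<in> component L \<nu>"
    define a where "a = nat (B \<nu> \<beta> mod int n)"
    have a: "a < n" "int n dvd B \<nu> \<beta> - int a"
      using n by (simp_all add: a_def nat_less_iff)
    have "s0 f = (\<Sum>b<n. if b = a then ?M (rep a) f else 0)"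
      unfolding s0_def
    proof (intro sum.cong refl)
      fix b assume b: "b \<in> {..<n}"
      show "?M (rep b) (proj \<beta> b f) = (if b = a then ?M (rep a) f else 0)"
      proof (cases "b = a")
        case False
        have "\<not> int n dvd B \<nu> \<beta> - int b"
        proof
          assume "int n dvd B \<nu> \<beta> - int b"
          then have "int n dvd (B \<nu> \<beta> - int b) - (B \<nu> \<beta> - int a)" using a(2) by (rule dvd_diff)
          then have "int n dvd int a - int b" by simp
          then have "int a mod int n = int b mod int n" by (simp only: mod_eq_dvd_iff)
          then show False using a(1) b False by simp
        qed
        then show ?thesis
          using False by (simp add: proj_component[OF \<beta> f] metaplectic_on_def Let_def perm_zero S_root \<beta>)
      qed (use a in \<open>simp add: proj_component[OF \<beta> f]\<close>)
    qed
    also have "\<dots> = ?M (rep a) f" using a by simp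
    also have "\<dots> = ?M \<nu> f"
    proof (rule metaplectic_on_cong[OF \<beta>])
      have "int n dvd B (rep a) \<beta> - int a" unfolding rep_def by (rule someI) (fact a)
      then have "int n dvd (B (rep a) \<beta> - int a) - (B \<nu> \<beta> - int a)" using a(2) by (rule dvd_diff)
      then show "int n dvd B (rep a) \<beta> - B \<nu> \<beta>" by simp
    qed
    finally show "s0 f = ?M \<nu> f" .
  qed
  moreover have "s1 = s2" if "?P s1" "?P s2" for s1 s2
  proof
    fix f
    show "s1 f = s2 f"
    proof (induction f rule: ratfun_induct)
      case (add f f')
      have "s1 (f + f') = s1 f + s1 f'" "s2 (f + f') = s2 f + s2 f'"
        using that by (auto simp: additive_def)
      then show ?case using add by simp
    next
      case (X \<nu> h)
      then have "h * X \<nu> \<in> component L \<nu>" using X_component[of h \<nu>] by (simp add: mult.commute)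
      then have "s1 (h * X \<nu>) = ?M \<nu> (h * X \<nu>)" "s2 (h * X \<nu>) = ?M \<nu> (h * X \<nu>)" using that by blast+
      then show ?case by simp
    qed
  qed
  ultimately have "?P (THE s. ?P s)"
    by (intro theI[where P = ?P])
  then have "?P (\<sigma> \<beta>)"
    unfolding metaplectic_def .
  then show "additive (\<sigma> \<beta>)"
    and "f \<in> component L \<nu> \<Longrightarrow> \<sigma> \<beta> f = metaplectic_on coroot Q n v g \<beta> \<nu> f"
    by auto
qed

lemmas sigma_add = additive.add[OF metaplectic_props(1)]
  and sigma_diff = additive.diff[OF metaplectic_props(1)]
  and sigma_zero = additive.zero[OF metaplectic_props(1)]

lemma sigma_semilinear:
  assumes \<beta>: "\<beta> \<in> S" and h: "h \<in> K0"
  shows "\<sigma> \<beta> (h * f) = perm (s \<beta>) h * \<sigma> \<beta> f"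
proof (induction f rule: ratfun_induct)
  case (add f f')
  then show ?case using \<beta> by (simp add: distrib_left sigma_add)
next
  case (X \<nu> h')
  have "h' * X \<nu> \<in> component L \<nu>" "h * (h' * X \<nu>) \<in> component L \<nu>"
    using X_component[of h' \<nu>] X_component[of "h * h'" \<nu>] X h
    by (simp_all add: mult_ac K0_mult)
  then show ?case
    by (simp add: metaplectic_props(2)[OF \<beta>] metaplectic_on_def Let_def perm_mult S_root \<beta>)
qed

lemma sigma_cst: "\<beta> \<in> S \<Longrightarrow> \<sigma> \<beta> (cst a * f) = cst a * \<sigma> \<beta> f"
  by (simp add: sigma_semilinear K0_cst perm_cst S_root)

section \<open>The action on monomials\<close>

definition Y :: "'d lat \<Rightarrow> int \<Rightarrow> 'd ratfun"
  where "Y \<beta> k = X (frag_cmul (m \<beta> * k) \<beta>)"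

lemma Y_add: "Y \<beta> (j + k) = Y \<beta> j * Y \<beta> k"
  by (simp add: Y_def distrib_left frag_cmul_distrib X_add)

lemma Y_zero [simp]: "Y \<beta> 0 = 1"
  by (simp add: Y_def)

lemma Y_neq_0 [simp]: "Y \<beta> k \<noteq> 0"
  by (simp add: Y_def)

lemma Y_uminus: "Y \<beta> (- k) = 1 / Y \<beta> k"
  using Y_add[of \<beta> k "- k"] by (simp add: field_simps)

lemma Y_K0: "\<beta> \<in> \<Phi> \<Longrightarrow> Y \<beta> k \<in> K0"
  using L_cmul[OF m_root_in_L, of \<beta> k] by (simp add: Y_def K0_X mult.commute)

lemma perm_Y: "\<beta> \<in> \<Phi> \<Longrightarrow> perm (s \<beta>) (Y \<beta> k) = Y \<beta> (- k)"
  by (simp add: Y_def perm_X refl_cmul refl_self frag_cmul_uminus)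

lemma one_minus_Y: "\<beta> \<in> \<Phi> \<Longrightarrow> 1 - Y \<beta> 1 \<noteq> 0"
  and one_minus_cst_Y: "\<beta> \<in> \<Phi> \<Longrightarrow> 1 - cst a * Y \<beta> 1 \<noteq> 0"
proof -
  assume "\<beta> \<in> \<Phi>"
  then have "frag_cmul (m \<beta> * 1) \<beta> \<noteq> 0"
    using m_pos[of \<beta>] root_neq_0[of \<beta>] by simp
  then show "1 - Y \<beta> 1 \<noteq> 0" "1 - cst a * Y \<beta> 1 \<noteq> 0"
    unfolding Y_def by (fact one_minus_X one_minus_cst_X)+
qed

text \<open>The shift by one is the dot action: \<open>ecoef \<beta> \<nu>\<close> is the value of the coroot at \<open>\<nu> - \<rho>\<close>.\<close>

definition ecoef :: "'d lat \<Rightarrow> 'd lat \<Rightarrow> int"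
  where "ecoef \<beta> \<nu> = coroot \<beta> \<nu> - 1"

definition dot :: "'d lat \<Rightarrow> 'd lat \<Rightarrow> 'd lat"
  where "dot \<beta> \<nu> = \<nu> - frag_cmul (ecoef \<beta> \<nu>) \<beta>"

lemma ecoef_dot: "\<beta> \<in> \<Phi> \<Longrightarrow> ecoef \<beta> (dot \<beta> \<nu>) = - ecoef \<beta> \<nu>"
  by (simp add: ecoef_def dot_def coroot_diff coroot_cmul coroot_self)

text \<open>Since the remainder in the definition differs from \<open>- coroot \<beta> \<nu>\<close>
  by a multiple of \<open>m \<beta>\<close>, the first summand is a power of y times the original
  monomial; the second is the dot-reflected monomial divided by y. So \<sigma> preserves the
  \<open>K0\<close>-span of these two monomials.\<close>

lemma sigma_X:
  assumes \<beta>: "\<beta> \<in> S"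
  shows "(1 - cst v * Y \<beta> 1) * \<sigma> \<beta> (X \<nu>) =
    (1 - cst v) * Y \<beta> ((- ecoef \<beta> \<nu> - 1) div m \<beta>) * X \<nu>
    + cst v * cst (gpar n g (- ecoef \<beta> \<nu> * Q \<beta>)) * (1 - 1 / Y \<beta> 1) * X (dot \<beta> \<nu>)"
proof -
  let ?c = "coroot \<beta> \<nu>" and ?m = "m \<beta>"
  have \<beta>': "\<beta> \<in> \<Phi>" using \<beta> by (rule S_root)
  have div: "B \<nu> \<beta> div Q \<beta> = ?c" and B: "Q \<beta> - B \<nu> \<beta> = - ecoef \<beta> \<nu> * Q \<beta>"
    using Q_nonzero[OF \<beta>] by (simp_all add: B_root \<beta>' ecoef_def algebra_simps)
  have "X \<nu> \<in> component L \<nu>" using X_component[OF K0_one, of \<nu>] by simp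
  then have "\<sigma> \<beta> (X \<nu>) = metaplectic_on coroot Q n v g \<beta> \<nu> (X \<nu>)"
    by (rule metaplectic_props(2)[OF \<beta>])
  then have "(1 - cst v * Y \<beta> 1) * \<sigma> \<beta> (X \<nu>) = X (s \<beta> \<nu>) *
      (X (frag_cmul (- ((- ?c) mod ?m)) \<beta>) * (1 - cst v)
       - cst v * cst (gpar n g (- ecoef \<beta> \<nu> * Q \<beta>)) * X (frag_cmul (1 - ?m) \<beta>) * (1 - Y \<beta> 1))"
    using one_minus_cst_Y[OF \<beta>', of v]
    by (simp add: metaplectic_on_def Let_def div B perm_X \<beta>' Y_def)
  also have "\<dots> = (1 - cst v) * (X (s \<beta> \<nu>) * X (frag_cmul (- ((- ?c) mod ?m)) \<beta>))
      - cst v * cst (gpar n g (- ecoef \<beta> \<nu> * Q \<beta>)) * (1 - Y \<beta> 1) * (X (s \<beta> \<nu>) * X (frag_cmul (1 - ?m) \<beta>))"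
    by (simp only: algebra_simps)
  also have "X (s \<beta> \<nu>) * X (frag_cmul (- ((- ?c) mod ?m)) \<beta>) = Y \<beta> ((- ecoef \<beta> \<nu> - 1) div ?m) * X \<nu>"
  proof -
    have "(- ?c) mod ?m = - ?c - ?m * ((- ?c) div ?m)"
      by (simp add: minus_mult_div_eq_mod)
    moreover have "s \<beta> \<nu> + frag_cmul (- a) \<beta> = frag_cmul (?m * b) \<beta> + \<nu>" if "a = - ?c - ?m * b" for a b
      by (intro poly_mapping_eqI) (simp add: that refl_def lookup_add lookup_minus algebra_simps)
    ultimately have "s \<beta> \<nu> + frag_cmul (- ((- ?c) mod ?m)) \<beta> = frag_cmul (?m * ((- ?c) div ?m)) \<beta> + \<nu>"
      by blast
    moreover have "- ecoef \<beta> \<nu> - 1 = - ?c" by (simp add: ecoef_def)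
    ultimately show ?thesis by (simp only: Y_def X_add[symmetric])
  qed
  also have "X (s \<beta> \<nu>) * X (frag_cmul (1 - ?m) \<beta>) = X (dot \<beta> \<nu>) / Y \<beta> 1"
  proof -
    have "s \<beta> \<nu> + frag_cmul (1 - ?m) \<beta> = dot \<beta> \<nu> - frag_cmul (?m * 1) \<beta>"
      by (intro poly_mapping_eqI) (simp add: refl_def dot_def ecoef_def lookup_add lookup_minus algebra_simps)
    then show ?thesis by (simp only: Y_def X_add[symmetric] X_diff[symmetric])
  qed
  also have "cst v * cst (gpar n g (- ecoef \<beta> \<nu> * Q \<beta>)) * (1 - Y \<beta> 1) * (X (dot \<beta> \<nu>) / Y \<beta> 1) =
     - (cst v * cst (gpar n g (- ecoef \<beta> \<nu> * Q \<beta>)) * (1 - 1 / Y \<beta> 1) * X (dot \<beta> \<nu>))"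
    by (simp add: divide_simps) (simp add: algebra_simps)
  finally show ?thesis by simp
qed

lemma gpar_neq_0: "gpar n g j \<noteq> 0"
  using n g(1) by (simp add: gpar_def nat_less_iff)

lemma gpar_mult:
  assumes "\<not> int n dvd j" shows "gpar n g j * gpar n g (- j) = inverse v"
proof -
  define i where "i = nat (j mod int n)"
  have i: "int i = j mod int n"
    using n by (simp add: i_def)
  have "i \<noteq> 0"
    using i assms by (metis dvd_eq_mod_eq_0 of_nat_0)
  moreover have "i < n"
    using i n by (metis of_nat_0_less_iff of_nat_less_iff pos_mod_bound)
  moreover have "(- j) mod int n = int (n - i)"
    using zmod_zminus1_eq_if[of j "int n"] assms i \<open>i < n\<close> by (metis dvd_eq_mod_eq_0 less_imp_le of_nat_diff)
  then have "nat ((- j) mod int n) = n - i" by simp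
  ultimately show ?thesis
    using g(3)[of i] by (simp add: gpar_def i_def)
qed

lemma gpar_dvd: "int n dvd j \<Longrightarrow> gpar n g j = -1"
  by (simp add: gpar_def g(2))

text \<open>On a wall the two monomials of \<open>sigma_X\<close> differ by a power of y and the
  parameter is g(0) = -1. The sum then contains the factor 1 - v y, which cancels.\<close>

lemma sigma_X_wall:
  assumes \<beta>: "\<beta> \<in> S" and e: "ecoef \<beta> \<nu> = m \<beta> * l"
  shows "\<sigma> \<beta> (X \<nu>) = Y \<beta> (- l - 1) * X \<nu>"
proof -
  have \<beta>': "\<beta> \<in> \<Phi>" using \<beta> by (rule S_root)
  have "(- ecoef \<beta> \<nu> - 1) div m \<beta> = - l - 1"
  proof -
    have "- ecoef \<beta> \<nu> - 1 = (m \<beta> - 1) + m \<beta> * (- l - 1)"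
      by (simp add: e algebra_simps)
    then have "(- ecoef \<beta> \<nu> - 1) div m \<beta> = (- l - 1) + (m \<beta> - 1) div m \<beta>"
      using m_pos[of \<beta>] by (metis div_mult_self2 less_irrefl)
    then show ?thesis using m_pos[of \<beta>] by simp
  qed
  moreover have "gpar n g (- ecoef \<beta> \<nu> * Q \<beta>) = -1"
    using n_dvd_iff[of "- ecoef \<beta> \<nu>" \<beta>] by (intro gpar_dvd) (simp add: e)
  moreover have "X (dot \<beta> \<nu>) = Y \<beta> (- l) * X \<nu>"
    by (simp add: dot_def e Y_def X_diff X_uminus divide_inverse mult.commute flip: minus_frag_cmul)
  ultimately have "(1 - cst v * Y \<beta> 1) * \<sigma> \<beta> (X \<nu>) =
     (1 - cst v) * Y \<beta> (- l - 1) * X \<nu> - cst v * (1 - 1 / Y \<beta> 1) * (Y \<beta> (- l) * X \<nu>)"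
    using sigma_X[OF \<beta>, of \<nu>] by (simp add: cst_minus)
  moreover have "Y \<beta> (- l) = Y \<beta> (- l - 1) * Y \<beta> 1"
    by (simp flip: Y_add)
  ultimately have "(1 - cst v * Y \<beta> 1) * \<sigma> \<beta> (X \<nu>) = (1 - cst v * Y \<beta> 1) * (Y \<beta> (- l - 1) * X \<nu>)"
    by (simp add: field_simps)
  then show ?thesis using one_minus_cst_Y[OF \<beta>'] by simp
qed

end

text \<open>The square of the matrix of \<sigma> on the span of a monomial Z and its dot reflection
  Z', first row. The coefficient of Z' vanishes by \<open>b * (y * a) = 1\<close>; that of Z is (1 -
  V)^2 + V (1 - y)(1 - 1/y), by \<open>V * (G * G') = 1\<close>.\<close>

lemma involution_identity:
  fixes V y a b G G' Z Z' :: "'a::field"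
  assumes "y \<noteq> 0" "a \<noteq> 0" "b * (y * a) = 1" "V * (G * G') = 1"
  shows "(1 - V) / a * ((1 - V) * a * Z + V * G * (1 - 1 / y) * Z')
     + V * G * (1 - y) * ((1 - V) * b * Z' + V * G' * (1 - 1 / y) * Z) = (1 - V * y) * ((1 - V / y) * Z)"
proof -
  define i j where "i = inverse y" and "j = inverse a"
  have "y * i = 1" "a * j = 1" using assms by (simp_all add: i_def j_def)
  then show ?thesis
    using assms(3,4) unfolding divide_inverse i_def[symmetric] j_def[symmetric] by algebra
qed

context metaplectic_data
begin

lemma perm_refl_refl:
  assumes "\<beta> \<in> \<Phi>" shows "perm (s \<beta>) (perm (s \<beta>) f) = f"
  by (cases f) (simp add: perm_def laurent_subst.Fract laurent_subst_perm laurent_subst.laurent_neq_0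
      assms subst_laurent_comp o_def refl_refl subst_id_1[unfolded id_def])

lemma dot_dot: "\<beta> \<in> \<Phi> \<Longrightarrow> dot \<beta> (dot \<beta> \<nu>) = \<nu>"
  by (simp add: dot_def[of _ "dot \<beta> \<nu>"] ecoef_dot) (simp add: dot_def flip: minus_frag_cmul)

lemma sigma_sigma:
  assumes \<beta>: "\<beta> \<in> S"
  shows "\<sigma> \<beta> (\<sigma> \<beta> f) = f"
proof -
  have \<beta>': "\<beta> \<in> \<Phi>" using \<beta> by (rule S_root)
  have X: "\<sigma> \<beta> (\<sigma> \<beta> (X \<nu>)) = X \<nu>" for \<nu>
  proof (cases "m \<beta> dvd ecoef \<beta> \<nu>")
    case True
    then obtain l where l: "ecoef \<beta> \<nu> = m \<beta> * l" by blast
    show ?thesis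
      by (simp add: sigma_X_wall[OF \<beta> l] sigma_semilinear[OF \<beta>] Y_K0 \<beta>' perm_Y flip: Y_add mult.assoc)
  next
    case False
    let ?e = "ecoef \<beta> \<nu>" and ?y = "Y \<beta> 1" and ?m = "m \<beta>"
    let ?k = "(- ?e - 1) div ?m" and ?k' = "(?e - 1) div ?m"
    let ?G = "cst (gpar n g (- ?e * Q \<beta>)) :: 'd ratfun" and ?G' = "cst (gpar n g (?e * Q \<beta>)) :: 'd ratfun"
    let ?V = "cst v :: 'd ratfun"
    \<comment> \<open>The exponents at \<nu> and at its dot reflection are the floors of (-e - 1)/m
      and (e - 1)/m. Their sum is -1 off the walls, and this yields
      \<open>b * (y * a) = 1\<close>.\<close>
    have k: "?k + ?k' = -1"
    proof -
      define a where "a = ?e div ?m"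
      define b where "b = ?e mod ?m"
      have e: "?e = ?m * a + b" by (simp add: a_def b_def)
      have b: "0 < b" "b < ?m"
        using False m_pos[of \<beta>] pos_mod_sign[of ?m ?e] pos_mod_bound[of ?m ?e]
        unfolding b_def dvd_eq_mod_eq_0 by linarith+
      have "?e - 1 = (b - 1) + ?m * a" "- ?e - 1 = (?m - b - 1) + ?m * (- a - 1)"
        by (simp_all add: e algebra_simps)
      then have "?k' = a + (b - 1) div ?m" "?k = (- a - 1) + (?m - b - 1) div ?m"
        using b by (metis div_mult_self2 less_irrefl less_trans)+
      then show ?thesis using b by simp
    qed
    have GG: "?V * (?G * ?G') = 1"
      using gpar_mult[of "- ?e * Q \<beta>"] False n_dvd_iff[of "?e" \<beta>] v by (simp flip: cst_mult)
    note dd = dot_dot[OF \<beta>', of \<nu>]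
    define Z Z' where "Z = (X \<nu> :: 'd ratfun)" and "Z' = (X (dot \<beta> \<nu>) :: 'd ratfun)"
    have 1: "(1 - ?V * ?y) * \<sigma> \<beta> Z = (1 - ?V) * Y \<beta> ?k * Z + ?V * ?G * (1 - 1 / ?y) * Z'"
      using sigma_X[OF \<beta>, of \<nu>] by (simp add: Z_def Z'_def)
    have 2: "(1 - ?V * ?y) * \<sigma> \<beta> Z' = (1 - ?V) * Y \<beta> ?k' * Z' + ?V * ?G' * (1 - 1 / ?y) * Z"
      using sigma_X[OF \<beta>, of "dot \<beta> \<nu>"] by (simp add: Z_def Z'_def ecoef_dot \<beta>' dd)
    have K: "1 - ?V * ?y \<in> K0" "(1 - ?V) * Y \<beta> ?k \<in> K0" "?V * ?G * (1 - 1 / ?y) \<in> K0"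
      by (intro K0_diff K0_mult K0_one K0_cst K0_divide Y_K0 \<beta>')+
    have "(1 - ?V / ?y) * \<sigma> \<beta> (\<sigma> \<beta> Z) = \<sigma> \<beta> ((1 - ?V * ?y) * \<sigma> \<beta> Z)"
      by (simp add: sigma_semilinear[OF \<beta> K(1)] perm_diff perm_mult perm_one perm_cst perm_Y \<beta>' Y_uminus)
    also have "\<dots> = (1 - ?V) / Y \<beta> ?k * \<sigma> \<beta> Z + ?V * ?G * (1 - ?y) * \<sigma> \<beta> Z'"
      unfolding 1 sigma_add[OF \<beta>] sigma_semilinear[OF \<beta> K(2)] sigma_semilinear[OF \<beta> K(3)]
      by (simp add: perm_diff perm_mult perm_divide perm_one perm_cst perm_Y \<beta>' Y_uminus)
    finally have 3: "(1 - ?V / ?y) * \<sigma> \<beta> (\<sigma> \<beta> Z) = (1 - ?V) / Y \<beta> ?k * \<sigma> \<beta> Z + ?V * ?G * (1 - ?y) * \<sigma> \<beta> Z'" .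
    have "(1 - ?V * ?y) * ((1 - ?V / ?y) * \<sigma> \<beta> (\<sigma> \<beta> Z)) =
        (1 - ?V) / Y \<beta> ?k * ((1 - ?V * ?y) * \<sigma> \<beta> Z) + ?V * ?G * (1 - ?y) * ((1 - ?V * ?y) * \<sigma> \<beta> Z')"
      unfolding 3 distrib_left by (simp only: mult.left_commute)
    also have "\<dots> = (1 - ?V) / Y \<beta> ?k * ((1 - ?V) * Y \<beta> ?k * Z + ?V * ?G * (1 - 1 / ?y) * Z')
        + ?V * ?G * (1 - ?y) * ((1 - ?V) * Y \<beta> ?k' * Z' + ?V * ?G' * (1 - 1 / ?y) * Z)"
      unfolding 1 2 ..
    also have "\<dots> = (1 - ?V * ?y) * ((1 - ?V / ?y) * Z)"
    proof (rule involution_identity[OF _ _ _ GG])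
      have "?k' = - 1 - ?k" using k by simp
      then have "Y \<beta> ?k' * (?y * Y \<beta> ?k) = Y \<beta> ((- 1 - ?k) + (1 + ?k))" by (simp only: Y_add)
      then show "Y \<beta> ?k' * (?y * Y \<beta> ?k) = 1" by simp
    qed simp_all
    finally have "(1 - ?V * ?y) * ((1 - ?V / ?y) * \<sigma> \<beta> (\<sigma> \<beta> Z)) = (1 - ?V * ?y) * ((1 - ?V / ?y) * Z)" .
    moreover have "1 - ?V / ?y \<noteq> 0"
      using perm_eq_0_iff[OF \<beta>', of "1 - ?V * ?y"] one_minus_cst_Y[OF \<beta>', of v]
      by (simp add: perm_diff perm_mult perm_one perm_cst perm_Y \<beta>' Y_uminus)
    ultimately show ?thesis
      using one_minus_cst_Y[OF \<beta>', of v] by (simp add: Z_def)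
  qed
  show ?thesis
  proof (induction f rule: ratfun_induct)
    case (X \<nu> h)
    then show ?case
      by (simp add: sigma_semilinear[OF \<beta>] K0_perm[OF \<beta>] perm_refl_refl[OF \<beta>'] \<open>\<And>\<nu>. \<sigma> \<beta> (\<sigma> \<beta> (X \<nu>)) = X \<nu>\<close>)
  qed (simp add: sigma_add \<beta>)
qed

subsection \<open>Demazure-Lusztig operators\<close>

definition U :: "complex \<Rightarrow> 'd lat \<Rightarrow> 'd ratfun \<Rightarrow> 'd ratfun"
  where "U t \<beta> f = (1 - cst t * Y \<beta> 1) * ((f - Y \<beta> 1 * \<sigma> \<beta> f) / (1 - Y \<beta> 1))"

abbreviation "T \<equiv> demazure_lusztig coroot S Q n v g"

lemma demazure_eq: "demazure coroot S Q n v g \<beta> f = U 0 \<beta> f"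
  by (simp add: demazure_def U_def Let_def Y_def)

lemma T_eq: "T \<beta> f = U v \<beta> f - f"
  by (simp add: demazure_lusztig_def demazure_def U_def Let_def Y_def)

lemma U_additive: "\<beta> \<in> S \<Longrightarrow> additive (U t \<beta>)"
  by (simp add: additive_def U_def sigma_add distrib_left add_divide_distrib[symmetric] add_diff_add)

lemma T_additive: "\<beta> \<in> S \<Longrightarrow> additive (T \<beta>)"
  using additive.add[OF U_additive] by (simp add: additive_def T_eq)

text \<open>The gauge condition replaces the reflected factor by \<open>h\<close> itself and turns 1
  - t y into 1 - t/y. The coefficient of \<open>\<sigma> \<beta> f\<close> then becomes - (1 - t/y)
  y / (1 - y), which is the reflection of \<open>c\<close>.\<close>

lemma U_gauge:
  assumes \<beta>: "\<beta> \<in> S" and h: "h \<in> K0"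
    and gauge: "perm (s \<beta>) h * (1 - cst t * Y \<beta> 1) = h * (1 - cst t / Y \<beta> 1)"
    and c: "c = (1 - cst t * Y \<beta> 1) / (1 - Y \<beta> 1)"
  shows "U t \<beta> (h * f) = h * (c * f + \<sigma> \<beta> (c * f))"
proof -
  have \<beta>': "\<beta> \<in> \<Phi>" using \<beta> by (rule S_root)
  let ?y = "Y \<beta> 1"
  have c0: "c \<in> K0" unfolding c by (intro K0_diff K0_mult K0_one K0_cst K0_divide Y_K0 \<beta>')
  have pc: "perm (s \<beta>) c = (1 - cst t / ?y) / (1 - 1 / ?y)"
    by (simp add: c perm_diff perm_divide perm_mult perm_one perm_cst perm_Y \<beta>' Y_uminus)
  have y: "?y \<noteq> 0" "1 - ?y \<noteq> 0" using one_minus_Y[OF \<beta>'] by simp_all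
  have "U t \<beta> (h * f) = h * c * f - (perm (s \<beta>) h * (1 - cst t * ?y)) * ?y * \<sigma> \<beta> f / (1 - ?y)"
    unfolding U_def sigma_semilinear[OF \<beta> h] c by (simp add: diff_divide_distrib right_diff_distrib mult_ac)
  also have "\<dots> = h * (c * f - (1 - cst t / ?y) * ?y * \<sigma> \<beta> f / (1 - ?y))"
    unfolding gauge by (simp add: algebra_simps)
  also have "- ((1 - cst t / ?y) * ?y * \<sigma> \<beta> f / (1 - ?y)) = perm (s \<beta>) c * \<sigma> \<beta> f"
    unfolding pc using y by (simp add: divide_simps) (simp add: algebra_simps)
  then have "h * (c * f - (1 - cst t / ?y) * ?y * \<sigma> \<beta> f / (1 - ?y)) = h * (c * f + perm (s \<beta>) c * \<sigma> \<beta> f)"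
    by simp
  finally show ?thesis by (simp add: sigma_semilinear[OF \<beta> c0])
qed

lemma c_reflect:
  fixes y t :: "'a::field"
  assumes "y \<noteq> 0" "1 - y \<noteq> 0"
  shows "(1 - t * (1 / y)) / (1 - 1 / y) = 1 + t - (1 - t * y) / (1 - y)"
proof -
  have "(1 - t * (1 / y)) / (1 - 1 / y) = (y - t) / (y - 1)"
    using assms by (simp add: divide_simps)
  also have "\<dots> = (t - y) / (1 - y)"
    by (metis minus_diff_eq minus_divide_divide)
  also have "\<dots> = 1 + t - (1 - t * y) / (1 - y)"
    using assms by (simp add: divide_simps) (simp add: algebra_simps)
  finally show ?thesis .
qed

text \<open>In rank one \<open>h = 1 - v y\<close> is a gauge factor and turns \<open>T + 1\<close>
  into (1 + \<sigma>) c. The square of that is c + s(c) = 1 + v times itself, because 1 + \<sigma>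
  has \<sigma>-fixed values.\<close>

lemma T_quadratic:
  assumes \<beta>: "\<beta> \<in> S"
  shows "T \<beta> (T \<beta> f) = (cst v - 1) * T \<beta> f + cst v * f"
proof -
  have \<beta>': "\<beta> \<in> \<Phi>" using \<beta> by (rule S_root)
  define y where "y = (Y \<beta> 1 :: 'd ratfun)"
  define c where "c = (1 - cst v * y) / (1 - y)"
  define h where "h = 1 - cst v * y"
  have y: "y \<noteq> 0" "1 - y \<noteq> 0" using one_minus_Y[OF \<beta>'] by (simp_all add: y_def)
  have K: "c \<in> K0" "h \<in> K0" "1 / (1 - y) \<in> K0"
    unfolding c_def h_def y_def by (intro K0_diff K0_mult K0_one K0_cst K0_divide Y_K0 \<beta>')+
  have U: "U v \<beta> (h * f) = h * (c * f + \<sigma> \<beta> (c * f))" for f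
    by (rule U_gauge[OF \<beta> K(2)])
      (simp_all add: c_def h_def y_def perm_diff perm_mult perm_one perm_cst perm_Y \<beta>' Y_uminus mult.commute)
  have h0: "h \<noteq> 0" using one_minus_cst_Y[OF \<beta>', of v] by (simp add: h_def y_def)
  have pc: "perm (s \<beta>) c + c = 1 + cst v"
    using c_reflect[OF y, of "cst v"]
    by (simp add: c_def y_def perm_diff perm_divide perm_mult perm_one perm_cst perm_Y \<beta>' Y_uminus)
  have UU: "U v \<beta> (U v \<beta> f) = (1 + cst v) * U v \<beta> f" for f
  proof -
    define z where "z = c * (f / h) + \<sigma> \<beta> (c * (f / h))"
    have z: "\<sigma> \<beta> z = z" by (simp add: z_def sigma_add \<beta> sigma_sigma add.commute)
    have "U v \<beta> f = h * z" using U[of "f / h"] h0 by (simp add: z_def)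
    moreover have "U v \<beta> (h * z) = h * ((perm (s \<beta>) c + c) * z)"
      unfolding U sigma_semilinear[OF \<beta> K(1)] z by (simp add: algebra_simps)
    ultimately show ?thesis by (simp add: pc mult_ac)
  qed
  show ?thesis
    unfolding T_eq additive.diff[OF U_additive[OF \<beta>]] UU by (simp add: algebra_simps)
qed

lemma T_cst:
  assumes "\<beta> \<in> S" shows "T \<beta> (cst a * f) = cst a * T \<beta> f"
  unfolding T_eq U_def sigma_cst[OF assms] by (simp add: diff_divide_distrib algebra_simps)

text \<open>The scalars by which \<open>T\<close> permutes monomials. The value at 0 is separate:
  there the monomial is fixed by the dot reflection and is an eigenvector of \<open>T\<close> for
  -1, while the general formula would give - v.\<close>

definition tau :: "'d lat \<Rightarrow> int \<Rightarrow> complex"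
  where "tau \<beta> e = (if e = 0 then -1 else v * gpar n g (- e * Q \<beta>))"

lemma T_X:
  assumes \<beta>: "\<beta> \<in> S" and e: "- m \<beta> \<le> ecoef \<beta> \<nu>" "ecoef \<beta> \<nu> \<le> 0"
  shows "T \<beta> (X \<nu>) = cst (tau \<beta> (ecoef \<beta> \<nu>)) * X (dot \<beta> \<nu>)"
proof -
  have \<beta>': "\<beta> \<in> \<Phi>" using \<beta> by (rule S_root)
  define y where "y = (Y \<beta> 1 :: 'd ratfun)"
  have y: "y \<noteq> 0" "1 - y \<noteq> 0" using one_minus_Y[OF \<beta>'] by (simp_all add: y_def)
  let ?V = "cst v :: 'd ratfun" and ?e = "ecoef \<beta> \<nu>"
  let ?R = "(1 - ?V) * Y \<beta> ((- ?e - 1) div m \<beta>) * X \<nu>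
    + ?V * cst (gpar n g (- ?e * Q \<beta>)) * (1 - 1 / y) * X (dot \<beta> \<nu>)"
  have "U v \<beta> (X \<nu>) = ((1 - ?V * y) * X \<nu> - y * ((1 - ?V * y) * \<sigma> \<beta> (X \<nu>))) / (1 - y)"
    by (simp add: U_def y_def right_diff_distrib mult_ac)
  also have "(1 - ?V * y) * \<sigma> \<beta> (X \<nu>) = ?R"
    using sigma_X[OF \<beta>, of \<nu>] by (simp add: y_def)
  finally have U: "T \<beta> (X \<nu>) = ((1 - ?V * y) * X \<nu> - y * ?R) / (1 - y) - X \<nu>"
    by (simp add: T_eq)
  show ?thesis
  proof (cases "?e = 0")
    case True
    have "(- 1) div m \<beta> = (- 1 :: int)" using m_pos[of \<beta>] by (simp add: div_eq_minus1)
    moreover have "dot \<beta> \<nu> = \<nu>" using True by (simp add: dot_def)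
    ultimately have "?R = (1 - ?V) * (1 / y) * X \<nu> - ?V * (1 - 1 / y) * X \<nu>"
      using True by (simp add: gpar_dvd Y_uminus cst_minus y_def)
    then have "y * ?R = ((1 - ?V) - ?V * (y - 1)) * X \<nu>"
      using y by (simp only:) (simp add: field_simps)
    then have "T \<beta> (X \<nu>) = ((1 - ?V * y) * X \<nu> - ((1 - ?V) - ?V * (y - 1)) * X \<nu>) / (1 - y) - X \<nu>"
      unfolding U by simp
    also have "\<dots> = - X \<nu>" by (simp add: algebra_simps)
    finally show ?thesis using True \<open>dot \<beta> \<nu> = \<nu>\<close> by (simp add: tau_def cst_minus)
  next
    case False
    \<comment> \<open>With exponent 0 the coefficient of the original monomial in \<open>U v\<close>
      is (1 - v y - y (1 - v)) / (1 - y) = 1, and subtracting the identity leaves only the reflected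
      monomial.\<close>
    have "(- ?e - 1) div m \<beta> = 0" using e False by (intro div_pos_pos_trivial) auto
    then have "y * ?R = y * (1 - ?V) * X \<nu> - (1 - y) * (?V * cst (gpar n g (- ?e * Q \<beta>)) * X (dot \<beta> \<nu>))"
      using y by (simp only: Y_zero) (simp add: field_simps)
    then have "T \<beta> (X \<nu>) = ((1 - y) * (X \<nu> + ?V * cst (gpar n g (- ?e * Q \<beta>)) * X (dot \<beta> \<nu>))) / (1 - y) - X \<nu>"
      unfolding U by (simp add: algebra_simps)
    then have "T \<beta> (X \<nu>) = ?V * cst (gpar n g (- ?e * Q \<beta>)) * X (dot \<beta> \<nu>)"
      using y by simp
    then show ?thesis using False by (simp add: tau_def cst_mult)
  qed
qed

text \<open>In \<open>sigma_X\<close> the coefficient of the reflected monomial is nonzero, since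
  \<open>v\<close> and all the \<open>g\<close> are; so the formula can be solved for that monomial.
  This lets the kernel of the braid difference follow the dot action.\<close>

lemma sigma_X_dot:
  assumes \<beta>: "\<beta> \<in> S"
  shows "\<exists>a\<in>K0. \<exists>b\<in>K0. X (dot \<beta> \<nu>) = a * X \<nu> + b * \<sigma> \<beta> (X \<nu>)"
proof -
  have \<beta>': "\<beta> \<in> \<Phi>" using \<beta> by (rule S_root)
  define y where "y = (Y \<beta> 1 :: 'd ratfun)"
  define d where "d = cst v * cst (gpar n g (- ecoef \<beta> \<nu> * Q \<beta>)) * (1 - 1 / y)"
  have "1 - 1 / y \<noteq> 0" using one_minus_Y[OF \<beta>'] by (simp add: y_def field_simps)
  then have "d \<noteq> 0" using v gpar_neq_0 by (simp add: d_def)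
  have "d * X (dot \<beta> \<nu>) = (1 - cst v * y) * \<sigma> \<beta> (X \<nu>) - (1 - cst v) * Y \<beta> ((- ecoef \<beta> \<nu> - 1) div m \<beta>) * X \<nu>"
    using sigma_X[OF \<beta>, of \<nu>] by (simp add: y_def d_def)
  then have "X (dot \<beta> \<nu>) = ((1 - cst v * y) * \<sigma> \<beta> (X \<nu>) - (1 - cst v) * Y \<beta> ((- ecoef \<beta> \<nu> - 1) div m \<beta>) * X \<nu>) / d"
    using \<open>d \<noteq> 0\<close> by (metis nonzero_mult_div_cancel_left)
  moreover have "(a * z - b * x) / d = (- b / d) * x + (a / d) * z" for a b x z :: "'d ratfun"
    by (simp add: diff_divide_distrib)
  ultimately have "X (dot \<beta> \<nu>) = (- ((1 - cst v) * Y \<beta> ((- ecoef \<beta> \<nu> - 1) div m \<beta>)) / d) * X \<nu>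
      + ((1 - cst v * y) / d) * \<sigma> \<beta> (X \<nu>)"
    by metis
  moreover have "d \<in> K0"
    unfolding d_def y_def by (intro K0_diff K0_mult K0_one K0_cst K0_divide Y_K0 \<beta>')
  then have "- ((1 - cst v) * Y \<beta> ((- ecoef \<beta> \<nu> - 1) div m \<beta>)) / d \<in> K0" "(1 - cst v * y) / d \<in> K0"
    unfolding y_def minus_divide_left[symmetric] diff_0[symmetric]
    by (intro K0_diff K0_mult K0_one K0_cst K0_divide Y_K0 \<beta>' K0_zero; assumption)+
  ultimately show ?thesis by blast
qed

end

section \<open>The c-function and the positive roots in rank two\<close>

lemma c_addition:
  fixes x y t :: "'a::field"
  assumes "1 - x \<noteq> 0" "1 - y \<noteq> 0" "1 - x * y \<noteq> 0"
  shows "(1 - t * x) / (1 - x) * ((1 - t * y) / (1 - y)) - t =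
    (1 - t * (x * y)) / (1 - x * y) * ((1 - t * x) / (1 - x) + (1 - t * y) / (1 - y) - (1 + t))"
proof -
  define i j k where "i = inverse (1 - x)" and "j = inverse (1 - y)" and "k = inverse (1 - x * y)"
  have "(1 - x) * i = 1" "(1 - y) * j = 1" "(1 - x * y) * k = 1" using assms by (simp_all add: i_def j_def k_def)
  then show ?thesis
    unfolding divide_inverse i_def[symmetric] j_def[symmetric] k_def[symmetric] by algebra
qed

context metaplectic_data
begin

text \<open>The comparison between \<open>U\<close> and \<sigma> for all t at once. \<open>h\<close>
  is the gauge factor and \<open>p\<close> the common coefficient of the longest words; both are
  nonzero elements of \<open>K0\<close>, so that neither affects whether a braid difference
  vanishes.\<close>

definition key :: "nat \<Rightarrow> 'd lat \<Rightarrow> 'd lat \<Rightarrow> bool"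
  where "key M \<beta> \<gamma> \<longleftrightarrow> (\<forall>t. \<exists>h\<in>K0. \<exists>p\<in>K0. h \<noteq> 0 \<and> p \<noteq> 0 \<and>
    (\<forall>f. kl M (cst t) (U t \<beta>) (U t \<gamma>) (h * f) - kl M (cst t) (U t \<gamma>) (U t \<beta>) (h * f) =
      h * (alternating M (\<sigma> \<beta>) (\<sigma> \<gamma>) (p * f) - alternating M (\<sigma> \<gamma>) (\<sigma> \<beta>) (p * f))))"

lemma key_sym: assumes "key M \<beta> \<gamma>" shows "key M \<gamma> \<beta>"
  unfolding key_def
proof
  fix t
  obtain h p where *: "h \<in> K0" "p \<in> K0" "h \<noteq> 0" "p \<noteq> 0"
    "\<And>f. kl M (cst t) (U t \<beta>) (U t \<gamma>) (h * f) - kl M (cst t) (U t \<gamma>) (U t \<beta>) (h * f) =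
      h * (alternating M (\<sigma> \<beta>) (\<sigma> \<gamma>) (p * f) - alternating M (\<sigma> \<gamma>) (\<sigma> \<beta>) (p * f))"
    using spec[OF assms[unfolded key_def], of t] by (elim bexE conjE) (rule that; (assumption | erule spec))
  have "kl M (cst t) (U t \<gamma>) (U t \<beta>) (h * f) - kl M (cst t) (U t \<beta>) (U t \<gamma>) (h * f) =
      h * (alternating M (\<sigma> \<gamma>) (\<sigma> \<beta>) (p * f) - alternating M (\<sigma> \<beta>) (\<sigma> \<gamma>) (p * f))" for f
    using arg_cong[OF *(5)[of f], of uminus] by (simp only: minus_diff_eq mult_minus_right[symmetric])
  with *(1-4) show "\<exists>h\<in>K0. \<exists>p\<in>K0. h \<noteq> 0 \<and> p \<noteq> 0 \<and>
    (\<forall>f. kl M (cst t) (U t \<gamma>) (U t \<beta>) (h * f) - kl M (cst t) (U t \<beta>) (U t \<gamma>) (h * f) =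
      h * (alternating M (\<sigma> \<gamma>) (\<sigma> \<beta>) (p * f) - alternating M (\<sigma> \<beta>) (\<sigma> \<gamma>) (p * f)))"
    by (intro bexI[of _ h] bexI[of _ p]) simp_all
qed

definition cfun :: "complex \<Rightarrow> 'd lat \<Rightarrow> 'd ratfun"
  where "cfun t \<mu> = (1 - cst t * X \<mu>) / (1 - X \<mu>)"

lemma cfun_K0: "\<mu> \<in> L \<Longrightarrow> cfun t \<mu> \<in> K0"
  unfolding cfun_def by (intro K0_diff K0_mult K0_one K0_cst K0_divide K0_X)

lemma cfun_neq_0: "\<mu> \<noteq> 0 \<Longrightarrow> cfun t \<mu> \<noteq> 0"
  using one_minus_cst_X[of \<mu> t] one_minus_X[of \<mu>] by (simp add: cfun_def del: right_minus_eq)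

lemma perm_cfun: "\<beta> \<in> \<Phi> \<Longrightarrow> perm (s \<beta>) (cfun t \<mu>) = cfun t (s \<beta> \<mu>)"
  by (simp add: cfun_def perm_diff perm_divide perm_mult perm_one perm_cst perm_X)

lemma cfun_uminus: "\<mu> \<noteq> 0 \<Longrightarrow> cfun t (- \<mu>) = 1 + cst t - cfun t \<mu>"
  using c_reflect[of "X \<mu>" "cst t"] one_minus_X[of \<mu>] by (simp add: cfun_def X_uminus inverse_eq_divide)

lemma cfun_add:
  assumes "\<mu> \<noteq> 0" "\<nu> \<noteq> 0" "\<mu> + \<nu> \<noteq> 0"
  shows "cfun t \<mu> * cfun t \<nu> - cst t = cfun t (\<mu> + \<nu>) * (cfun t \<mu> + cfun t \<nu> - (1 + cst t))"
  using c_addition[of "X \<mu>" "X \<nu>" "cst t"] assms[THEN one_minus_X] by (simp add: cfun_def X_add)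

text \<open>\<open>\<mu> 1, \<dots>, \<mu> M\<close> are the positive roots of the rescaled rank two system, in cyclic order.\<close>

definition root_sequence :: "nat \<Rightarrow> 'd lat \<Rightarrow> 'd lat \<Rightarrow> (nat \<Rightarrow> 'd lat) \<Rightarrow> bool"
  where "root_sequence M \<beta> \<gamma> \<mu> \<longleftrightarrow> M > 1 \<and> \<mu> 1 = frag_cmul (m \<beta>) \<beta> \<and> \<mu> M = frag_cmul (m \<gamma>) \<gamma> \<and>
    (\<forall>k\<in>{1..M}. \<mu> k \<in> L \<and> \<mu> k \<noteq> 0) \<and>
    (\<forall>k\<in>{2..M}. s \<beta> (\<mu> k) = \<mu> (M + 2 - k)) \<and>
    (\<forall>k\<in>{1..<M}. s \<gamma> (\<mu> k) = \<mu> (M - k))"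

lemma root_sequence_dihedral:
  assumes \<beta>: "\<beta> \<in> S" "\<gamma> \<in> S" and \<mu>: "root_sequence M \<beta> \<gamma> \<mu>"
  shows "dihedral_action (\<sigma> \<beta>) (\<sigma> \<gamma>) (cst t) (1 + cst t) M (\<lambda>k. cfun t (\<mu> k))"
proof (rule dihedral_action.intro)
  have M: "M > 1" and \<mu>1: "\<mu> 1 = frag_cmul (m \<beta>) \<beta>" "\<mu> M = frag_cmul (m \<gamma>) \<gamma>"
    and L: "\<And>k. 1 \<le> k \<Longrightarrow> k \<le> M \<Longrightarrow> \<mu> k \<in> L" "\<And>k. 1 \<le> k \<Longrightarrow> k \<le> M \<Longrightarrow> \<mu> k \<noteq> 0"
    and s1: "\<And>k. 2 \<le> k \<Longrightarrow> k \<le> M \<Longrightarrow> s \<beta> (\<mu> k) = \<mu> (M + 2 - k)"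
    and s2: "\<And>k. 1 \<le> k \<Longrightarrow> k < M \<Longrightarrow> s \<gamma> (\<mu> k) = \<mu> (M - k)"
    using \<mu> by (auto simp: root_sequence_def)
  note R = \<beta>[THEN S_root]
  note semi = sigma_semilinear[OF \<beta>(1) cfun_K0[OF L(1)]] sigma_semilinear[OF \<beta>(2) cfun_K0[OF L(1)]]
  show "additive (\<sigma> \<beta>)" "additive (\<sigma> \<gamma>)" "M > 0"
    using metaplectic_props(1) \<beta> M by auto
  show "\<sigma> \<beta> (\<sigma> \<beta> x) = x" "\<sigma> \<gamma> (\<sigma> \<gamma> x) = x" for x by (simp_all add: sigma_sigma \<beta>)
  show "\<sigma> \<beta> (cst t * x) = cst t * \<sigma> \<beta> x" "\<sigma> \<gamma> (cst t * x) = cst t * \<sigma> \<gamma> x" for x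
    by (simp_all add: sigma_cst \<beta>)
  show "\<sigma> \<beta> ((1 + cst t) * x) = (1 + cst t) * \<sigma> \<beta> x" "\<sigma> \<gamma> ((1 + cst t) * x) = (1 + cst t) * \<sigma> \<gamma> x" for x
    using sigma_cst[OF \<beta>(1), of "1 + t"] sigma_cst[OF \<beta>(2), of "1 + t"] by (simp_all add: cst_add)
  have "s \<beta> (\<mu> 1) = - \<mu> 1" "s \<gamma> (\<mu> M) = - \<mu> M"
    unfolding \<mu>1 by (simp_all add: refl_cmul R refl_self frag_cmul_uminus)
  then show "\<sigma> \<beta> (cfun t (\<mu> 1) * x) = (1 + cst t - cfun t (\<mu> 1)) * \<sigma> \<beta> x"
    "\<sigma> \<gamma> (cfun t (\<mu> M) * x) = (1 + cst t - cfun t (\<mu> M)) * \<sigma> \<gamma> x" for x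
    using M by (simp_all add: semi perm_cfun R cfun_uminus L del: One_nat_def)
  show "\<sigma> \<beta> (cfun t (\<mu> k) * x) = cfun t (\<mu> (M + 2 - k)) * \<sigma> \<beta> x" if "1 < k" "k \<le> M" for x k
    using that by (simp add: semi perm_cfun R s1)
  show "\<sigma> \<gamma> (cfun t (\<mu> k) * x) = cfun t (\<mu> (M - k)) * \<sigma> \<gamma> x" if "1 \<le> k" "k < M" for x k
    using that by (simp add: semi perm_cfun R s2)
qed

lemma perm_prod: "\<beta> \<in> \<Phi> \<Longrightarrow> perm (s \<beta>) (prod f A) = (\<Prod>a\<in>A. perm (s \<beta>) (f a))"
  by (induction A rule: infinite_finite_induct) (auto simp: perm_mult perm_one)

lemma K0_prod: "(\<And>a. a \<in> A \<Longrightarrow> f a \<in> K0) \<Longrightarrow> prod f A \<in> K0"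
  by (induction A rule: infinite_finite_induct) (auto simp: K0_mult K0_one)

text \<open>Each of the two reflections negates its own simple root and permutes the other positive
  roots, so the product \<open>h\<close> of all factors 1 - t x^\<mu> satisfies the gauge condition
  for both. What depends on the type is left in the premise \<open>kl\<close>.\<close>

lemma root_sequence_key:
  assumes \<beta>: "\<beta> \<in> S" "\<gamma> \<in> S" and \<mu>: "root_sequence M \<beta> \<gamma> \<mu>"
    and p: "\<And>t. p t \<in> K0" "\<And>t. p t \<noteq> 0"
    and kl: "\<And>t f. kl M (cst t) (dihedral_action.V (\<sigma> \<beta>) (\<lambda>k. cfun t (\<mu> k)))
       (dihedral_action.W (\<sigma> \<gamma>) M (\<lambda>k. cfun t (\<mu> k))) f -
      kl M (cst t) (dihedral_action.W (\<sigma> \<gamma>) M (\<lambda>k. cfun t (\<mu> k))) (dihedral_action.V (\<sigma> \<beta>) (\<lambda>k. cfun t (\<mu> k))) f =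
      alternating M (\<sigma> \<beta>) (\<sigma> \<gamma>) (p t * f) - alternating M (\<sigma> \<gamma>) (\<sigma> \<beta>) (p t * f)"
  shows "key M \<beta> \<gamma>"
  unfolding key_def
proof
  fix t
  interpret dihedral_action "\<sigma> \<beta>" "\<sigma> \<gamma>" "cst t" "1 + cst t" M "\<lambda>k. cfun t (\<mu> k)"
    using root_sequence_dihedral[OF \<beta> \<mu>] .
  have M: "M > 1" and \<mu>1: "\<mu> 1 = frag_cmul (m \<beta>) \<beta>" "\<mu> M = frag_cmul (m \<gamma>) \<gamma>"
    and L: "\<And>k. 1 \<le> k \<Longrightarrow> k \<le> M \<Longrightarrow> \<mu> k \<in> L" "\<And>k. 1 \<le> k \<Longrightarrow> k \<le> M \<Longrightarrow> \<mu> k \<noteq> 0"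
    and s1: "\<And>k. 2 \<le> k \<Longrightarrow> k \<le> M \<Longrightarrow> s \<beta> (\<mu> k) = \<mu> (M + 2 - k)"
    and s2: "\<And>k. 1 \<le> k \<Longrightarrow> k < M \<Longrightarrow> s \<gamma> (\<mu> k) = \<mu> (M - k)"
    using \<mu> by (auto simp: root_sequence_def)
  note R = \<beta>[THEN S_root]
  define d where "d k = 1 - cst t * X (\<mu> k)" for k
  define h where "h = (\<Prod>k\<in>{1..M}. d k)"
  have d: "d k \<in> K0" "d k \<noteq> 0" if "1 \<le> k" "k \<le> M" for k
    using that unfolding d_def by (intro K0_diff K0_mult K0_one K0_cst K0_X L one_minus_cst_X; simp)+
  have h: "h \<in> K0" "h \<noteq> 0" using d by (auto simp: h_def intro!: K0_prod)
  have pd: "perm (s \<delta>) (d k) = 1 - cst t * X (s \<delta> (\<mu> k))" if "\<delta> \<in> \<Phi>" for \<delta> k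
    using that by (simp add: d_def perm_diff perm_mult perm_one perm_cst perm_X)
  have Y1: "Y \<beta> 1 = X (\<mu> 1)" "Y \<gamma> 1 = X (\<mu> M)" by (simp_all add: Y_def \<mu>1 flip: One_nat_def)
  have "h = d 1 * (\<Prod>k\<in>{2..M}. d k)"
    unfolding h_def using M by (subst prod.atLeast_Suc_atMost) (auto simp: numeral_2_eq_2)
  moreover have "perm (s \<beta>) (\<Prod>k\<in>{2..M}. d k) = (\<Prod>k\<in>{2..M}. d k)"
    unfolding perm_prod[OF R(1)]
    by (rule prod.reindex_bij_witness[where i = "\<lambda>k. M + 2 - k" and j = "\<lambda>k. M + 2 - k"])
       (auto simp: pd R s1, simp_all add: d_def)
  moreover have "perm (s \<beta>) (d 1) = 1 - cst t / Y \<beta> 1"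
    unfolding pd[OF R(1)] Y1 unfolding \<mu>1 by (simp add: refl_cmul R refl_self frag_cmul_uminus X_uminus divide_inverse flip: minus_frag_cmul)
  ultimately have g1: "perm (s \<beta>) h * (1 - cst t * Y \<beta> 1) = h * (1 - cst t / Y \<beta> 1)"
    using R by (simp add: perm_mult Y1) (simp add: d_def)
  have "h = (\<Prod>k\<in>{1..<M}. d k) * d M"
    unfolding h_def using M by (metis atLeastLessThanSuc_atLeastAtMost less_imp_le prod.atLeastLessThan_Suc)
  moreover have "perm (s \<gamma>) (\<Prod>k\<in>{1..<M}. d k) = (\<Prod>k\<in>{1..<M}. d k)"
    unfolding perm_prod[OF R(2)]
    by (rule prod.reindex_bij_witness[where i = "\<lambda>k. M - k" and j = "\<lambda>k. M - k"])
       (auto simp: pd R s2, simp_all add: d_def)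
  moreover have "perm (s \<gamma>) (d M) = 1 - cst t / Y \<gamma> 1"
    unfolding pd[OF R(2)] Y1 unfolding \<mu>1 by (simp add: refl_cmul R refl_self frag_cmul_uminus X_uminus divide_inverse flip: minus_frag_cmul)
  ultimately have g2: "perm (s \<gamma>) h * (1 - cst t * Y \<gamma> 1) = h * (1 - cst t / Y \<gamma> 1)"
    using R by (simp add: perm_mult Y1) (simp add: d_def)
  have gauge: "U t \<beta> (h * x) = h * V x" "U t \<gamma> (h * x) = h * W x" for x
    unfolding V_def W_def
    by (rule U_gauge[OF \<beta>(1) h(1) g1], simp only: cfun_def Y1, rule U_gauge[OF \<beta>(2) h(1) g2], simp only: cfun_def Y1)
  have "kl M (cst t) (U t \<beta>) (U t \<gamma>) (h * f) - kl M (cst t) (U t \<gamma>) (U t \<beta>) (h * f) =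
      h * (alternating M (\<sigma> \<beta>) (\<sigma> \<gamma>) (p t * f) - alternating M (\<sigma> \<gamma>) (\<sigma> \<beta>) (p t * f))" for f
    unfolding kl[symmetric] kl_gauge[of "U t \<beta>" h V "U t \<gamma>" W, OF gauge] kl_gauge[of "U t \<gamma>" h W "U t \<beta>" V, OF gauge(2,1)]
    by (simp add: right_diff_distrib)
  then show "\<exists>h\<in>K0. \<exists>p\<in>K0. h \<noteq> 0 \<and> p \<noteq> 0 \<and>
    (\<forall>f. kl M (cst t) (U t \<beta>) (U t \<gamma>) (h * f) - kl M (cst t) (U t \<gamma>) (U t \<beta>) (h * f) =
      h * (alternating M (\<sigma> \<beta>) (\<sigma> \<gamma>) (p * f) - alternating M (\<sigma> \<gamma>) (\<sigma> \<beta>) (p * f)))"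
    using h p[of t] by (intro bexI[of _ h] bexI[of _ "p t"]) simp_all
qed

context
  fixes \<beta> \<gamma> :: "'d lat" and p q :: int
  assumes \<beta>: "\<beta> \<in> S" and \<gamma>: "\<gamma> \<in> S"
    and indep: "\<And>x y. frag_cmul x \<beta> + frag_cmul y \<gamma> = 0 \<Longrightarrow> x = 0 \<and> y = 0"
    and cartan: "s \<beta> (frag_cmul (m \<gamma>) \<gamma>) = frag_cmul (m \<gamma>) \<gamma> + frag_cmul (p * m \<beta>) \<beta>"
      "s \<gamma> (frag_cmul (m \<beta>) \<beta>) = frag_cmul (m \<beta>) \<beta> + frag_cmul (q * m \<gamma>) \<gamma>"
begin

definition lin :: "int \<Rightarrow> int \<Rightarrow> 'd lat"
  where "lin x y = frag_cmul (x * m \<beta>) \<beta> + frag_cmul (y * m \<gamma>) \<gamma>"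

lemma lin_add: "lin x y + lin x' y' = lin (x + x') (y + y')"
  by (simp add: lin_def distrib_right frag_cmul_distrib add_ac)

lemma lin_neq_0: "x \<noteq> 0 \<or> y \<noteq> 0 \<Longrightarrow> lin x y \<noteq> 0"
  using indep[of "x * m \<beta>" "y * m \<gamma>"] m_pos[of \<beta>] m_pos[of \<gamma>] by (auto simp: lin_def)

lemma lin_L: "lin x y \<in> L"
  using L_cmul[OF m_root_in_L[OF S_root[OF \<beta>]], of x] L_cmul[OF m_root_in_L[OF S_root[OF \<gamma>]], of y]
  by (simp add: lin_def L_add)

lemma refl_lin: "s \<beta> (lin x y) = lin (p * y - x) y" "s \<gamma> (lin x y) = lin x (q * x - y)"
proof -
  have 1: "frag_cmul (x * m \<delta>) \<delta> = frag_cmul x (frag_cmul (m \<delta>) \<delta>)" for x \<delta>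
    by simp
  note R = \<beta>[THEN S_root] \<gamma>[THEN S_root]
  have c: "frag_cmul (m \<gamma>) (s \<beta> \<gamma>) = frag_cmul (m \<gamma>) \<gamma> + frag_cmul (p * m \<beta>) \<beta>"
    "frag_cmul (m \<beta>) (s \<gamma> \<beta>) = frag_cmul (m \<beta>) \<beta> + frag_cmul (q * m \<gamma>) \<gamma>"
    using cartan R by (simp_all add: refl_cmul)
  note add = additive.add[OF additive_refl[OF R(1)]] additive.add[OF additive_refl[OF R(2)]]
  have "s \<beta> (lin x y) = frag_cmul x (frag_cmul (m \<beta>) (- \<beta>)) + frag_cmul y (frag_cmul (m \<gamma>) \<gamma> + frag_cmul (p * m \<beta>) \<beta>)"
    unfolding lin_def 1 add refl_cmul[OF R(1)] c(1) refl_self[OF R(1)] by simp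
  also have "\<dots> = lin (p * y - x) y"
    by (intro poly_mapping_eqI) (simp add: lin_def lookup_add algebra_simps)
  finally show "s \<beta> (lin x y) = lin (p * y - x) y" .
  have "s \<gamma> (lin x y) = frag_cmul x (frag_cmul (m \<beta>) \<beta> + frag_cmul (q * m \<gamma>) \<gamma>) + frag_cmul y (frag_cmul (m \<gamma>) (- \<gamma>))"
    unfolding lin_def 1 add refl_cmul[OF R(2)] c(2) refl_self[OF R(2)] by simp
  also have "\<dots> = lin x (q * x - y)"
    by (intro poly_mapping_eqI) (simp add: lin_def lookup_add algebra_simps)
  finally show "s \<gamma> (lin x y) = lin x (q * x - y)" .
qed

lemma cfun_lin_add:
  assumes "x \<noteq> 0 \<or> y \<noteq> 0" "x' \<noteq> 0 \<or> y' \<noteq> 0" "x + x' \<noteq> 0 \<or> y + y' \<noteq> 0" "z = x + x'" "w = y + y'"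
  shows "cfun t (lin x y) * cfun t (lin x' y') - cst t =
    cfun t (lin z w) * (cfun t (lin x y) + cfun t (lin x' y') - (1 + cst t))"
  using cfun_add[of "lin x y" "lin x' y'" t] assms by (simp add: lin_neq_0 lin_add)

lemma key_2:
  assumes "p = 0" "q = 0"
  shows "key 2 \<beta> \<gamma>"
proof -
  \<comment> \<open>The entry at index 0 is a filler, so that the roots are counted from 1.\<close>
  define \<mu> where "\<mu> k = [0, lin 1 0, lin 0 1] ! k" for k
  let ?p = "\<lambda>t. cfun t (\<mu> 1) * cfun t (\<mu> 2)"
  have \<mu>: "\<mu> 1 = lin 1 0" "\<mu> 2 = lin 0 1"
    by (simp_all add: \<mu>_def)
  have *: "k = 1 \<or> k = 2" if "1 \<le> k" "k \<le> 2" for k :: nat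
    using that by linarith
  have rs: "root_sequence 2 \<beta> \<gamma> \<mu>"
    unfolding root_sequence_def
  proof (intro conjI ballI)
    show "\<mu> 1 = frag_cmul (m \<beta>) \<beta>" "\<mu> 2 = frag_cmul (m \<gamma>) \<gamma>" unfolding \<mu> by (simp_all add: lin_def)
    show "\<mu> k \<in> L" "\<mu> k \<noteq> 0" if "k \<in> {1..2}" for k
      using *[of k] that by (auto simp: \<mu>_def lin_L lin_neq_0)
    show "s \<beta> (\<mu> k) = \<mu> (2 + 2 - k)" if "k \<in> {2..2}" for k
      using *[of k] that by (auto simp: \<mu>_def refl_lin assms)
    show "s \<gamma> (\<mu> k) = \<mu> (2 - k)" if "k \<in> {1..<2}" for k
      using *[of k] that by (auto simp: \<mu>_def refl_lin assms)
  qed simp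
  show ?thesis
  proof (rule root_sequence_key[OF \<beta> \<gamma> rs, where p = ?p])
    fix t
    interpret dihedral_action "\<sigma> \<beta>" "\<sigma> \<gamma>" "cst t" "1 + cst t" 2 "\<lambda>k. cfun t (\<mu> k)"
      using root_sequence_dihedral[OF \<beta> \<gamma> rs] .
    show "?p t \<in> K0" unfolding \<mu> by (intro K0_mult cfun_K0 lin_L)
    show "?p t \<noteq> 0" unfolding \<mu> by (simp add: cfun_neq_0 lin_neq_0)
    show "kl 2 (cst t) V W f - kl 2 (cst t) W V f =
      alternating 2 (\<sigma> \<beta>) (\<sigma> \<gamma>) (?p t * f) - alternating 2 (\<sigma> \<gamma>) (\<sigma> \<beta>) (?p t * f)" for f
      by (rule kl_diff_2[OF refl])
  qed
qed

lemma key_3: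
  assumes "p = 1" "q = 1"
  shows "key 3 \<beta> \<gamma>"
proof -
  define \<mu> where "\<mu> k = [0, lin 1 0, lin 1 1, lin 0 1] ! k" for k
  let ?p = "\<lambda>t. cfun t (\<mu> 1) * cfun t (\<mu> 2) * cfun t (\<mu> 3)"
  have \<mu>: "\<mu> 1 = lin 1 0" "\<mu> 2 = lin 1 1" "\<mu> 3 = lin 0 1"
    by (simp_all add: \<mu>_def)
  have *: "k = 1 \<or> k = 2 \<or> k = 3" if "1 \<le> k" "k \<le> 3" for k :: nat
    using that by linarith
  have rs: "root_sequence 3 \<beta> \<gamma> \<mu>"
    unfolding root_sequence_def
  proof (intro conjI ballI)
    show "\<mu> 1 = frag_cmul (m \<beta>) \<beta>" "\<mu> 3 = frag_cmul (m \<gamma>) \<gamma>" unfolding \<mu> by (simp_all add: lin_def)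
    show "\<mu> k \<in> L" "\<mu> k \<noteq> 0" if "k \<in> {1..3}" for k
      using *[of k] that by (auto simp: \<mu>_def lin_L lin_neq_0)
    show "s \<beta> (\<mu> k) = \<mu> (3 + 2 - k)" if "k \<in> {2..3}" for k
      using *[of k] that by (auto simp: \<mu>_def refl_lin assms)
    show "s \<gamma> (\<mu> k) = \<mu> (3 - k)" if "k \<in> {1..<3}" for k
      using *[of k] that by (auto simp: \<mu>_def refl_lin assms)
  qed simp
  show ?thesis
  proof (rule root_sequence_key[OF \<beta> \<gamma> rs, where p = ?p])
    fix t
    interpret dihedral_action "\<sigma> \<beta>" "\<sigma> \<gamma>" "cst t" "1 + cst t" 3 "\<lambda>k. cfun t (\<mu> k)"
      using root_sequence_dihedral[OF \<beta> \<gamma> rs] .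
    show "?p t \<in> K0" unfolding \<mu> by (intro K0_mult cfun_K0 lin_L)
    show "?p t \<noteq> 0" unfolding \<mu> by (simp add: cfun_neq_0 lin_neq_0)
    show "kl 3 (cst t) V W f - kl 3 (cst t) W V f =
      alternating 3 (\<sigma> \<beta>) (\<sigma> \<gamma>) (?p t * f) - alternating 3 (\<sigma> \<gamma>) (\<sigma> \<beta>) (?p t * f)" for f
      by (rule kl_diff_3[OF refl], (unfold \<mu>, (rule cfun_lin_add; simp)+))
  qed
qed

text \<open>The scaled \<beta> is the short root here, as in \<open>key_6\<close>; the other
  orientation is obtained by exchanging the roots with \<open>key_sym\<close>.\<close>

lemma key_4:
  assumes "p = 2" "q = 1"
  shows "key 4 \<beta> \<gamma>"
proof -
  define \<mu> where "\<mu> k = [0, lin 1 0, lin 2 1, lin 1 1, lin 0 1] ! k" for k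
  let ?p = "\<lambda>t. cfun t (\<mu> 1) * cfun t (\<mu> 2) * cfun t (\<mu> 3) * cfun t (\<mu> 4)"
  have \<mu>: "\<mu> 1 = lin 1 0" "\<mu> 2 = lin 2 1" "\<mu> 3 = lin 1 1" "\<mu> 4 = lin 0 1"
    by (simp_all add: \<mu>_def)
  have *: "k = 1 \<or> k = 2 \<or> k = 3 \<or> k = 4" if "1 \<le> k" "k \<le> 4" for k :: nat
    using that by linarith
  have rs: "root_sequence 4 \<beta> \<gamma> \<mu>"
    unfolding root_sequence_def
  proof (intro conjI ballI)
    show "\<mu> 1 = frag_cmul (m \<beta>) \<beta>" "\<mu> 4 = frag_cmul (m \<gamma>) \<gamma>" unfolding \<mu> by (simp_all add: lin_def)
    show "\<mu> k \<in> L" "\<mu> k \<noteq> 0" if "k \<in> {1..4}" for k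
      using *[of k] that by (auto simp: \<mu>_def lin_L lin_neq_0)
    show "s \<beta> (\<mu> k) = \<mu> (4 + 2 - k)" if "k \<in> {2..4}" for k
      using *[of k] that by (auto simp: \<mu>_def refl_lin assms)
    show "s \<gamma> (\<mu> k) = \<mu> (4 - k)" if "k \<in> {1..<4}" for k
      using *[of k] that by (auto simp: \<mu>_def refl_lin assms)
  qed simp
  show ?thesis
  proof (rule root_sequence_key[OF \<beta> \<gamma> rs, where p = ?p])
    fix t
    interpret dihedral_action "\<sigma> \<beta>" "\<sigma> \<gamma>" "cst t" "1 + cst t" 4 "\<lambda>k. cfun t (\<mu> k)"
      using root_sequence_dihedral[OF \<beta> \<gamma> rs] .
    show "?p t \<in> K0" unfolding \<mu> by (intro K0_mult cfun_K0 lin_L)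
    show "?p t \<noteq> 0" unfolding \<mu> by (simp add: cfun_neq_0 lin_neq_0)
    show "kl 4 (cst t) V W f - kl 4 (cst t) W V f =
      alternating 4 (\<sigma> \<beta>) (\<sigma> \<gamma>) (?p t * f) - alternating 4 (\<sigma> \<gamma>) (\<sigma> \<beta>) (?p t * f)" for f
      by (rule kl_diff_4[OF refl], (unfold \<mu>, (rule cfun_lin_add; simp)+))
  qed
qed

lemma key_6:
  assumes "p = 3" "q = 1"
  shows "key 6 \<beta> \<gamma>"
proof -
  define \<mu> where "\<mu> k = [0, lin 1 0, lin 3 1, lin 2 1, lin 3 2, lin 1 1, lin 0 1] ! k" for k
  let ?p = "\<lambda>t. cfun t (\<mu> 1) * cfun t (\<mu> 2) * cfun t (\<mu> 3) * cfun t (\<mu> 4) * cfun t (\<mu> 5) * cfun t (\<mu> 6)"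
  have \<mu>: "\<mu> 1 = lin 1 0" "\<mu> 2 = lin 3 1" "\<mu> 3 = lin 2 1" "\<mu> 4 = lin 3 2" "\<mu> 5 = lin 1 1" "\<mu> 6 = lin 0 1"
    by (simp_all add: \<mu>_def)
  have *: "k = 1 \<or> k = 2 \<or> k = 3 \<or> k = 4 \<or> k = 5 \<or> k = 6" if "1 \<le> k" "k \<le> 6" for k :: nat
    using that by linarith
  have rs: "root_sequence 6 \<beta> \<gamma> \<mu>"
    unfolding root_sequence_def
  proof (intro conjI ballI)
    show "\<mu> 1 = frag_cmul (m \<beta>) \<beta>" "\<mu> 6 = frag_cmul (m \<gamma>) \<gamma>" unfolding \<mu> by (simp_all add: lin_def)
    show "\<mu> k \<in> L" "\<mu> k \<noteq> 0" if "k \<in> {1..6}" for k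
      using *[of k] that by (auto simp: \<mu>_def lin_L lin_neq_0)
    show "s \<beta> (\<mu> k) = \<mu> (6 + 2 - k)" if "k \<in> {2..6}" for k
      using *[of k] that by (auto simp: \<mu>_def refl_lin assms)
    show "s \<gamma> (\<mu> k) = \<mu> (6 - k)" if "k \<in> {1..<6}" for k
      using *[of k] that by (auto simp: \<mu>_def refl_lin assms)
  qed simp
  show ?thesis
  proof (rule root_sequence_key[OF \<beta> \<gamma> rs, where p = ?p])
    fix t
    interpret dihedral_action "\<sigma> \<beta>" "\<sigma> \<gamma>" "cst t" "1 + cst t" 6 "\<lambda>k. cfun t (\<mu> k)"
      using root_sequence_dihedral[OF \<beta> \<gamma> rs] .
    show "?p t \<in> K0" unfolding \<mu> by (intro K0_mult cfun_K0 lin_L)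
    show "?p t \<noteq> 0" unfolding \<mu> by (simp add: cfun_neq_0 lin_neq_0)
    show "kl 6 (cst t) V W f - kl 6 (cst t) W V f =
      alternating 6 (\<sigma> \<beta>) (\<sigma> \<gamma>) (?p t * f) - alternating 6 (\<sigma> \<gamma>) (\<sigma> \<beta>) (?p t * f)" for f
      by (rule kl_diff_6[OF refl], (unfold \<mu>, (rule cfun_lin_add; simp)+))
  qed
qed

end

end

text \<open>Appended on the right, \<open>F\<close> cancels against the last letter of one word and
  lengthens the other. The same two results arise by putting one letter in front of the words at
  \<open>x\<close>, where they agree.\<close>

lemma alternating_involution:
  assumes "\<And>x. F (F x) = x" "\<And>x. G (G x) = x" and "alternating k F G x = alternating k G F x"
  shows "alternating k F G (F x) = alternating k G F (F x)"
proof (cases k)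
  case (Suc j)
  show ?thesis
  proof (cases "even k")
    case True
    have "alternating k F G (F x) = alternating (Suc k) F G x"
      using True by (simp only: alternating_snoc if_True)
    also have "\<dots> = F (alternating k F G x)" by (simp add: assms(3))
    also have "\<dots> = alternating j G F x" by (simp add: Suc assms(1))
    also have "\<dots> = alternating k G F (F x)"
      using True by (simp only: Suc alternating_snoc) (simp add: assms(1))
    finally show ?thesis .
  next
    case False
    have "alternating k F G (F x) = alternating j F G x"
      using False by (simp only: Suc alternating_snoc) (simp add: assms(1))
    also have "\<dots> = G (alternating k G F x)" by (simp add: Suc assms(2))
    also have "\<dots> = alternating (Suc k) G F x" by (simp add: assms(3)[symmetric])
    also have "\<dots> = alternating k G F (F x)"
      using False by (simp only: alternating_snoc if_False)
    finally show ?thesis .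
  qed
qed simp

context metaplectic_data
begin

subsection \<open>The kernel of the braid difference\<close>

definition delta :: "nat \<Rightarrow> 'd lat \<Rightarrow> 'd lat \<Rightarrow> 'd ratfun \<Rightarrow> 'd ratfun"
  where "delta M \<beta> \<gamma> f = alternating M (\<sigma> \<beta>) (\<sigma> \<gamma>) f - alternating M (\<sigma> \<gamma>) (\<sigma> \<beta>) f"

lemma alternating_refl:
  assumes "\<beta> \<in> \<Phi>" "\<gamma> \<in> \<Phi>"
  shows "laurent_subst (\<lambda>_. 1) (alternating k (s \<beta>) (s \<gamma>))"
    "alternating k (perm (s \<beta>)) (perm (s \<gamma>)) f = perm (alternating k (s \<beta>) (s \<gamma>)) f"
  using assms
proof (induction k arbitrary: \<beta> \<gamma>)
  case 0
  {
    case 1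
    show ?case by unfold_locales (auto simp: additive_def)
  next
    case 2
    have "laurent_subst (\<lambda>_. 1) (id :: 'd lat \<Rightarrow> 'd lat)"
      by unfold_locales (auto simp: additive_def)
    then have "perm id f = f"
      by (cases f) (simp only: perm_def laurent_subst.Fract subst_id_1 not_False_eq_True)
    then show ?case
      unfolding alternating.simps(1) by (subst id_apply) (rule sym)
  }
next
  case (Suc k)
  {
    case 1
    have "inj (alternating k (s \<gamma>) (s \<beta>))" "additive (alternating k (s \<gamma>) (s \<beta>))"
      using Suc(1)[of \<gamma> \<beta>] 1 by (auto simp: laurent_subst_def)
    then show ?case
      using inj_compose[OF inj_refl[OF 1(1)]] additive_refl[OF 1(1)]
      by (intro laurent_subst.intro) (auto simp: additive_def o_def)
  next
    case 2
    then show ?case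
      using Suc(2)[of \<gamma> \<beta>] subst_ratfun_comp[OF laurent_subst_perm[OF 2(1)] Suc(1)[of \<gamma> \<beta>], of f]
      by (simp add: perm_def o_def)
  }
qed

lemma alternating_semilinear:
  assumes "\<beta> \<in> S" "\<gamma> \<in> S" "h \<in> K0"
  shows "alternating k (\<sigma> \<beta>) (\<sigma> \<gamma>) (h * f) = perm (alternating k (s \<beta>) (s \<gamma>)) h * alternating k (\<sigma> \<beta>) (\<sigma> \<gamma>) f"
proof -
  have "alternating k (perm (s \<beta>)) (perm (s \<gamma>)) h \<in> K0 \<and>
    alternating k (\<sigma> \<beta>) (\<sigma> \<gamma>) (h * f) = alternating k (perm (s \<beta>)) (perm (s \<gamma>)) h * alternating k (\<sigma> \<beta>) (\<sigma> \<gamma>) f"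
    using assms by (induction k arbitrary: \<beta> \<gamma>) (simp_all add: K0_perm sigma_semilinear)
  then show ?thesis by (simp add: alternating_refl S_root assms)
qed

context
  fixes M :: nat and \<beta> \<gamma> :: "'d lat"
  assumes \<beta>: "\<beta> \<in> S" and \<gamma>: "\<gamma> \<in> S" and M: "M > 0"
    and braid: "\<And>\<nu>. alternating M (s \<beta>) (s \<gamma>) \<nu> = alternating M (s \<gamma>) (s \<beta>) \<nu>"
    and key: "key M \<beta> \<gamma>"
begin

text \<open>By the braid relation of the reflections on the lattice, both words twist
  \<open>K0\<close> by the same automorphism, so their difference is again semilinear.\<close>

lemma delta_semilinear:
  assumes "h \<in> K0"
  shows "delta M \<beta> \<gamma> (h * f) = perm (alternating M (s \<beta>) (s \<gamma>)) h * delta M \<beta> \<gamma> f"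
proof -
  have "alternating M (s \<gamma>) (s \<beta>) = alternating M (s \<beta>) (s \<gamma>)"
    using braid by (intro ext) simp
  then show ?thesis
    by (simp add: delta_def alternating_semilinear \<beta> \<gamma> assms right_diff_distrib)
qed

lemma delta_K0: "h \<in> K0 \<Longrightarrow> h \<noteq> 0 \<Longrightarrow> delta M \<beta> \<gamma> (h * f) = 0 \<longleftrightarrow> delta M \<beta> \<gamma> f = 0"
  using laurent_subst.eq_0_iff[OF alternating_refl(1)[OF S_root[OF \<beta>] S_root[OF \<gamma>]], of M h]
  by (simp add: delta_semilinear perm_def)

lemma delta_add: "delta M \<beta> \<gamma> (f + f') = delta M \<beta> \<gamma> f + delta M \<beta> \<gamma> f'"
  using additive.add[OF alternating_additive[OF metaplectic_props(1)[OF \<beta>] metaplectic_props(1)[OF \<gamma>]]]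
    additive.add[OF alternating_additive[OF metaplectic_props(1)[OF \<gamma>] metaplectic_props(1)[OF \<beta>]]]
  by (simp add: delta_def)

lemma delta_mult_0: "h \<in> K0 \<Longrightarrow> delta M \<beta> \<gamma> f = 0 \<Longrightarrow> delta M \<beta> \<gamma> (h * f) = 0"
  by (simp add: delta_semilinear)

lemma delta_sigma:
  assumes "delta M \<beta> \<gamma> f = 0"
  shows "delta M \<beta> \<gamma> (\<sigma> \<beta> f) = 0" "delta M \<beta> \<gamma> (\<sigma> \<gamma> f) = 0"
  using assms alternating_involution[of "\<sigma> \<beta>" "\<sigma> \<gamma>" M f] alternating_involution[of "\<sigma> \<gamma>" "\<sigma> \<beta>" M f]
  by (simp_all add: delta_def sigma_sigma \<beta> \<gamma>)

lemma delta_X_dot: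
  assumes "delta M \<beta> \<gamma> (X \<nu>) = 0" "\<delta> \<in> {\<beta>, \<gamma>}"
  shows "delta M \<beta> \<gamma> (X (dot \<delta> \<nu>)) = 0"
proof -
  have "\<delta> \<in> S" using assms(2) \<beta> \<gamma> by auto
  then obtain a b where "a \<in> K0" "b \<in> K0" "X (dot \<delta> \<nu>) = a * X \<nu> + b * \<sigma> \<delta> (X \<nu>)"
    using sigma_X_dot by blast
  moreover have "delta M \<beta> \<gamma> (\<sigma> \<delta> (X \<nu>)) = 0"
    using assms delta_sigma by auto
  ultimately show ?thesis by (simp add: delta_add delta_mult_0 assms)
qed

lemma delta_X_translate:
  assumes "delta M \<beta> \<gamma> (X (\<nu> + \<mu>)) = 0" "\<mu> \<in> L"
  shows "delta M \<beta> \<gamma> (X \<nu>) = 0"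
  using delta_K0[OF K0_X[OF assms(2)] X_neq_0, of "X \<nu>"] assms(1) by (simp add: X_add mult.commute)

text \<open>One Kazhdan-Lusztig difference is read in two ways: in the Hecke generators
  \<open>T\<close>, and through \<open>key\<close> in the \<sigma>.\<close>

lemma T_diff:
  "\<exists>h\<in>K0. \<exists>p\<in>K0. h \<noteq> 0 \<and> p \<noteq> 0 \<and>
    (\<forall>f. alternating M (T \<beta>) (T \<gamma>) (h * f) - alternating M (T \<gamma>) (T \<beta>) (h * f) = h * delta M \<beta> \<gamma> (p * f))"
proof -
  have U: "U v \<beta> = (\<lambda>x. T \<beta> x + x)" "U v \<gamma> = (\<lambda>x. T \<gamma> x + x)"
    by (simp_all add: T_eq)
  have "kl M (cst v) (U v \<beta>) (U v \<gamma>) f - kl M (cst v) (U v \<gamma>) (U v \<beta>) f =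
      alternating M (T \<beta>) (T \<gamma>) f - alternating M (T \<gamma>) (T \<beta>) f" for f
    unfolding U by (rule kl_diff_hecke) (simp_all add: T_additive T_cst T_quadratic \<beta> \<gamma>)
  then show ?thesis using spec[OF key[unfolded key_def], of v] by (simp add: delta_def)
qed

lemma D_diff:
  "\<exists>h\<in>K0. \<exists>p\<in>K0. h \<noteq> 0 \<and> p \<noteq> 0 \<and>
    (\<forall>f. alternating M (U 0 \<beta>) (U 0 \<gamma>) (h * f) - alternating M (U 0 \<gamma>) (U 0 \<beta>) (h * f) = h * delta M \<beta> \<gamma> (p * f))"
proof -
  have "kl M 0 F G f = alternating M F G f" for F G :: "'d ratfun \<Rightarrow> 'd ratfun" and f
    using kl_zero[of "M - 1"] M by simp
  then show ?thesis using spec[OF key[unfolded key_def], of 0] by (simp add: delta_def)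
qed

lemma delta_X:
  assumes "alternating M (T \<beta>) (T \<gamma>) (X \<nu>) = alternating M (T \<gamma>) (T \<beta>) (X \<nu>)"
  shows "delta M \<beta> \<gamma> (X \<nu>) = 0"
proof -
  obtain h p where *: "h \<in> K0" "p \<in> K0" "h \<noteq> 0" "p \<noteq> 0" and
    eq: "\<And>f. alternating M (T \<beta>) (T \<gamma>) (h * f) - alternating M (T \<gamma>) (T \<beta>) (h * f) = h * delta M \<beta> \<gamma> (p * f)"
    using T_diff by blast
  \<comment> \<open>Dividing the argument by \<open>h\<close> makes the left side of
    \<open>eq\<close> the braid difference at the monomial; the factor \<open>p / h\<close> that
    remains lies in \<open>K0\<close> and is nonzero.\<close>
  have "h * delta M \<beta> \<gamma> (p * (X \<nu> / h)) = 0"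
    using eq[of "X \<nu> / h"] * assms by simp
  then have "delta M \<beta> \<gamma> (p / h * X \<nu>) = 0" using * by simp
  then show ?thesis using * by (subst (asm) delta_K0) (auto intro: K0_divide)
qed

lemma braid_from_X:
  assumes "\<And>\<nu>. delta M \<beta> \<gamma> (X \<nu>) = 0"
  shows "alternating M (T \<beta>) (T \<gamma>) = alternating M (T \<gamma>) (T \<beta>)"
    "alternating M (demazure coroot S Q n v g \<beta>) (demazure coroot S Q n v g \<gamma>) =
     alternating M (demazure coroot S Q n v g \<gamma>) (demazure coroot S Q n v g \<beta>)"
proof -
  have 0: "delta M \<beta> \<gamma> f = 0" for f
    by (induction f rule: ratfun_induct) (simp_all add: delta_add delta_mult_0 assms)
  have fin: "F = G" if "h \<noteq> 0" "\<And>f. F (h * f) - G (h * f) = 0" for h and F G :: "'d ratfun \<Rightarrow> 'd ratfun"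
  proof
    fix f show "F f = G f" using that(2)[of "f / h"] that(1) by simp
  qed
  show "alternating M (T \<beta>) (T \<gamma>) = alternating M (T \<gamma>) (T \<beta>)"
    using T_diff fin unfolding 0 by fastforce
  have "demazure coroot S Q n v g \<delta> = U 0 \<delta>" for \<delta>
    by (intro ext demazure_eq)
  then show "alternating M (demazure coroot S Q n v g \<beta>) (demazure coroot S Q n v g \<gamma>) =
     alternating M (demazure coroot S Q n v g \<gamma>) (demazure coroot S Q n v g \<beta>)"
    using D_diff fin unfolding 0 by fastforce
qed

end

subsection \<open>Reduction to the fundamental alcove\<close>

definition pt :: "'d lat \<Rightarrow> 'd lat \<Rightarrow> 'd lat \<Rightarrow> int \<Rightarrow> int \<Rightarrow> 'd lat"
  where "pt \<beta> \<gamma> \<nu> A z = \<nu> + frag_cmul A \<beta> + frag_cmul z \<gamma>"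

lemma pt_zero: "pt \<beta> \<gamma> \<nu> 0 0 = \<nu>"
  by (simp add: pt_def)

context
  fixes \<beta> \<gamma> :: "'d lat" and p q :: int
  assumes \<beta>: "\<beta> \<in> S" and \<gamma>: "\<gamma> \<in> S"
    and cartan: "coroot \<beta> \<gamma> = - p" "coroot \<gamma> \<beta> = - q"
begin

abbreviation "pnt \<equiv> pt \<beta> \<gamma>"

lemma coroot_pt:
  "coroot \<beta> (pnt \<nu> A z) = coroot \<beta> \<nu> + 2 * A - p * z"
  "coroot \<gamma> (pnt \<nu> A z) = coroot \<gamma> \<nu> + 2 * z - q * A"
  by (simp_all add: pt_def coroot_add coroot_cmul coroot_self cartan S_root \<beta> \<gamma>)

lemma refl_pt:
  "s \<beta> (pnt \<nu> A z) = pnt \<nu> (p * z - A - coroot \<beta> \<nu>) z"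
  "s \<gamma> (pnt \<nu> A z) = pnt \<nu> A (q * A - z - coroot \<gamma> \<nu>)"
  unfolding refl_def coroot_pt
  by (intro poly_mapping_eqI; simp add: pt_def lookup_add lookup_minus algebra_simps)+

lemma ecoef_pt:
  "ecoef \<beta> (pnt \<nu> A z) = ecoef \<beta> \<nu> + 2 * A - p * z"
  "ecoef \<gamma> (pnt \<nu> A z) = ecoef \<gamma> \<nu> + 2 * z - q * A"
  by (simp_all add: ecoef_def coroot_pt)

lemma dot_pt:
  "dot \<beta> (pnt \<nu> A z) = pnt \<nu> (p * z - A - ecoef \<beta> \<nu>) z"
  "dot \<gamma> (pnt \<nu> A z) = pnt \<nu> A (q * A - z - ecoef \<gamma> \<nu>)"
  unfolding dot_def ecoef_pt
  by (intro poly_mapping_eqI; simp add: pt_def lookup_add lookup_minus algebra_simps)+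

lemma ecoef_dot_pt:
  "ecoef \<beta> (dot \<beta> \<nu>) = - ecoef \<beta> \<nu>" "ecoef \<gamma> (dot \<beta> \<nu>) = ecoef \<gamma> \<nu> + q * ecoef \<beta> \<nu>"
  "ecoef \<gamma> (dot \<gamma> \<nu>) = - ecoef \<gamma> \<nu>" "ecoef \<beta> (dot \<gamma> \<nu>) = ecoef \<beta> \<nu> + p * ecoef \<gamma> \<nu>"
  using dot_pt[of \<nu> 0 0] ecoef_pt[of \<nu> "- ecoef \<beta> \<nu>" 0] ecoef_pt[of \<nu> 0 "- ecoef \<gamma> \<nu>"]
  by (simp_all add: pt_zero)

lemma T_pt:
  "e = ecoef \<beta> \<nu> + 2 * A - p * z \<Longrightarrow> A' = A - e \<Longrightarrow> - m \<beta> \<le> e \<Longrightarrow> e \<le> 0 \<Longrightarrow>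
    T \<beta> (cst k * X (pnt \<nu> A z)) = cst (k * tau \<beta> e) * X (pnt \<nu> A' z)"
  "e = ecoef \<gamma> \<nu> + 2 * z - q * A \<Longrightarrow> z' = z - e \<Longrightarrow> - m \<gamma> \<le> e \<Longrightarrow> e \<le> 0 \<Longrightarrow>
    T \<gamma> (cst k * X (pnt \<nu> A z)) = cst (k * tau \<gamma> e) * X (pnt \<nu> A z')"
  by (simp_all add: T_cst \<beta> \<gamma> T_X ecoef_pt dot_pt cst_mult mult.assoc)
     (simp_all add: algebra_simps)

text \<open>The descent sees weights only through their values on the two coroots, so a translation
  is recorded by its values there. The scale factor \<open>k\<close> stays separate because it
  depends on \<open>n\<close>, while \<open>r1\<close> and \<open>r2\<close> are fixed numbers in
  each type.\<close>

definition translation :: "int \<Rightarrow> int \<Rightarrow> int \<Rightarrow> bool"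
  where "translation k r1 r2 \<longleftrightarrow> (\<exists>\<mu>\<in>L. coroot \<beta> \<mu> = k * r1 \<and> coroot \<gamma> \<mu> = k * r2)"

lemma translation_simple: "translation (m \<beta>) 2 (- q)" "translation (m \<gamma>) (- p) 2"
  using m_root_in_L[OF S_root[OF \<beta>]] m_root_in_L[OF S_root[OF \<gamma>]]
  by (auto simp: translation_def coroot_cmul coroot_self cartan S_root \<beta> \<gamma> intro: bexI[rotated])

lemma translation_refl:
  assumes "translation k r1 r2"
  shows "translation k (- r1) (r2 + q * r1)" "translation k (r1 + p * r2) (- r2)"
proof -
  obtain \<mu> where \<mu>: "\<mu> \<in> L" "coroot \<beta> \<mu> = k * r1" "coroot \<gamma> \<mu> = k * r2"
    using assms by (auto simp: translation_def)
  note R = \<beta>[THEN S_root] \<gamma>[THEN S_root]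
  show "translation k (- r1) (r2 + q * r1)"
    unfolding translation_def using refl_L[OF \<beta> \<mu>(1)]
    by (intro bexI[of _ "s \<beta> \<mu>"]) (simp_all add: refl_def coroot_diff coroot_cmul coroot_self cartan R \<mu> algebra_simps)
  show "translation k (r1 + p * r2) (- r2)"
    unfolding translation_def using refl_L[OF \<gamma> \<mu>(1)]
    by (intro bexI[of _ "s \<gamma> \<mu>"]) (simp_all add: refl_def coroot_diff coroot_cmul coroot_self cartan R \<mu> algebra_simps)
qed

text \<open>
  The measure is the invariant form evaluated at \<open>20(\<nu> - \<rho>) + \<rho>\<close>: a translation into the Voronoi
  cell shortens \<open>\<nu> - \<rho>\<close>, and a simple reflection that keeps this length moves \<open>\<nu> - \<rho>\<close> away
  from \<open>\<rho>\<close>.  The elements \<open>(k, r1, r2, c, d)\<close> of \<open>R\<close> describe positive roots: \<open>(k * r1, k * r2)\<close>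
  are the coordinates of the scaled root, and \<open>(c, d)\<close> those of its coroot.
\<close>

lemma descent:
  fixes P :: "'d lat \<Rightarrow> bool" and a b :: int and R :: "(int \<times> int \<times> int \<times> int \<times> int) set"
  defines "N \<equiv> \<lambda>e f. a * e * e + a * p * e * f + b * f * f"
    and "H \<equiv> \<lambda>e f. (2 * a + a * p) * e + (2 * b + b * q) * f"
  assumes ab: "a > 0" "a * p = b * q" "(a * p) * (a * p) \<le> 4 * a * b"
    and H: "H 2 (- q) > 0" "H (- p) 2 > 0"
    and R: "\<And>k r1 r2 c d. (k, r1, r2, c, d) \<in> R \<Longrightarrow> k > 0 \<and> translation k r1 r2 \<and>
      N r1 r2 > 0 \<and> H r1 r2 < 20 * N r1 r2 \<and>
      N r1 r2 * c = 2 * a * r1 + a * p * r2 \<and> N r1 r2 * d = a * p * r1 + 2 * b * r2"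
    and dot: "\<And>\<nu>. P (dot \<beta> \<nu>) \<Longrightarrow> P \<nu>" "\<And>\<nu>. P (dot \<gamma> \<nu>) \<Longrightarrow> P \<nu>"
    and translate: "\<And>\<nu> \<mu>. \<mu> \<in> L \<Longrightarrow> P (\<nu> + \<mu>) \<Longrightarrow> P \<nu>"
    and alcove: "\<And>\<nu>. ecoef \<beta> \<nu> \<le> 0 \<Longrightarrow> ecoef \<gamma> \<nu> \<le> 0 \<Longrightarrow>
      \<forall>(k, r1, r2, c, d)\<in>R. - k \<le> c * ecoef \<beta> \<nu> + d * ecoef \<gamma> \<nu> \<Longrightarrow> P \<nu>"
  shows "P \<nu>"
proof (induction "nat (N (20 * ecoef \<beta> \<nu> + 1) (20 * ecoef \<gamma> \<nu> + 1))" arbitrary: \<nu> rule: less_induct)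
  case less
  define E F where "E = ecoef \<beta> \<nu>" and "F = ecoef \<gamma> \<nu>"
  \<comment> \<open>\<open>H\<close> is the polar form of \<open>N\<close> against (1, 1), the
    coordinates of \<rho>, and gives the linear part of this measure. A dot reflection preserves
    \<open>N E F\<close> and changes only that part.\<close>
  let ?M = "\<lambda>E F. N (20 * E + 1) (20 * F + 1)"
  have nonneg: "N e f \<ge> 0" for e f
  proof -
    have "4 * a * N e f = (2 * a * e + a * p * f)\<^sup>2 + (4 * a * b - (a * p) * (a * p)) * f\<^sup>2"
      by (simp add: N_def algebra_simps power2_eq_square)
    also have "\<dots> \<ge> 0" using ab(3) by simp
    finally show ?thesis using ab(1) by (simp add: zero_le_mult_iff)
  qed
  have IH: "P \<mu>" if "?M (ecoef \<beta> \<mu>) (ecoef \<gamma> \<mu>) < ?M E F" for \<mu>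
  proof (rule less)
    have "0 < ?M E F" using that nonneg[of "20 * ecoef \<beta> \<mu> + 1" "20 * ecoef \<gamma> \<mu> + 1"] by linarith
    then show "nat (?M (ecoef \<beta> \<mu>) (ecoef \<gamma> \<mu>)) < nat (?M (ecoef \<beta> \<nu>) (ecoef \<gamma> \<nu>))"
      using that by (simp add: E_def F_def)
  qed
  consider "E > 0" | "F > 0" | k r1 r2 c d where "(k, r1, r2, c, d) \<in> R" "c * E + d * F < - k"
    | "E \<le> 0" "F \<le> 0" "\<forall>(k, r1, r2, c, d)\<in>R. - k \<le> c * E + d * F"
    by (fastforce simp: not_less)
  then show ?case
  proof cases
    case 1
    have "?M (- E) (F + q * E) - ?M E F = - (20 * (E * H 2 (- q)))"
      unfolding N_def H_def using ab(2) by algebra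
    moreover have "E * H 2 (- q) > 0" using 1 H(1) by simp
    ultimately show ?thesis
      using dot(1)[of \<nu>] IH[of "dot \<beta> \<nu>"] by (simp add: ecoef_dot_pt flip: E_def F_def)
  next
    case 2
    have "?M (E + p * F) (- F) - ?M E F = - (20 * (F * H (- p) 2))"
      unfolding N_def H_def using ab(2) by algebra
    moreover have "F * H (- p) 2 > 0" using 2 H(2) by simp
    ultimately show ?thesis
      using dot(2)[of \<nu>] IH[of "dot \<gamma> \<nu>"] by (simp add: ecoef_dot_pt flip: E_def F_def)
  next
    case (3 k r1 r2 c d)
    note r = R[OF 3(1)]
    obtain \<mu> where \<mu>: "\<mu> \<in> L" "coroot \<beta> \<mu> = k * r1" "coroot \<gamma> \<mu> = k * r2"
      using r by (auto simp: translation_def)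
    have "?M (E + k * r1) (F + k * r2) - ?M E F = 20 * k * (20 * (N r1 r2 * k + (N r1 r2 * c * E + N r1 r2 * d * F)) + H r1 r2)"
      using r ab(2) unfolding N_def H_def by algebra
    also have "N r1 r2 * k + (N r1 r2 * c * E + N r1 r2 * d * F) = N r1 r2 * (k + (c * E + d * F))"
      by (simp add: algebra_simps)
    also have "20 * k * (20 * (N r1 r2 * (k + (c * E + d * F))) + H r1 r2) < 0"
    proof -
      \<comment> \<open>By integrality a violated bound is violated by at least 1, a gain of
        \<open>N r1 r2\<close>; the constant 20 is large enough for this to outweigh
        \<open>H r1 r2\<close> in every type.\<close>
      have "N r1 r2 * (k + (c * E + d * F)) \<le> N r1 r2 * (- 1)" using r 3(2) by (intro mult_left_mono) auto
      then have "20 * (N r1 r2 * (k + (c * E + d * F))) + H r1 r2 < 0" using r by linarith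
      then show ?thesis using r by (intro mult_pos_neg) auto
    qed
    finally have "P (\<nu> + \<mu>)"
      using IH[of "\<nu> + \<mu>"] by (simp add: ecoef_def E_def F_def coroot_add S_root \<beta> \<gamma> \<mu> algebra_simps)
    then show ?thesis by (rule translate[OF \<mu>(1)])
  next
    case 4
    then show ?thesis by (intro alcove) (simp_all add: E_def F_def)
  qed
qed

section \<open>The braid relation at monomials in the four types\<close>

lemma braid_refl:
  assumes "(p, q, M) \<in> {(0, 0, 2), (1, 1, 3), (1, 2, 4), (1, 3, 6)}"
  shows "alternating M (s \<beta>) (s \<gamma>) \<nu> = alternating M (s \<gamma>) (s \<beta>) \<nu>"
proof -
  have "alternating M (s \<beta>) (s \<gamma>) (pnt \<nu> 0 0) = alternating M (s \<gamma>) (s \<beta>) (pnt \<nu> 0 0)"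
    using assms by (auto simp: eval_nat_numeral refl_pt)
  then show ?thesis by (simp add: pt_zero)
qed

text \<open>One word meets, as values of \<open>ecoef\<close>, the values of all positive coroots in
  cyclic order, the other word in reverse order. The hypotheses bound exactly these values, so every
  step stays where \<open>T\<close> sends a monomial to a monomial.\<close>

lemma T_braid_X_2:
  fixes \<nu>
  defines "E \<equiv> ecoef \<beta> \<nu>" and "F \<equiv> ecoef \<gamma> \<nu>"
  assumes pq: "p = 0" "q = 0" and EF: "E \<le> 0" "F \<le> 0"
    and lower: "- m \<beta> \<le> E" "- m \<gamma> \<le> F"
  shows "alternating 2 (T \<beta>) (T \<gamma>) (X \<nu>) = alternating 2 (T \<gamma>) (T \<beta>) (X \<nu>)"
proof -
  have M: "(2 :: nat) = Suc (Suc 0)" by simp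
  have a1: "T \<beta> (cst k * X (pnt \<nu> 0 0)) =
      cst (k * tau \<beta> E) * X (pnt \<nu> (- E) 0)" for k
    by (rule T_pt; use EF lower in \<open>simp add: pq E_def[symmetric] F_def[symmetric]\<close>)
  have a2: "T \<gamma> (cst k * X (pnt \<nu> (- E) 0)) =
      cst (k * tau \<gamma> F) * X (pnt \<nu> (- E) (- F))" for k
    by (rule T_pt; use EF lower in \<open>simp add: pq E_def[symmetric] F_def[symmetric]\<close>)
  have b1: "T \<gamma> (cst k * X (pnt \<nu> 0 0)) =
      cst (k * tau \<gamma> F) * X (pnt \<nu> 0 (- F))" for k
    by (rule T_pt; use EF lower in \<open>simp add: pq E_def[symmetric] F_def[symmetric]\<close>)
  have b2: "T \<beta> (cst k * X (pnt \<nu> 0 (- F))) =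
      cst (k * tau \<beta> E) * X (pnt \<nu> (- E) (- F))" for k
    by (rule T_pt; use EF lower in \<open>simp add: pq E_def[symmetric] F_def[symmetric]\<close>)
  have "alternating 2 (T \<beta>) (T \<gamma>) (cst 1 * X (pnt \<nu> 0 0)) = alternating 2 (T \<gamma>) (T \<beta>) (cst 1 * X (pnt \<nu> 0 0))"
    by (simp only: M alternating.simps o_apply id_apply a1 a2 b1 b2)
      (simp add: mult_ac)
  then show ?thesis by (simp add: pt_zero)
qed

text \<open>The alcove bounds come from translations by all positive roots. These are found, here
  and in the other types, as \<beta>, s_\<beta> \<gamma>, s_\<beta> s_\<gamma> \<beta> and so on;
  each keeps the scale factor of the simple root it starts from.\<close>

lemma delta_X_2:
  assumes pq: "p = 0" "q = 0" and key: "key 2 \<beta> \<gamma>"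
  shows "delta 2 \<beta> \<gamma> (X \<nu>) = 0"
proof -
  have br: "alternating 2 (s \<beta>) (s \<gamma>) \<nu> = alternating 2 (s \<gamma>) (s \<beta>) \<nu>" for \<nu>
    by (rule braid_refl) (simp add: pq)
  note A = \<beta> \<gamma> _ br key
  note tr = translation_simple(1)
    translation_refl(1)[OF translation_simple(2)]
  show ?thesis
  proof (rule descent[where a = 1 and b = 1 and R = "{(m \<beta>, 2, 0, 1, 0),
      (m \<gamma>, 0, 2, 0, 1)}"])
    show "delta 2 \<beta> \<gamma> (X \<nu>) = 0" if "delta 2 \<beta> \<gamma> (X (dot \<beta> \<nu>)) = 0" for \<nu>
      using delta_X_dot[OF A that, of \<beta>] by (simp add: dot_dot S_root \<beta>)
    show "delta 2 \<beta> \<gamma> (X \<nu>) = 0" if "delta 2 \<beta> \<gamma> (X (dot \<gamma> \<nu>)) = 0" for \<nu>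
      using delta_X_dot[OF A that, of \<gamma>] by (simp add: dot_dot S_root \<gamma>)
    show "delta 2 \<beta> \<gamma> (X \<nu>) = 0" if "\<mu> \<in> L" "delta 2 \<beta> \<gamma> (X (\<nu> + \<mu>)) = 0" for \<nu> \<mu>
      using delta_X_translate[OF A that(2,1)] by simp
  qed (use tr m_pos[of \<beta>] m_pos[of \<gamma>] in \<open>auto simp: pq intro!: delta_X[OF A] T_braid_X_2[OF pq]\<close>)
qed

lemma T_braid_X_3:
  fixes \<nu>
  defines "E \<equiv> ecoef \<beta> \<nu>" and "F \<equiv> ecoef \<gamma> \<nu>"
  assumes pq: "p = 1" "q = 1" and EF: "E \<le> 0" "F \<le> 0"
    and lower: "- m \<beta> \<le> E" "- m \<gamma> \<le> E + F" "- m \<beta> \<le> F"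
  shows "alternating 3 (T \<beta>) (T \<gamma>) (X \<nu>) = alternating 3 (T \<gamma>) (T \<beta>) (X \<nu>)"
proof -
  \<comment> \<open>For odd length the two words meet a given coroot value with different letters,
    so the scalars of \<beta> and \<gamma> must agree. In the even types the letters match.\<close>
  have Q: "Q \<beta> = Q \<gamma>"
    using B_root[OF S_root[OF \<beta>], of \<gamma>] B_root[OF S_root[OF \<gamma>], of \<beta>] B_sym[of \<beta> \<gamma>] by (simp add: cartan pq)
  then have m: "m \<beta> = m \<gamma>" by (simp add: mexp_def)
  have tau: "tau \<beta> = tau \<gamma>" by (rule ext) (simp add: tau_def Q)
  have M: "(3 :: nat) = Suc (Suc (Suc 0))" by simp
  have a1: "T \<beta> (cst k * X (pnt \<nu> 0 0)) =
      cst (k * tau \<beta> E) * X (pnt \<nu> (- E) 0)" for k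
    by (rule T_pt; use EF lower in \<open>simp add: pq E_def[symmetric] F_def[symmetric] m\<close>)
  have a2: "T \<gamma> (cst k * X (pnt \<nu> (- E) 0)) =
      cst (k * tau \<gamma> (E + F)) * X (pnt \<nu> (- E) (- E - F))" for k
    by (rule T_pt; use EF lower in \<open>simp add: pq E_def[symmetric] F_def[symmetric] m\<close>)
  have a3: "T \<beta> (cst k * X (pnt \<nu> (- E) (- E - F))) =
      cst (k * tau \<beta> F) * X (pnt \<nu> (- E - F) (- E - F))" for k
    by (rule T_pt; use EF lower in \<open>simp add: pq E_def[symmetric] F_def[symmetric] m\<close>)
  have b1: "T \<gamma> (cst k * X (pnt \<nu> 0 0)) =
      cst (k * tau \<gamma> F) * X (pnt \<nu> 0 (- F))" for k
    by (rule T_pt; use EF lower in \<open>simp add: pq E_def[symmetric] F_def[symmetric] m\<close>)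
  have b2: "T \<beta> (cst k * X (pnt \<nu> 0 (- F))) =
      cst (k * tau \<beta> (E + F)) * X (pnt \<nu> (- E - F) (- F))" for k
    by (rule T_pt; use EF lower in \<open>simp add: pq E_def[symmetric] F_def[symmetric] m\<close>)
  have b3: "T \<gamma> (cst k * X (pnt \<nu> (- E - F) (- F))) =
      cst (k * tau \<gamma> E) * X (pnt \<nu> (- E - F) (- E - F))" for k
    by (rule T_pt; use EF lower in \<open>simp add: pq E_def[symmetric] F_def[symmetric] m\<close>)
  have "alternating 3 (T \<beta>) (T \<gamma>) (cst 1 * X (pnt \<nu> 0 0)) = alternating 3 (T \<gamma>) (T \<beta>) (cst 1 * X (pnt \<nu> 0 0))"
    by (simp only: M alternating.simps o_apply id_apply a1 a2 a3 b1 b2 b3)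
      (simp add: mult_ac tau)
  then show ?thesis by (simp add: pt_zero)
qed

lemma delta_X_3:
  assumes pq: "p = 1" "q = 1" and key: "key 3 \<beta> \<gamma>"
  shows "delta 3 \<beta> \<gamma> (X \<nu>) = 0"
proof -
  have br: "alternating 3 (s \<beta>) (s \<gamma>) \<nu> = alternating 3 (s \<gamma>) (s \<beta>) \<nu>" for \<nu>
    by (rule braid_refl) (simp add: pq)
  note A = \<beta> \<gamma> _ br key
  note tr = translation_simple(1)
    translation_refl(1)[OF translation_simple(2)]
    translation_refl(1)[OF translation_refl(2)[OF translation_simple(1)]]
  show ?thesis
  proof (rule descent[where a = 1 and b = 1 and R = "{(m \<beta>, 2, -1, 1, 0),
      (m \<gamma>, 1, 1, 1, 1),
      (m \<beta>, -1, 2, 0, 1)}"])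
    show "delta 3 \<beta> \<gamma> (X \<nu>) = 0" if "delta 3 \<beta> \<gamma> (X (dot \<beta> \<nu>)) = 0" for \<nu>
      using delta_X_dot[OF A that, of \<beta>] by (simp add: dot_dot S_root \<beta>)
    show "delta 3 \<beta> \<gamma> (X \<nu>) = 0" if "delta 3 \<beta> \<gamma> (X (dot \<gamma> \<nu>)) = 0" for \<nu>
      using delta_X_dot[OF A that, of \<gamma>] by (simp add: dot_dot S_root \<gamma>)
    show "delta 3 \<beta> \<gamma> (X \<nu>) = 0" if "\<mu> \<in> L" "delta 3 \<beta> \<gamma> (X (\<nu> + \<mu>)) = 0" for \<nu> \<mu>
      using delta_X_translate[OF A that(2,1)] by simp
  qed (use tr m_pos[of \<beta>] m_pos[of \<gamma>] in \<open>auto simp: pq intro!: delta_X[OF A] T_braid_X_3[OF pq]\<close>)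
qed

lemma T_braid_X_4:
  fixes \<nu>
  defines "E \<equiv> ecoef \<beta> \<nu>" and "F \<equiv> ecoef \<gamma> \<nu>"
  assumes pq: "p = 1" "q = 2" and EF: "E \<le> 0" "F \<le> 0"
    and lower: "- m \<beta> \<le> E" "- m \<gamma> \<le> 2 * E + F" "- m \<beta> \<le> E + F" "- m \<gamma> \<le> F"
  shows "alternating 4 (T \<beta>) (T \<gamma>) (X \<nu>) = alternating 4 (T \<gamma>) (T \<beta>) (X \<nu>)"
proof -
  have M: "(4 :: nat) = Suc (Suc (Suc (Suc 0)))" by simp
  have a1: "T \<beta> (cst k * X (pnt \<nu> 0 0)) =
      cst (k * tau \<beta> E) * X (pnt \<nu> (- E) 0)" for k
    by (rule T_pt; use EF lower in \<open>simp add: pq E_def[symmetric] F_def[symmetric]\<close>)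
  have a2: "T \<gamma> (cst k * X (pnt \<nu> (- E) 0)) =
      cst (k * tau \<gamma> (2 * E + F)) * X (pnt \<nu> (- E) (-2 * E - F))" for k
    by (rule T_pt; use EF lower in \<open>simp add: pq E_def[symmetric] F_def[symmetric]\<close>)
  have a3: "T \<beta> (cst k * X (pnt \<nu> (- E) (-2 * E - F))) =
      cst (k * tau \<beta> (E + F)) * X (pnt \<nu> (-2 * E - F) (-2 * E - F))" for k
    by (rule T_pt; use EF lower in \<open>simp add: pq E_def[symmetric] F_def[symmetric]\<close>)
  have a4: "T \<gamma> (cst k * X (pnt \<nu> (-2 * E - F) (-2 * E - F))) =
      cst (k * tau \<gamma> F) * X (pnt \<nu> (-2 * E - F) (-2 * E - 2 * F))" for k
    by (rule T_pt; use EF lower in \<open>simp add: pq E_def[symmetric] F_def[symmetric]\<close>)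
  have b1: "T \<gamma> (cst k * X (pnt \<nu> 0 0)) =
      cst (k * tau \<gamma> F) * X (pnt \<nu> 0 (- F))" for k
    by (rule T_pt; use EF lower in \<open>simp add: pq E_def[symmetric] F_def[symmetric]\<close>)
  have b2: "T \<beta> (cst k * X (pnt \<nu> 0 (- F))) =
      cst (k * tau \<beta> (E + F)) * X (pnt \<nu> (- E - F) (- F))" for k
    by (rule T_pt; use EF lower in \<open>simp add: pq E_def[symmetric] F_def[symmetric]\<close>)
  have b3: "T \<gamma> (cst k * X (pnt \<nu> (- E - F) (- F))) =
      cst (k * tau \<gamma> (2 * E + F)) * X (pnt \<nu> (- E - F) (-2 * E - 2 * F))" for k
    by (rule T_pt; use EF lower in \<open>simp add: pq E_def[symmetric] F_def[symmetric]\<close>)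
  have b4: "T \<beta> (cst k * X (pnt \<nu> (- E - F) (-2 * E - 2 * F))) =
      cst (k * tau \<beta> E) * X (pnt \<nu> (-2 * E - F) (-2 * E - 2 * F))" for k
    by (rule T_pt; use EF lower in \<open>simp add: pq E_def[symmetric] F_def[symmetric]\<close>)
  have "alternating 4 (T \<beta>) (T \<gamma>) (cst 1 * X (pnt \<nu> 0 0)) = alternating 4 (T \<gamma>) (T \<beta>) (cst 1 * X (pnt \<nu> 0 0))"
    by (simp only: M alternating.simps o_apply id_apply a1 a2 a3 a4 b1 b2 b3 b4)
      (simp add: mult_ac)
  then show ?thesis by (simp add: pt_zero)
qed

lemma delta_X_4:
  assumes pq: "p = 1" "q = 2" and key: "key 4 \<beta> \<gamma>"
  shows "delta 4 \<beta> \<gamma> (X \<nu>) = 0"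
proof -
  have br: "alternating 4 (s \<beta>) (s \<gamma>) \<nu> = alternating 4 (s \<gamma>) (s \<beta>) \<nu>" for \<nu>
    by (rule braid_refl) (simp add: pq)
  note A = \<beta> \<gamma> _ br key
  note tr = translation_simple(1)
    translation_refl(1)[OF translation_simple(2)]
    translation_refl(1)[OF translation_refl(2)[OF translation_simple(1)]]
    translation_refl(1)[OF translation_refl(2)[OF translation_refl(1)[OF translation_simple(2)]]]
  show ?thesis
  proof (rule descent[where a = 2 and b = 1 and R = "{(m \<beta>, 2, -2, 1, 0),
      (m \<gamma>, 1, 0, 2, 1),
      (m \<beta>, 0, 2, 1, 1),
      (m \<gamma>, -1, 2, 0, 1)}"])
    show "delta 4 \<beta> \<gamma> (X \<nu>) = 0" if "delta 4 \<beta> \<gamma> (X (dot \<beta> \<nu>)) = 0" for \<nu>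
      using delta_X_dot[OF A that, of \<beta>] by (simp add: dot_dot S_root \<beta>)
    show "delta 4 \<beta> \<gamma> (X \<nu>) = 0" if "delta 4 \<beta> \<gamma> (X (dot \<gamma> \<nu>)) = 0" for \<nu>
      using delta_X_dot[OF A that, of \<gamma>] by (simp add: dot_dot S_root \<gamma>)
    show "delta 4 \<beta> \<gamma> (X \<nu>) = 0" if "\<mu> \<in> L" "delta 4 \<beta> \<gamma> (X (\<nu> + \<mu>)) = 0" for \<nu> \<mu>
      using delta_X_translate[OF A that(2,1)] by simp
  qed (use tr m_pos[of \<beta>] m_pos[of \<gamma>] in \<open>auto simp: pq intro!: delta_X[OF A] T_braid_X_4[OF pq]\<close>)
qed

lemma T_braid_X_6:
  fixes \<nu>
  defines "E \<equiv> ecoef \<beta> \<nu>" and "F \<equiv> ecoef \<gamma> \<nu>"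
  assumes pq: "p = 1" "q = 3" and EF: "E \<le> 0" "F \<le> 0"
    and lower: "- m \<beta> \<le> E" "- m \<gamma> \<le> 3 * E + F" "- m \<beta> \<le> 2 * E + F" "- m \<gamma> \<le> 3 * E + 2 * F" "- m \<beta> \<le> E + F" "- m \<gamma> \<le> F"
  shows "alternating 6 (T \<beta>) (T \<gamma>) (X \<nu>) = alternating 6 (T \<gamma>) (T \<beta>) (X \<nu>)"
proof -
  have M: "(6 :: nat) = Suc (Suc (Suc (Suc (Suc (Suc 0)))))" by simp
  have a1: "T \<beta> (cst k * X (pnt \<nu> 0 0)) =
      cst (k * tau \<beta> E) * X (pnt \<nu> (- E) 0)" for k
    by (rule T_pt; use EF lower in \<open>simp add: pq E_def[symmetric] F_def[symmetric]\<close>)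
  have a2: "T \<gamma> (cst k * X (pnt \<nu> (- E) 0)) =
      cst (k * tau \<gamma> (3 * E + F)) * X (pnt \<nu> (- E) (-3 * E - F))" for k
    by (rule T_pt; use EF lower in \<open>simp add: pq E_def[symmetric] F_def[symmetric]\<close>)
  have a3: "T \<beta> (cst k * X (pnt \<nu> (- E) (-3 * E - F))) =
      cst (k * tau \<beta> (2 * E + F)) * X (pnt \<nu> (-3 * E - F) (-3 * E - F))" for k
    by (rule T_pt; use EF lower in \<open>simp add: pq E_def[symmetric] F_def[symmetric]\<close>)
  have a4: "T \<gamma> (cst k * X (pnt \<nu> (-3 * E - F) (-3 * E - F))) =
      cst (k * tau \<gamma> (3 * E + 2 * F)) * X (pnt \<nu> (-3 * E - F) (-6 * E - 3 * F))" for k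
    by (rule T_pt; use EF lower in \<open>simp add: pq E_def[symmetric] F_def[symmetric]\<close>)
  have a5: "T \<beta> (cst k * X (pnt \<nu> (-3 * E - F) (-6 * E - 3 * F))) =
      cst (k * tau \<beta> (E + F)) * X (pnt \<nu> (-4 * E - 2 * F) (-6 * E - 3 * F))" for k
    by (rule T_pt; use EF lower in \<open>simp add: pq E_def[symmetric] F_def[symmetric]\<close>)
  have a6: "T \<gamma> (cst k * X (pnt \<nu> (-4 * E - 2 * F) (-6 * E - 3 * F))) =
      cst (k * tau \<gamma> F) * X (pnt \<nu> (-4 * E - 2 * F) (-6 * E - 4 * F))" for k
    by (rule T_pt; use EF lower in \<open>simp add: pq E_def[symmetric] F_def[symmetric]\<close>)
  have b1: "T \<gamma> (cst k * X (pnt \<nu> 0 0)) =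
      cst (k * tau \<gamma> F) * X (pnt \<nu> 0 (- F))" for k
    by (rule T_pt; use EF lower in \<open>simp add: pq E_def[symmetric] F_def[symmetric]\<close>)
  have b2: "T \<beta> (cst k * X (pnt \<nu> 0 (- F))) =
      cst (k * tau \<beta> (E + F)) * X (pnt \<nu> (- E - F) (- F))" for k
    by (rule T_pt; use EF lower in \<open>simp add: pq E_def[symmetric] F_def[symmetric]\<close>)
  have b3: "T \<gamma> (cst k * X (pnt \<nu> (- E - F) (- F))) =
      cst (k * tau \<gamma> (3 * E + 2 * F)) * X (pnt \<nu> (- E - F) (-3 * E - 3 * F))" for k
    by (rule T_pt; use EF lower in \<open>simp add: pq E_def[symmetric] F_def[symmetric]\<close>)
  have b4: "T \<beta> (cst k * X (pnt \<nu> (- E - F) (-3 * E - 3 * F))) =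
      cst (k * tau \<beta> (2 * E + F)) * X (pnt \<nu> (-3 * E - 2 * F) (-3 * E - 3 * F))" for k
    by (rule T_pt; use EF lower in \<open>simp add: pq E_def[symmetric] F_def[symmetric]\<close>)
  have b5: "T \<gamma> (cst k * X (pnt \<nu> (-3 * E - 2 * F) (-3 * E - 3 * F))) =
      cst (k * tau \<gamma> (3 * E + F)) * X (pnt \<nu> (-3 * E - 2 * F) (-6 * E - 4 * F))" for k
    by (rule T_pt; use EF lower in \<open>simp add: pq E_def[symmetric] F_def[symmetric]\<close>)
  have b6: "T \<beta> (cst k * X (pnt \<nu> (-3 * E - 2 * F) (-6 * E - 4 * F))) =
      cst (k * tau \<beta> E) * X (pnt \<nu> (-4 * E - 2 * F) (-6 * E - 4 * F))" for k
    by (rule T_pt; use EF lower in \<open>simp add: pq E_def[symmetric] F_def[symmetric]\<close>)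
  have "alternating 6 (T \<beta>) (T \<gamma>) (cst 1 * X (pnt \<nu> 0 0)) = alternating 6 (T \<gamma>) (T \<beta>) (cst 1 * X (pnt \<nu> 0 0))"
    by (simp only: M alternating.simps o_apply id_apply a1 a2 a3 a4 a5 a6 b1 b2 b3 b4 b5 b6)
      (simp add: mult_ac)
  then show ?thesis by (simp add: pt_zero)
qed

lemma delta_X_6:
  assumes pq: "p = 1" "q = 3" and key: "key 6 \<beta> \<gamma>"
  shows "delta 6 \<beta> \<gamma> (X \<nu>) = 0"
proof -
  have br: "alternating 6 (s \<beta>) (s \<gamma>) \<nu> = alternating 6 (s \<gamma>) (s \<beta>) \<nu>" for \<nu>
    by (rule braid_refl) (simp add: pq)
  note A = \<beta> \<gamma> _ br key
  note tr = translation_simple(1)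
    translation_refl(1)[OF translation_simple(2)]
    translation_refl(1)[OF translation_refl(2)[OF translation_simple(1)]]
    translation_refl(1)[OF translation_refl(2)[OF translation_refl(1)[OF translation_simple(2)]]]
    translation_refl(1)[OF translation_refl(2)[OF translation_refl(1)[OF translation_refl(2)[OF translation_simple(1)]]]]
    translation_refl(1)[OF translation_refl(2)[OF translation_refl(1)[OF translation_refl(2)[OF translation_refl(1)[OF translation_simple(2)]]]]]
  show ?thesis
  proof (rule descent[where a = 3 and b = 1 and R = "{(m \<beta>, 2, -3, 1, 0),
      (m \<gamma>, 1, -1, 3, 1),
      (m \<beta>, 1, 0, 2, 1),
      (m \<gamma>, 0, 1, 3, 2),
      (m \<beta>, -1, 3, 1, 1),
      (m \<gamma>, -1, 2, 0, 1)}"])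
    show "delta 6 \<beta> \<gamma> (X \<nu>) = 0" if "delta 6 \<beta> \<gamma> (X (dot \<beta> \<nu>)) = 0" for \<nu>
      using delta_X_dot[OF A that, of \<beta>] by (simp add: dot_dot S_root \<beta>)
    show "delta 6 \<beta> \<gamma> (X \<nu>) = 0" if "delta 6 \<beta> \<gamma> (X (dot \<gamma> \<nu>)) = 0" for \<nu>
      using delta_X_dot[OF A that, of \<gamma>] by (simp add: dot_dot S_root \<gamma>)
    show "delta 6 \<beta> \<gamma> (X \<nu>) = 0" if "\<mu> \<in> L" "delta 6 \<beta> \<gamma> (X (\<nu> + \<mu>)) = 0" for \<nu> \<mu>
      using delta_X_translate[OF A that(2,1)] by simp
  qed (use tr m_pos[of \<beta>] m_pos[of \<gamma>] in \<open>auto simp: pq intro!: delta_X[OF A] T_braid_X_6[OF pq]\<close>)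
qed

end

section \<open>Coxeter entries and Cartan integers\<close>

context
  fixes \<beta> \<gamma> :: "'d lat" and p q :: int
  assumes \<beta>: "\<beta> \<in> S" and \<gamma>: "\<gamma> \<in> S"
    and indep: "\<And>x y. frag_cmul x \<beta> + frag_cmul y \<gamma> = 0 \<Longrightarrow> x = 0 \<and> y = 0"
    and cartan: "coroot \<beta> \<gamma> = - p" "coroot \<gamma> \<beta> = - q"
begin

lemma pt_eq_iff: "pt \<beta> \<gamma> \<nu> x y = pt \<beta> \<gamma> \<nu> x' y' \<longleftrightarrow> x = x' \<and> y = y'"
proof
  assume eq: "pt \<beta> \<gamma> \<nu> x y = pt \<beta> \<gamma> \<nu> x' y'"
  have "frag_cmul (x - x') \<beta> + frag_cmul (y - y') \<gamma> = pt \<beta> \<gamma> \<nu> x y - pt \<beta> \<gamma> \<nu> x' y'"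
    by (simp add: pt_def frag_cmul_diff_distrib)
  then show "x = x' \<and> y = y'" using eq indep[of "x - x'" "y - y'"] by simp
qed simp

text \<open>That the \<open>k\<close>-th power is the identity has to be checked at every weight;
  for minimality one moved vector is enough, and \<open>pt \<beta> \<gamma> 0 1 0\<close> is the
  root \<beta>.\<close>

lemma coxeter_entry_eqI:
  assumes "k > 0" and "\<And>\<nu>. ((s \<beta> \<circ> s \<gamma>) ^^ k) (pt \<beta> \<gamma> \<nu> 0 0) = pt \<beta> \<gamma> \<nu> 0 0"
    and "\<And>l. 0 < l \<Longrightarrow> l < k \<Longrightarrow> ((s \<beta> \<circ> s \<gamma>) ^^ l) (pt \<beta> \<gamma> 0 1 0) \<noteq> pt \<beta> \<gamma> 0 1 0"
  shows "coxeter_entry coroot \<beta> \<gamma> = k"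
  unfolding coxeter_entry_def
proof (rule Least_equality)
  show "0 < k \<and> (s \<beta> \<circ> s \<gamma>) ^^ k = id"
    using assms(1,2) by (auto simp: pt_zero)
  show "k \<le> l" if "0 < l \<and> (s \<beta> \<circ> s \<gamma>) ^^ l = id" for l
    using assms(3)[of l] that by (metis id_apply leI)
qed

lemma coxeter_entry_cartan:
  assumes M: "(p, q, M) \<in> {(0, 0, 2), (1, 1, 3), (1, 2, 4), (2, 1, 4), (1, 3, 6), (3, 1, 6)}"
  shows "coxeter_entry coroot \<beta> \<gamma> = M"
proof (rule coxeter_entry_eqI)
  note r = refl_pt[OF \<beta> \<gamma> cartan]
  show "M > 0" "((s \<beta> \<circ> s \<gamma>) ^^ M) (pt \<beta> \<gamma> \<nu> 0 0) = pt \<beta> \<gamma> \<nu> 0 0" for \<nu>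
    using M by (auto simp: eval_nat_numeral r)
  show "((s \<beta> \<circ> s \<gamma>) ^^ l) (pt \<beta> \<gamma> 0 1 0) \<noteq> pt \<beta> \<gamma> 0 1 0" if "0 < l" "l < M" for l
  proof -
    have "l \<in> {1, 2, 3, 4, 5}" using M that by auto
    then show ?thesis
      using M that(2) by (auto simp: eval_nat_numeral r coroot_zero S_root \<beta> \<gamma> pt_eq_iff)
  qed
qed

end

text \<open>
  The scaled roots \<open>m(\<alpha>)\<alpha>\<close> may form the dual of the original rank two system, so their Cartan
  integers are independent of \<open>p\<close> and \<open>q\<close> up to the product.
\<close>

lemma key_cartan:
  assumes \<beta>: "\<beta> \<in> S" "\<gamma> \<in> S"
    and indep: "\<And>x y. frag_cmul x \<beta> + frag_cmul y \<gamma> = 0 \<Longrightarrow> x = 0 \<and> y = 0"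
    and pq: "coroot \<beta> \<gamma> = - p" "coroot \<gamma> \<beta> = - q"
    and nn: "0 \<le> p" "0 \<le> q"
  shows "p * q = 0 \<Longrightarrow> p = 0 \<and> q = 0"
    and "p * q = 0 \<Longrightarrow> key 2 \<beta> \<gamma>" and "p * q = 1 \<Longrightarrow> key 3 \<beta> \<gamma>"
    and "p * q = 2 \<Longrightarrow> key 4 \<beta> \<gamma>" and "p * q = 3 \<Longrightarrow> key 6 \<beta> \<gamma>"
proof -
  note R = \<beta>[THEN S_root]
  have pQ: "p * Q \<beta> = q * Q \<gamma>"
    using B_root[OF R(1), of \<gamma>] B_root[OF R(2), of \<beta>] B_sym[of \<beta> \<gamma>] pq by simp
  \<comment> \<open>Symmetry of \<open>B\<close> gives
    \<open>p * Q \<beta> = q * Q \<gamma>\<close>; multiplied by \<open>m \<gamma>\<close> the right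
    side is divisible by \<open>n\<close>, so \<open>n_dvd_iff\<close> applies to the left.\<close>
  have "m \<beta> dvd p * m \<gamma>"
  proof -
    have "p * m \<gamma> * Q \<beta> = q * (m \<gamma> * Q \<gamma>)" using pQ by (simp add: mult_ac)
    moreover have "int n dvd m \<gamma> * Q \<gamma>" by (simp add: n_dvd_iff)
    ultimately show ?thesis by (metis dvd_mult n_dvd_iff)
  qed
  then obtain p' where p': "p * m \<gamma> = p' * m \<beta>" by (metis dvd_def mult.commute)
  have "m \<gamma> dvd q * m \<beta>"
  proof -
    have "q * m \<beta> * Q \<gamma> = p * (m \<beta> * Q \<beta>)" using pQ by (simp add: mult_ac)
    moreover have "int n dvd m \<beta> * Q \<beta>" by (simp add: n_dvd_iff)
    ultimately show ?thesis by (metis dvd_mult n_dvd_iff)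
  qed
  then obtain q' where q': "q * m \<beta> = q' * m \<gamma>" by (metis dvd_def mult.commute)
  note mp = m_pos[of \<beta>] m_pos[of \<gamma>]
  have "(p * q) * (m \<beta> * m \<gamma>) = (p * m \<gamma>) * (q * m \<beta>)" by (simp only: mult_ac)
  also have "\<dots> = (p' * q') * (m \<beta> * m \<gamma>)" unfolding p' q' by (simp only: mult_ac)
  finally have prod: "p' * q' = p * q" using mp by simp
  have "p' * m \<beta> \<ge> 0" "q' * m \<gamma> \<ge> 0" using nn mp by (simp_all flip: p' q')
  then have nn': "p' \<ge> 0" "q' \<ge> 0" using mp by (simp_all add: zero_le_mult_iff)
  show z: "p = 0 \<and> q = 0" if "p * q = 0"
    using that pQ Q_nonzero[OF \<beta>(1)] Q_nonzero[OF \<beta>(2)] by auto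
  have cartan: "s \<beta> (frag_cmul (m \<gamma>) \<gamma>) = frag_cmul (m \<gamma>) \<gamma> + frag_cmul (p' * m \<beta>) \<beta>"
    "s \<gamma> (frag_cmul (m \<beta>) \<beta>) = frag_cmul (m \<beta>) \<beta> + frag_cmul (q' * m \<gamma>) \<gamma>"
    using R pq by (simp_all add: refl_def coroot_cmul flip: p' q') (simp_all add: mult.commute)
  have indep': "\<And>x y. frag_cmul x \<gamma> + frag_cmul y \<beta> = 0 \<Longrightarrow> x = 0 \<and> y = 0"
    using indep by (metis add.commute)
  note k = key_2[OF \<beta> indep cartan] key_3[OF \<beta> indep cartan] key_4[OF \<beta> indep cartan] key_6[OF \<beta> indep cartan]
  note k' = key_4[OF \<beta>(2,1) indep' cartan(2,1)] key_6[OF \<beta>(2,1) indep' cartan(2,1)]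
  show "key 2 \<beta> \<gamma>" if "p * q = 0"
  proof -
    have "p' * m \<beta> = 0" "q' * m \<gamma> = 0" using z[OF that] by (simp_all flip: p' q')
    then show ?thesis using mp by (intro k(1)) auto
  qed
  show "key 3 \<beta> \<gamma>" if "p * q = 1"
    using that prod nn' by (intro k(2)) (auto simp: zmult_eq_1_iff)
  have prime: "p' = 1 \<and> q' = r \<or> p' = r \<and> q' = 1" if "p * q = r" "r = 2 \<or> r = 3" for r
  proof -
    have "p' \<noteq> 0" "q' \<noteq> 0" using prod that by auto
    then have "p' \<ge> 1" "q' \<ge> 1" using nn' by auto
    moreover have "p' \<le> 3" "q' \<le> 3"
      using prod that \<open>p' \<ge> 1\<close> \<open>q' \<ge> 1\<close> mult_left_mono[of 1 q' p'] mult_right_mono[of 1 p' q'] by auto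
    ultimately have "p' \<in> {1, 2, 3}" "q' \<in> {1, 2, 3}" by auto
    then show ?thesis using prod that by auto
  qed
  show "key 4 \<beta> \<gamma>" if "p * q = 2"
    using prime[OF that] k(3) key_sym[OF k'(1)] by auto
  show "key 6 \<beta> \<gamma>" if "p * q = 3"
    using prime[OF that] k(4) key_sym[OF k'(2)] by auto
qed

lemma braid_ordered:
  assumes \<beta>: "\<beta> \<in> S" "\<gamma> \<in> S"
    and pq: "coroot \<beta> \<gamma> = - p" "coroot \<gamma> \<beta> = - q"
    and key: "key M \<beta> \<gamma>" and M: "(p, q, M) \<in> {(0, 0, 2), (1, 1, 3), (1, 2, 4), (1, 3, 6)}"
  shows "alternating M (T \<beta>) (T \<gamma>) = alternating M (T \<gamma>) (T \<beta>) \<and>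
    alternating M (demazure coroot S Q n v g \<beta>) (demazure coroot S Q n v g \<gamma>) =
     alternating M (demazure coroot S Q n v g \<gamma>) (demazure coroot S Q n v g \<beta>)"
proof -
  have X: "M > 0 \<and> delta M \<beta> \<gamma> (X \<nu>) = 0" for \<nu>
    using M key delta_X_2[OF \<beta> pq, of \<nu>] delta_X_3[OF \<beta> pq, of \<nu>]
      delta_X_4[OF \<beta> pq, of \<nu>] delta_X_6[OF \<beta> pq, of \<nu>]
    by auto
  then show ?thesis
    using braid_from_X[OF \<beta> _ braid_refl[OF \<beta> pq M] key] by blast
qed

lemma braid_relation:
  assumes \<beta>: "\<beta> \<in> S" "\<gamma> \<in> S"
    and indep: "\<And>x y. frag_cmul x \<beta> + frag_cmul y \<gamma> = 0 \<Longrightarrow> x = 0 \<and> y = 0"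
    and pq: "coroot \<beta> \<gamma> = - p" "coroot \<gamma> \<beta> = - q"
    and nn: "0 \<le> p" "0 \<le> q" "p * q < 4"
    and M: "M = coxeter_entry coroot \<beta> \<gamma>"
  shows "alternating M (T \<beta>) (T \<gamma>) = alternating M (T \<gamma>) (T \<beta>) \<and>
    alternating M (demazure coroot S Q n v g \<beta>) (demazure coroot S Q n v g \<gamma>) =
     alternating M (demazure coroot S Q n v g \<gamma>) (demazure coroot S Q n v g \<beta>)"
proof -
  have k1: "p * q = 0 \<Longrightarrow> p = 0 \<and> q = 0"
    by (rule key_cartan(1)[OF \<beta> indep pq nn(1,2)])
  have k2: "p * q = 0 \<Longrightarrow> key 2 \<beta> \<gamma>"
    by (rule key_cartan(2)[OF \<beta> indep pq nn(1,2)])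
  have k3: "p * q = 1 \<Longrightarrow> key 3 \<beta> \<gamma>"
    by (rule key_cartan(3)[OF \<beta> indep pq nn(1,2)])
  have k4: "p * q = 2 \<Longrightarrow> key 4 \<beta> \<gamma>"
    by (rule key_cartan(4)[OF \<beta> indep pq nn(1,2)])
  have k5: "p * q = 3 \<Longrightarrow> key 6 \<beta> \<gamma>"
    by (rule key_cartan(5)[OF \<beta> indep pq nn(1,2)])
  have "(p, q) \<in> {(0, 0), (1, 1), (1, 2), (1, 3), (2, 1), (3, 1)}"
  proof (cases "p * q = 0")
    case False
    then have "p \<ge> 1" "q \<ge> 1" using nn by (auto simp: order_le_less)
    have "p * 1 \<le> p * q" by (rule mult_left_mono) fact+
    moreover have "1 * q \<le> p * q" by (rule mult_right_mono) fact+
    ultimately have "p \<le> 3" "q \<le> 3" using nn(3) by linarith+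
    then have "p \<in> {1, 2, 3}" "q \<in> {1, 2, 3}" using \<open>p \<ge> 1\<close> \<open>q \<ge> 1\<close> by auto
    then show ?thesis using nn(3) by auto
  next
    case True
    from k1[OF this] show ?thesis by simp
  qed
  then obtain l :: nat where "(p, q, l) \<in> {(0, 0, 2), (1, 1, 3), (1, 2, 4), (2, 1, 4), (1, 3, 6), (3, 1, 6)}"
    by auto
  then have pqM: "(p, q, M) \<in> {(0, 0, 2), (1, 1, 3), (1, 2, 4), (2, 1, 4), (1, 3, 6), (3, 1, 6)}"
    using coxeter_entry_cartan[OF \<beta> indep pq, of l] M by simp
  then have key: "key M \<beta> \<gamma>"
    using k2 k3 k4 k5 by auto
  \<comment> \<open>The alcove computations cover one orientation of each type; exchanging the roots
    in the other orientation only swaps the two sides.\<close>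
  consider "(p, q, M) \<in> {(0, 0, 2), (1, 1, 3), (1, 2, 4), (1, 3, 6)}" | "(q, p, M) \<in> {(0, 0, 2), (1, 1, 3), (1, 2, 4), (1, 3, 6)}"
    using pqM by auto
  then show ?thesis
  proof cases
    case 1
    then show ?thesis by (rule braid_ordered[OF \<beta> pq key])
  next
    case 2
    from braid_ordered[OF \<beta>(2,1) pq(2,1) key_sym[OF key] this] show ?thesis
      by (elim conjE) (intro conjI; rule sym; assumption)
  qed
qed

text \<open>
  Reflecting alternately would otherwise produce infinitely many roots \<open>x\<beta> + y\<gamma>\<close>: beyond one of
  the two isotropic lines, \<open>x + y\<close> grows.
\<close>

lemma cartan_product_less_4:
  assumes \<beta>: "\<beta> \<in> \<Phi>" "\<gamma> \<in> \<Phi>"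
    and indep: "\<And>x y. frag_cmul x \<beta> + frag_cmul y \<gamma> = 0 \<Longrightarrow> x = 0 \<and> y = 0"
    and pq: "coroot \<beta> \<gamma> = - p" "coroot \<gamma> \<beta> = - q"
    and nn: "0 \<le> p" "0 \<le> q"
  shows "p * q < 4"
proof (rule ccontr)
  assume "\<not> p * q < 4"
  then have 4: "p * q \<ge> 4" by simp
  then have p: "p \<ge> 1" "q \<ge> 1" using nn by (auto simp: order_le_less)
  define f where "f = (\<lambda>(x, y). frag_cmul x \<beta> + frag_cmul y \<gamma>)"
  define A where "A = {(x, y). f (x, y) \<in> \<Phi> \<and> x > 0 \<and> y > 0 \<and> (2 * x > p * y \<or> 2 * y > q * x)}"
  have "inj f"
  proof (rule injI, clarify)
    fix x y x' y' assume "f (x, y) = f (x', y')"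
    then have "frag_cmul (x - x') \<beta> + frag_cmul (y - y') \<gamma> = 0"
      by (simp add: f_def frag_cmul_diff_distrib algebra_simps)
    then show "x = x' \<and> y = y'" using indep by force
  qed
  moreover have "finite \<Phi>" using root_system by (simp add: root_system_def)
  moreover have "A \<subseteq> f -` \<Phi>" by (auto simp: A_def)
  ultimately have fin: "finite A" by (meson finite_subset finite_vimageI)
  have s1: "f (p * y - x, y) \<in> \<Phi>" if "f (x, y) \<in> \<Phi>" for x y
  proof -
    have "s \<beta> (f (x, y)) = f (p * y - x, y)"
      by (intro poly_mapping_eqI) (simp add: refl_def f_def coroot_add coroot_cmul coroot_self \<beta> pq lookup_add lookup_minus algebra_simps)
    then show ?thesis using refl_root[OF \<beta>(1) that] by simp
  qed
  have s2: "f (x, q * x - y) \<in> \<Phi>" if "f (x, y) \<in> \<Phi>" for x y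
  proof -
    have "s \<gamma> (f (x, y)) = f (x, q * x - y)"
      by (intro poly_mapping_eqI) (simp add: refl_def f_def coroot_add coroot_cmul coroot_self \<beta> pq lookup_add lookup_minus algebra_simps)
    then show ?thesis using refl_root[OF \<beta>(2) that] by simp
  qed
  have step1: "\<exists>z\<in>A. fst z + snd z > x + y" if "(x, y) \<in> A" "2 * x > p * y" for x y
  proof -
    have xy: "x > 0" "y > 0" using that by (auto simp: A_def)
    \<comment> \<open>Since p q \<ge> 4, a point on the growing side of one line lies on the
      shrinking side of the other; reflecting there increases y and leads to the growing side of the
      second line.\<close>
    have "q * (2 * x) > q * (p * y)" using that(2) p by (intro mult_strict_left_mono) auto
    moreover have "(p * q) * y \<ge> 4 * y" using 4 xy by (intro mult_right_mono) auto
    ultimately have "2 * y < q * x" by (simp add: mult_ac)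
    then have "(x, q * x - y) \<in> A" using that s2[of x y] xy by (auto simp: A_def)
    then show ?thesis using \<open>2 * y < q * x\<close> by (intro bexI) auto
  qed
  have step2: "\<exists>z\<in>A. fst z + snd z > x + y" if "(x, y) \<in> A" "2 * y > q * x" for x y
  proof -
    have xy: "x > 0" "y > 0" using that by (auto simp: A_def)
    have "p * (2 * y) > p * (q * x)" using that(2) p by (intro mult_strict_left_mono) auto
    moreover have "(p * q) * x \<ge> 4 * x" using 4 xy by (intro mult_right_mono) auto
    ultimately have "2 * x < p * y" by (simp add: mult_ac)
    then have "(p * y - x, y) \<in> A" using that s1[of x y] xy by (auto simp: A_def)
    then show ?thesis using \<open>2 * x < p * y\<close> by (intro bexI) auto
  qed
  \<comment> \<open>The starting point is the reflection of \<gamma> in \<beta>.\<close>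
  have "f (p, 1) \<in> \<Phi>" using s1[of 0 1] \<beta> by (simp add: f_def)
  then have "(p, 1) \<in> A" using p by (simp add: A_def)
  then have "A \<noteq> {}" by auto
  then have "Max ((\<lambda>z. fst z + snd z) ` A) \<in> (\<lambda>z. fst z + snd z) ` A" using fin by (intro Max_in) auto
  then obtain z where z: "z \<in> A" "Max ((\<lambda>z. fst z + snd z) ` A) = fst z + snd z" by auto
  obtain x y where xy: "z = (x, y)" by (cases z)
  from z(1) have "2 * x > p * y \<or> 2 * y > q * x" by (auto simp: A_def xy)
  then obtain z' where "z' \<in> A" "fst z' + snd z' > x + y"
    using step1 step2 z(1) xy by blast
  then show False using Max_ge[of "(\<lambda>z. fst z + snd z) ` A" "fst z' + snd z'"] fin z(2) xy by simp
qed

end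

lemma frag_cmul_uminus_diff: "a - frag_cmul (- k) b = a + frag_cmul k b"
  by (rule poly_mapping_eqI) (simp add: lookup_add lookup_minus)

subsection \<open>The braid relations\<close>

text \<open>The coefficients of a root in the simple roots are unique and have one sign. Here the
  coefficient at \<open>\<alpha> j\<close> is 1, so the one at \<open>\<alpha> i\<close> cannot be
  negative; applied to a reflected simple root, this gives the sign of the Cartan integers.\<close>

lemma simple_roots_pair:
  assumes sr: "simple_roots \<Phi> r \<alpha>" and ij: "i \<in> {1..r}" "j \<in> {1..r}" "i \<noteq> j"
  shows "frag_cmul x (\<alpha> i) + frag_cmul y (\<alpha> j) = 0 \<Longrightarrow> x = 0 \<and> y = 0"
    and "frag_cmul x (\<alpha> i) + \<alpha> j \<in> \<Phi> \<Longrightarrow> 0 \<le> x"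
proof -
  have ind: "\<And>c. (\<Sum>i=1..r. frag_cmul (c i) (\<alpha> i)) = 0 \<Longrightarrow> (\<forall>i\<in>{1..r}. c i = 0)"
    and sgn: "\<And>\<beta>. \<beta> \<in> \<Phi> \<Longrightarrow> \<exists>c. \<beta> = (\<Sum>i=1..r. frag_cmul (c i) (\<alpha> i)) \<and>
       ((\<forall>i\<in>{1..r}. 0 \<le> c i) \<or> (\<forall>i\<in>{1..r}. c i \<le> 0))"
    using sr unfolding simple_roots_def by blast+
  define c where "c x y k = (if k = i then x else if k = j then y else (0::int))" for x y k
  have c: "(\<Sum>k=1..r. frag_cmul (c x y k) (\<alpha> k)) = frag_cmul x (\<alpha> i) + frag_cmul y (\<alpha> j)" for x y
  proof -
    have "(\<Sum>k=1..r. frag_cmul (c x y k) (\<alpha> k)) = (\<Sum>k\<in>{i, j}. frag_cmul (c x y k) (\<alpha> k))"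
      using ij by (intro sum.mono_neutral_right) (auto simp: c_def)
    then show ?thesis using ij(3) by (simp add: c_def)
  qed
  show "x = 0 \<and> y = 0" if "frag_cmul x (\<alpha> i) + frag_cmul y (\<alpha> j) = 0"
  proof -
    have "(\<Sum>k=1..r. frag_cmul (c x y k) (\<alpha> k)) = 0" using c[of x y] that by (rule trans)
    then have "\<forall>k\<in>{1..r}. c x y k = 0" by (rule ind)
    then have "c x y i = 0" "c x y j = 0" using ij by auto
    then show ?thesis using ij by (simp add: c_def)
  qed
  show "0 \<le> x" if root: "frag_cmul x (\<alpha> i) + \<alpha> j \<in> \<Phi>"
  proof -
    obtain d where d: "frag_cmul x (\<alpha> i) + \<alpha> j = (\<Sum>k=1..r. frag_cmul (d k) (\<alpha> k))"
      "(\<forall>i\<in>{1..r}. 0 \<le> d i) \<or> (\<forall>i\<in>{1..r}. d i \<le> 0)"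
      using sgn[OF root] by blast
    have "(\<Sum>k=1..r. frag_cmul (c x 1 k - d k) (\<alpha> k)) = 0"
      using c[of x 1] d(1) by (simp add: frag_cmul_diff_distrib sum_subtractf)
    then have "\<forall>k\<in>{1..r}. c x 1 k - d k = 0" by (rule ind)
    then have "c x 1 i - d i = 0" "c x 1 j - d j = 0" using ij by auto
    then have "d i = x" "d j = 1" using ij by (auto simp: c_def)
    then show ?thesis using d(2) ij by force
  qed
qed

theorem proposition7:
  fixes \<Phi> :: "'d::{finite,linorder} lat set"
    and coroot :: "'d lat \<Rightarrow> 'd lat \<Rightarrow> int"
    and r :: nat and \<alpha> :: "nat \<Rightarrow> 'd lat"
    and Q :: "'d lat \<Rightarrow> int"
    and n :: nat and v :: complex and g :: "nat \<Rightarrow> complex"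
    and D T :: "nat \<Rightarrow> 'd ratfun \<Rightarrow> 'd ratfun"
    and i j :: nat
  assumes "root_system \<Phi> coroot" and "reduced \<Phi>" and "irreducible_roots \<Phi> coroot"
    and "simple_roots \<Phi> r \<alpha>"
    and "quadratic_form Q"
    and "\<forall>w\<in>weyl_group \<Phi> coroot. \<forall>\<nu>. Q (w \<nu>) = Q \<nu>"
    and "\<forall>i\<in>{1..r}. Q (\<alpha> i) \<noteq> 0"
    and "n > 0"
    and "v \<noteq> 0" and "\<forall>i<n. g i \<noteq> 0" and "g 0 = -1"
    and "\<forall>i\<in>{1..n - 1}. g i * g (n - i) = inverse v"
    and "\<And>i. D i = demazure coroot (\<alpha> ` {1..r}) Q n v g (\<alpha> i)"
    and "\<And>i. T i = demazure_lusztig coroot (\<alpha> ` {1..r}) Q n v g (\<alpha> i)"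
    and "i \<in> {1..r}" and "j \<in> {1..r}"
  shows "alternating (coxeter_entry coroot (\<alpha> i) (\<alpha> j)) (D i) (D j) =
           alternating (coxeter_entry coroot (\<alpha> i) (\<alpha> j)) (D j) (D i) \<and>
         alternating (coxeter_entry coroot (\<alpha> i) (\<alpha> j)) (T i) (T j) =
           alternating (coxeter_entry coroot (\<alpha> i) (\<alpha> j)) (T j) (T i)"
proof (cases "i = j")
  case False
  interpret metaplectic_data \<Phi> coroot "\<alpha> ` {1..r}" Q n v g
    using assms(1,4-12) by unfold_locales (auto simp: simple_roots_def)
  note pair = simple_roots_pair[OF assms(4,15,16) False] simple_roots_pair[OF assms(4,16,15) False[symmetric]]
  have S: "\<alpha> i \<in> \<alpha> ` {1..r}" "\<alpha> j \<in> \<alpha> ` {1..r}" using assms(15,16) by auto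
  note R = S[THEN S_root]
  define p q where "p = - coroot (\<alpha> i) (\<alpha> j)" and "q = - coroot (\<alpha> j) (\<alpha> i)"
  have pq: "coroot (\<alpha> i) (\<alpha> j) = - p" "coroot (\<alpha> j) (\<alpha> i) = - q"
    by (simp_all add: p_def q_def)
  have "frag_cmul p (\<alpha> i) + \<alpha> j \<in> \<Phi>" "frag_cmul q (\<alpha> j) + \<alpha> i \<in> \<Phi>"
    using refl_root[OF R] refl_root[OF R(2,1)] by (simp_all add: refl_def pq add.commute frag_cmul_uminus_diff)
  then have nn: "0 \<le> p" "0 \<le> q" using pair(2,4) by auto
  show ?thesis
    unfolding assms(13,14)
    using braid_relation[OF S pair(1) pq nn cartan_product_less_4[OF R pair(1) pq nn] refl] by blast
qed simp

end
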